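(* Let $\mathfrak{g}=\mathfrak{g}_{\bar 0}+\mathfrak{g}_{\bar 1}$ be a real basic classical Lie superalgebra whose Killing form $\mathbf{K}$ is non-degenerate, with $\mathfrak{g}_{\bar 0}=\mathfrak{k}_0\oplus\mathfrak{k}_1\oplus\cdots\oplus\mathfrak{k}_s$, where $\mathfrak{k}_0$ is Abelian and $\mathfrak{k}_1,\dots,\mathfrak{k}_s$ are simple ideals. Let $x_0,\dots,x_s\in\mathbb{R}\setminus\{0\}$, let $$\langle\cdot,\cdot\rangle=x_0\mathbf{K}|_{\mathfrak{k}_0}+x_1\mathbf{K}|_{\mathfrak{k}_1}+\cdots+x_s\mathbf{K}|_{\mathfrak{k}_s}+\mathbf{K}|_{\mathfrak{g}_{\bar 1}},$$ let $c\in\mathbb{R}$, and let $l_i$ be the index of the representation of $\mathfrak{k}_i$ on $\mathfrak{g}_{\bar 1}$, $1\le i\le s$. Then $\langle\cdot,\cdot\rangle$ is Einstein with $\mathrm{ric}=c\langle\cdot,\cdot\rangle$ if and only if $$\left\{\begin{aligned}&c=-\frac{x_0}{4},\quad\text{if }\mathfrak{k}_0\ne0,\\ &\frac14(l_ix_i^2-1)=c(1-l_i)x_i,\quad 1\le i\le s,\\ &-\frac{\dim\mathfrak{k}_0}{\dim\mathfrak{g}_{\bar 1}}x_0+\sum_{i=1}^{s}\frac{l_i\dim\mathfrak{k}_i}{(1-l_i)\dim\mathfrak{g}_{\bar 1}}x_i=2c+1.\end{aligned}\right.$$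
   Context: Lie superalgebras are finite dimensional with $\mathfrak{g}_{\bar 1}\ne 0$; $[X]\in\mathbb{Z}_2$ is the parity of a homogeneous element $X$, and formulas are written for homogeneous elements. All dimensions are real dimensions. A bilinear form $f$ is even if $f(\mathfrak{g}_{\bar 0},\mathfrak{g}_{\bar 1})=0$, supersymmetric if $f(X,Y)=(-1)^{[X][Y]}f(Y,X)$, bi-invariant if $f([X,Y],Z)=f(X,[Y,Z])$. A metric on $\mathfrak{g}$ is a non-degenerate even supersymmetric bilinear form. $\mathfrak{g}$ is basic classical if it is simple, the representation of $\mathfrak{g}_{\bar 0}$ on $\mathfrak{g}_{\bar 1}$ is completely reducible, and it admits a non-degenerate even supersymmetric bi-invariant bilinear form; then $\mathfrak{g}_{\bar 0}$ is reductive. Killing form: $\mathbf{K}(X,Y)=\mathrm{str}(\mathrm{ad}X\circ\mathrm{ad}Y)$, where $\mathrm{str}$ is the supertrace (trace of the even-even block minus trace of the odd-odd block); it is even, supersymmetric and bi-invariant. Index: $l_i\in\mathbb{R}$ is the constant with $\mathrm{tr}(\mathrm{ad}X\circ\mathrm{ad}Y|_{\mathfrak{g}_{\bar 1}})=l_i\mathbf{K}_i(X,Y)$ for all $X,Y\in\mathfrak{k}_i$, where $\mathbf{K}_i$ is the Killing form of $\mathfrak{k}_i$. One has $\mathbf{K}|_{\mathfrak{k}_i}=(1-l_i)\mathbf{K}_i$, so $l_i\ne 1$ when $\mathbf{K}$ is non-degenerate. The Levi-Civita connection $\nabla$ of a metric is the unique even bilinear map with $\langle\nabla_XY,Z\rangle+(-1)^{[X][Y]}\langle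 Y,\nabla_XZ\rangle=0$ and $\nabla_XY-(-1)^{[X][Y]}\nabla_YX=[X,Y]$. The curvature is $R(X,Y)Z=\nabla_X\nabla_YZ-(-1)^{[X][Y]}\nabla_Y\nabla_XZ-\nabla_{[X,Y]}Z$, and $\mathrm{ric}(X,Y)=\mathrm{str}(Z\mapsto R(Z,X)Y)$. *)

theory Defs
  imports "HOL-Analysis.Analysis" "HOL-Library.Z2"
begin

section \<open>Linear algebra on subspaces\<close>

text \<open>
  Internal direct sum \<open>W = \<Oplus>\<^sub>i V\<^sub>i\<close> over a finite index set: every vector of \<open>W\<close> is the sum of
  exactly one family of vectors \<open>f i \<in> V i\<close>.
\<close>

definition direct_sum :: "'i set \<Rightarrow> ('i \<Rightarrow> 'a::real_vector set) \<Rightarrow> 'a set \<Rightarrow> bool" where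
  "direct_sum I V W \<longleftrightarrow>
     finite I \<and> (\<forall>i\<in>I. subspace (V i)) \<and> bij_betw (\<lambda>f. sum f I) (Pi\<^sub>E I V) W"

definition component :: "'i set \<Rightarrow> ('i \<Rightarrow> 'a::real_vector set) \<Rightarrow> 'i \<Rightarrow> 'a \<Rightarrow> 'a" where
  "component I V i x = inv_into (Pi\<^sub>E I V) (\<lambda>f. sum f I) x i"

text \<open>
  Trace of an endomorphism of a finite-dimensional subspace \<open>V\<close>: the sum of the diagonal entries
  of its matrix with respect to some basis of \<open>V\<close> (the value does not depend on the basis).  It is
  only meaningful if \<open>T\<close> is linear on \<open>V\<close> and maps \<open>V\<close> into \<open>V\<close>.
\<close>

definition trace_on :: "'a::real_vector set \<Rightarrow> ('a \<Rightarrow> 'a) \<Rightarrow> real" where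
  "trace_on V T =
     (let B = (SOME B. independent B \<and> span B = V) in \<Sum>b\<in>B. representation B (T b) b)"

definition nondegenerate :: "('a::real_vector \<Rightarrow> 'a \<Rightarrow> real) \<Rightarrow> bool" where
  "nondegenerate f \<longleftrightarrow> (\<forall>X. (\<forall>Y. f X Y = 0) \<longrightarrow> X = 0)"

section \<open>Superspaces\<close>

text \<open>
  A superspace is a type \<open>'a\<close> together with a grading \<open>gr :: bit \<Rightarrow> 'a set\<close>, where \<open>bit\<close> is the field
  with two elements; \<open>gr 0\<close> is the even and \<open>gr 1\<close> the odd part.
\<close>

abbreviation part :: "(bit \<Rightarrow> 'a::real_vector set) \<Rightarrow> bit \<Rightarrow> 'a \<Rightarrow> 'a" where
  "part gr \<equiv> component UNIV gr"

text \<open>The sign \<open>(-1)\<^sup>p\<^sup>q\<close>.\<close>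

definition sgn2 :: "bit \<Rightarrow> bit \<Rightarrow> real" where
  "sgn2 p q = (if p = 1 \<and> q = 1 then -1 else 1)"

definition supertrace :: "(bit \<Rightarrow> 'a::real_vector set) \<Rightarrow> ('a \<Rightarrow> 'a) \<Rightarrow> real" where
  "supertrace gr T = trace_on (gr 0) (part gr 0 \<circ> T) - trace_on (gr 1) (part gr 1 \<circ> T)"

definition even_form :: "(bit \<Rightarrow> 'a::real_vector set) \<Rightarrow> ('a \<Rightarrow> 'a \<Rightarrow> real) \<Rightarrow> bool" where
  "even_form gr f \<longleftrightarrow> (\<forall>X\<in>gr 0. \<forall>Y\<in>gr 1. f X Y = 0)"

definition supersymmetric :: "(bit \<Rightarrow> 'a::real_vector set) \<Rightarrow> ('a \<Rightarrow> 'a \<Rightarrow> real) \<Rightarrow> bool" where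
  "supersymmetric gr f \<longleftrightarrow> (\<forall>p q. \<forall>X\<in>gr p. \<forall>Y\<in>gr q. f X Y = sgn2 p q * f Y X)"

definition is_metric :: "(bit \<Rightarrow> 'a::real_vector set) \<Rightarrow> ('a \<Rightarrow> 'a \<Rightarrow> real) \<Rightarrow> bool" where
  "is_metric gr f \<longleftrightarrow> bilinear f \<and> even_form gr f \<and> supersymmetric gr f \<and> nondegenerate f"

definition even_map :: "(bit \<Rightarrow> 'a::real_vector set) \<Rightarrow> ('a \<Rightarrow> 'a \<Rightarrow> 'a) \<Rightarrow> bool" where
  "even_map gr m \<longleftrightarrow> (\<forall>p q. \<forall>X\<in>gr p. \<forall>Y\<in>gr q. m X Y \<in> gr (p + q))"

section \<open>Lie superalgebras\<close>

locale lie_superalgebra =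
  fixes gr :: "bit \<Rightarrow> 'a::real_vector set"
    and br :: "'a \<Rightarrow> 'a \<Rightarrow> 'a"
  assumes finite_dim: "\<exists>B. finite B \<and> span B = (UNIV :: 'a set)"
    and grading: "direct_sum UNIV gr UNIV"
    and odd_nonzero: "gr 1 \<noteq> {0}"
    and bilinear: "bilinear br"
    and even: "even_map gr br"
    and super_skew: "\<And>p q X Y. X \<in> gr p \<Longrightarrow> Y \<in> gr q \<Longrightarrow> br X Y = - (sgn2 p q *\<^sub>R br Y X)"
    and super_jacobi: "\<And>p q X Y Z. X \<in> gr p \<Longrightarrow> Y \<in> gr q \<Longrightarrow>
          br X (br Y Z) = br (br X Y) Z + sgn2 p q *\<^sub>R br Y (br X Z)"

text \<open>
  \<open>lie_ideal br L I\<close>: \<open>I\<close> is an ideal of the subalgebra \<open>L\<close>.  One-sided absorption suffices, because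
  the predicate is used only for ordinary Lie algebras and for graded subspaces.
\<close>

definition lie_ideal :: "('a::real_vector \<Rightarrow> 'a \<Rightarrow> 'a) \<Rightarrow> 'a set \<Rightarrow> 'a set \<Rightarrow> bool" where
  "lie_ideal br L I \<longleftrightarrow> subspace I \<and> I \<subseteq> L \<and> (\<forall>X\<in>L. \<forall>Y\<in>I. br X Y \<in> I)"

definition graded_subspace :: "(bit \<Rightarrow> 'a::real_vector set) \<Rightarrow> 'a set \<Rightarrow> bool" where
  "graded_subspace gr U \<longleftrightarrow> subspace U \<and> (\<forall>X\<in>U. \<forall>p. part gr p X \<in> U)"

definition abelian_lie :: "('a::real_vector \<Rightarrow> 'a \<Rightarrow> 'a) \<Rightarrow> 'a set \<Rightarrow> bool" where
  "abelian_lie br L \<longleftrightarrow> (\<forall>X\<in>L. \<forall>Y\<in>L. br X Y = 0)"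

definition simple_lie :: "('a::real_vector \<Rightarrow> 'a \<Rightarrow> 'a) \<Rightarrow> 'a set \<Rightarrow> bool" where
  "simple_lie br L \<longleftrightarrow> \<not> abelian_lie br L \<and> (\<forall>I. lie_ideal br L I \<longrightarrow> I = {0} \<or> I = L)"

definition simple_superalgebra ::
    "(bit \<Rightarrow> 'a::real_vector set) \<Rightarrow> ('a \<Rightarrow> 'a \<Rightarrow> 'a) \<Rightarrow> bool" where
  "simple_superalgebra gr br \<longleftrightarrow> \<not> abelian_lie br UNIV \<and>
     (\<forall>I. graded_subspace gr I \<and> lie_ideal br UNIV I \<longrightarrow> I = {0} \<or> I = UNIV)"

text \<open>Complete reducibility of the representation of \<open>L\<close> on \<open>V\<close> by \<open>br\<close>.\<close>

definition invariant_subspace ::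
    "('a::real_vector \<Rightarrow> 'a \<Rightarrow> 'a) \<Rightarrow> 'a set \<Rightarrow> 'a set \<Rightarrow> 'a set \<Rightarrow> bool" where
  "invariant_subspace br L V U \<longleftrightarrow> subspace U \<and> U \<subseteq> V \<and> (\<forall>X\<in>L. \<forall>Y\<in>U. br X Y \<in> U)"

definition completely_reducible ::
    "('a::real_vector \<Rightarrow> 'a \<Rightarrow> 'a) \<Rightarrow> 'a set \<Rightarrow> 'a set \<Rightarrow> bool" where
  "completely_reducible br L V \<longleftrightarrow>
     (\<forall>U. invariant_subspace br L V U \<longrightarrow>
        (\<exists>W. invariant_subspace br L V W \<and> U \<inter> W = {0} \<and> {u + w | u w. u \<in> U \<and> w \<in> W} = V))"

definition bi_invariant ::
    "('a::real_vector \<Rightarrow> 'a \<Rightarrow> 'a) \<Rightarrow> ('a \<Rightarrow> 'a \<Rightarrow> real) \<Rightarrow> bool" where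
  "bi_invariant br f \<longleftrightarrow> (\<forall>X Y Z. f (br X Y) Z = f X (br Y Z))"

definition basic_classical ::
    "(bit \<Rightarrow> 'a::real_vector set) \<Rightarrow> ('a \<Rightarrow> 'a \<Rightarrow> 'a) \<Rightarrow> bool" where
  "basic_classical gr br \<longleftrightarrow>
     lie_superalgebra gr br \<and> simple_superalgebra gr br \<and> completely_reducible br (gr 0) (gr 1) \<and>
     (\<exists>f. bilinear f \<and> even_form gr f \<and> supersymmetric gr f \<and> nondegenerate f \<and> bi_invariant br f)"

definition super_killing ::
    "(bit \<Rightarrow> 'a::real_vector set) \<Rightarrow> ('a \<Rightarrow> 'a \<Rightarrow> 'a) \<Rightarrow> 'a \<Rightarrow> 'a \<Rightarrow> real" where
  "super_killing gr br X Y = supertrace gr (br X \<circ> br Y)"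

text \<open>The trace form of the action on \<open>V\<close>; for \<open>V = L\<close> it is the Killing form of \<open>L\<close>.\<close>

definition trace_form ::
    "('a::real_vector \<Rightarrow> 'a \<Rightarrow> 'a) \<Rightarrow> 'a set \<Rightarrow> 'a \<Rightarrow> 'a \<Rightarrow> real" where
  "trace_form br V X Y = trace_on V (br X \<circ> br Y)"

definition is_index ::
    "('a::real_vector \<Rightarrow> 'a \<Rightarrow> 'a) \<Rightarrow> 'a set \<Rightarrow> 'a set \<Rightarrow> real \<Rightarrow> bool" where
  "is_index br L V l \<longleftrightarrow> (\<forall>X\<in>L. \<forall>Y\<in>L. trace_form br V X Y = l * trace_form br L X Y)"

section \<open>Levi-Civita connection and Ricci curvature\<close>

definition is_levi_civita ::
    "(bit \<Rightarrow> 'a::real_vector set) \<Rightarrow> ('a \<Rightarrow> 'a \<Rightarrow> 'a) \<Rightarrow> ('a \<Rightarrow> 'a \<Rightarrow> real) \<Rightarrow>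
     ('a \<Rightarrow> 'a \<Rightarrow> 'a) \<Rightarrow> bool" where
  "is_levi_civita gr br g D \<longleftrightarrow>
     bilinear D \<and> even_map gr D \<and>
     (\<forall>p q r. \<forall>X\<in>gr p. \<forall>Y\<in>gr q. \<forall>Z\<in>gr r. g (D X Y) Z + sgn2 p q * g Y (D X Z) = 0) \<and>
     (\<forall>p q. \<forall>X\<in>gr p. \<forall>Y\<in>gr q. D X Y - sgn2 p q *\<^sub>R D Y X = br X Y)"

definition levi_civita ::
    "(bit \<Rightarrow> 'a::real_vector set) \<Rightarrow> ('a \<Rightarrow> 'a \<Rightarrow> 'a) \<Rightarrow> ('a \<Rightarrow> 'a \<Rightarrow> real) \<Rightarrow> 'a \<Rightarrow> 'a \<Rightarrow> 'a" where
  "levi_civita gr br g = (THE D. is_levi_civita gr br g D)"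

text \<open>
  The multilinear extension of
  \<open>R(X,Y)Z = \<nabla>\<^sub>X\<nabla>\<^sub>YZ - (-1)\<^bsup>[X][Y]\<^esup>\<nabla>\<^sub>Y\<nabla>\<^sub>XZ - \<nabla>\<^bsub>[X,Y]\<^esub>Z\<close> from homogeneous to arbitrary vectors; only the
  middle term, which carries a sign, has to be split into homogeneous parts.
\<close>

definition curvature ::
    "(bit \<Rightarrow> 'a::real_vector set) \<Rightarrow> ('a \<Rightarrow> 'a \<Rightarrow> 'a) \<Rightarrow> ('a \<Rightarrow> 'a \<Rightarrow> real) \<Rightarrow>
     'a \<Rightarrow> 'a \<Rightarrow> 'a \<Rightarrow> 'a" where
  "curvature gr br g X Y Z =
     (let D = levi_civita gr br g in
        D X (D Y Z)
        - (\<Sum>p\<in>UNIV. \<Sum>q\<in>UNIV. sgn2 p q *\<^sub>R D (part gr q Y) (D (part gr p X) Z))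
        - D (br X Y) Z)"

definition ricci ::
    "(bit \<Rightarrow> 'a::real_vector set) \<Rightarrow> ('a \<Rightarrow> 'a \<Rightarrow> 'a) \<Rightarrow> ('a \<Rightarrow> 'a \<Rightarrow> real) \<Rightarrow> 'a \<Rightarrow> 'a \<Rightarrow> real" where
  "ricci gr br g X Y = supertrace gr (\<lambda>Z. curvature gr br g Z X Y)"

definition einstein ::
    "(bit \<Rightarrow> 'a::real_vector set) \<Rightarrow> ('a \<Rightarrow> 'a \<Rightarrow> 'a) \<Rightarrow> ('a \<Rightarrow> 'a \<Rightarrow> real) \<Rightarrow> real \<Rightarrow> bool" where
  "einstein gr br g c \<longleftrightarrow> is_metric gr g \<and> (\<forall>X Y. ricci gr br g X Y = c * g X Y)"

text \<open>
  The form \<open>x\<^sub>0 K|\<^bsub>k\<^sub>0\<^esub> + \<dots> + x\<^sub>s K|\<^bsub>k\<^sub>s\<^esub> + K|\<^bsub>g\<^sub>1\<^esub>\<close> for \<open>g\<^sub>0 = k\<^sub>0 \<oplus> \<dots> \<oplus> k\<^sub>s\<close>, each restriction being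
  extended by zero to the other summands.
\<close>

definition rescaled_killing ::
    "(bit \<Rightarrow> 'a::real_vector set) \<Rightarrow> ('a \<Rightarrow> 'a \<Rightarrow> 'a) \<Rightarrow> (nat \<Rightarrow> 'a set) \<Rightarrow> nat \<Rightarrow> (nat \<Rightarrow> real) \<Rightarrow>
     'a \<Rightarrow> 'a \<Rightarrow> real" where
  "rescaled_killing gr br k s x X Y =
     (\<Sum>i=0..s. x i * super_killing gr br (component {0..s} k i (part gr 0 X))
                                          (component {0..s} k i (part gr 0 Y)))
     + super_killing gr br (part gr 1 X) (part gr 1 Y)"

end

theory Submission
  imports Defs "HOL-Computational_Algebra.Fundamental_Theorem_Algebra"
begin

text \<open>
  Write the metric as \<open>K(A X, Y)\<close>, where \<open>A\<close> is \<open>x\<^sub>i\<close> on \<open>k\<^sub>i\<close> and the identity on \<open>g\<^sub>1\<close>.  Its Levi-Civita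
  connection is \<open>\<nabla>\<^sub>X Y = ([X,Y] + [X,A Y] - [A X,Y]) / 2\<close>, and a direct computation gives
  \<open>ric(X,Y) = (tr\<^sub>1(ad(A X) ad(A Y)) - tr\<^sub>0(ad X ad Y)) / 4\<close> on \<open>g\<^sub>0\<close> and
  \<open>ric(X,Y) = (tr\<^sub>0(A ad X ad Y) - K(X,Y)) / 2\<close> on \<open>g\<^sub>1\<close>.  On \<open>g\<^sub>0\<close> the Einstein equation splits into one
  scalar equation for each \<open>k\<^sub>i\<close>.  On \<open>g\<^sub>1\<close> one needs that \<open>tr\<^sub>0(P\<^sub>i ad X ad Y) = K(X, C\<^sub>i Y)\<close> is a multiple
  of \<open>K(X,Y)\<close>, \<open>P\<^sub>i\<close> being the projection to \<open>k\<^sub>i\<close> and \<open>C\<^sub>i\<close> the Casimir operator of \<open>k\<^sub>i\<close> on \<open>g\<^sub>1\<close>.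

  As \<open>g\<^sub>1\<close> may be reducible, Schur's lemma does not apply directly.  Instead, every \<open>K\<close>-symmetric
  \<open>g\<^sub>0\<close>-intertwiner \<open>T\<close> of \<open>g\<^sub>1\<close> satisfies \<open>T[[X,Y],Z] = [[T X,Y],Z]\<close>, so its kernel generates an ideal of
  the simple algebra \<open>g\<close>, and \<open>T\<close> is injective or zero.  Hence \<open>C\<^sub>i = a + b J\<close> with \<open>b = 0\<close> or
  \<open>J\<^sup>2 = -1\<close>.  In the latter case \<open>J\<close> extends to a complex structure \<open>J\<^sub>0\<close> of \<open>k\<^sub>i\<close>, the trace of \<open>J C\<^sub>i\<close> is
  a multiple of that of \<open>J\<^sub>0\<close> and therefore zero, but it equals \<open>- b dim g\<^sub>1\<close>.  So \<open>C\<^sub>i\<close> is the scalar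
  determined by its trace.
\<close>

section \<open>Traces and frames\<close>

locale finite_dim_space =
  fixes ty :: "'a::real_vector itself"
  assumes fin_dim: "\<exists>B. finite B \<and> span B = (UNIV :: 'a set)"
begin

lemma basis_finite:
  assumes "independent (B :: 'a set)"
  shows "finite B"
  using fin_dim independent_span_bound[OF _ assms] by blast

text \<open>A resolution of the identity of \<open>V\<close>; the vectors \<open>e i\<close> need not be independent.\<close>

definition frame :: "'a set \<Rightarrow> 'i set \<Rightarrow> ('i \<Rightarrow> 'a) \<Rightarrow> ('i \<Rightarrow> 'a \<Rightarrow> real) \<Rightarrow> bool" where
  "frame V I e \<phi> \<longleftrightarrow> finite I \<and> (\<forall>i\<in>I. e i \<in> V \<and> linear (\<phi> i)) \<and>
     (\<forall>v\<in>V. v = (\<Sum>i\<in>I. \<phi> i v *\<^sub>R e i))"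

text \<open>\<open>representation B\<close> is linear on \<open>span B\<close> only. Coordinates
  with respect to a basis \<open>C\<close> of the whole space that extends \<open>B\<close> are
  linear everywhere and agree with it there.\<close>

lemma frame_basis:
  assumes ind: "independent (B :: 'a set)"
  obtains \<phi> where "frame (span B) B (\<lambda>b. b) \<phi>"
    "\<And>v b. v \<in> span B \<Longrightarrow> representation B v b = \<phi> b v"
proof -
  obtain C where C: "B \<subseteq> C" "independent C" "UNIV \<subseteq> span C"
    by (rule maximal_independent_subset_extend[OF subset_UNIV ind])
  define \<phi> where "\<phi> b v = representation C v b" for b v
  have rep: "representation B v b = \<phi> b v" if "v \<in> span B" for v b
    unfolding \<phi>_def using representation_extend[OF C(2) that C(1)] by simp
  have lin: "linear (\<phi> b)" for b
    unfolding \<phi>_def using C(2) UNIV_I[THEN subsetD[OF C(3)]]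
    by (intro linearI) (auto simp: representation_add representation_scale)
  have "v = (\<Sum>b\<in>B. \<phi> b v *\<^sub>R b)" if "v \<in> span B" for v
    using sum_representation_eq[OF ind that basis_finite[OF ind] subset_refl] rep[OF that] by simp
  then have "frame (span B) B (\<lambda>b. b) \<phi>"
    unfolding frame_def using lin basis_finite[OF ind] by (auto intro: span_base)
  then show thesis using rep that by blast
qed

text \<open>Fixes the basis that \<open>trace_on\<close> chooses, so that later lemmas meet only a
  finite sum of linear functionals and never the choice operator.\<close>

lemma ex_frame:
  assumes "subspace (V :: 'a set)"
  obtains B \<phi> where "frame V B (\<lambda>b. b) \<phi>" "independent B" "span B = V"
    "\<And>T. (\<And>v. v \<in> V \<Longrightarrow> T v \<in> V) \<Longrightarrow> trace_on V T = (\<Sum>b\<in>B. \<phi> b (T b))"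
proof -
  define B where "B = (SOME B. independent B \<and> span B = V)"
  have "\<exists>B. independent B \<and> span B = V"
    using basis_exists[of V] assms by (metis span_eq_iff span_mono subset_antisym)
  then have B: "independent B" "span B = V"
    unfolding B_def by (metis (mono_tags, lifting) someI_ex)+
  obtain \<phi> where \<phi>: "frame (span B) B (\<lambda>b. b) \<phi>"
    "\<And>v b. v \<in> span B \<Longrightarrow> representation B v b = \<phi> b v"
    using frame_basis[OF B(1)] by blast
  have "trace_on V T = (\<Sum>b\<in>B. \<phi> b (T b))" if "\<And>v. v \<in> V \<Longrightarrow> T v \<in> V" for T
    unfolding trace_on_def Let_def B_def[symmetric]
    using \<phi>(2) B that span_base by (metis (mono_tags, lifting) sum.cong)
  then show thesis using that \<phi> B by metis
qed

text \<open>Expanding \<open>T (e i)\<close> in the second frame and \<open>S (f j)\<close> in the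
  first turns both sides into the same double sum. With one of the maps the identity, this also
  gives independence of the frame.\<close>

lemma frame_swap:
  assumes F: "frame (V :: 'a set) I e \<phi>" and G: "frame W J f \<psi>"
    and "linear S" "linear T" "\<And>v. v \<in> V \<Longrightarrow> T v \<in> W" "\<And>w. w \<in> W \<Longrightarrow> S w \<in> V"
  shows "(\<Sum>i\<in>I. \<phi> i (S (T (e i)))) = (\<Sum>j\<in>J. \<psi> j (T (S (f j))))"
proof -
  have "\<phi> i (S (T (e i))) = (\<Sum>j\<in>J. \<psi> j (T (e i)) * \<phi> i (S (f j)))" if "i \<in> I" for i
  proof -
    have "T (e i) = (\<Sum>j\<in>J. \<psi> j (T (e i)) *\<^sub>R f j)" 
      using F G assms(5) that unfolding frame_def by blast
    moreover have "linear (\<lambda>x. \<phi> i (S x))"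
      using F that assms(3) linear_compose[of S "\<phi> i"] unfolding frame_def o_def by blast
    ultimately have "\<phi> i (S (T (e i))) = (\<Sum>j\<in>J. \<phi> i (S (\<psi> j (T (e i)) *\<^sub>R f j)))"
      using linear_sum[of "\<lambda>x. \<phi> i (S x)" "\<lambda>j. \<psi> j (T (e i)) *\<^sub>R f j" J] by simp
    then show ?thesis
      by (simp add: linear_cmul[OF \<open>linear (\<lambda>x. \<phi> i (S x))\<close>])
  qed
  moreover have "\<psi> j (T (S (f j))) = (\<Sum>i\<in>I. \<phi> i (S (f j)) * \<psi> j (T (e i)))" if "j \<in> J" for j
  proof -
    have "S (f j) = (\<Sum>i\<in>I. \<phi> i (S (f j)) *\<^sub>R e i)" 
      using F G assms(6) that unfolding frame_def by blast
    moreover have "linear (\<lambda>x. \<psi> j (T x))"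
      using G that assms(4) linear_compose[of T "\<psi> j"] unfolding frame_def o_def by blast
    ultimately have "\<psi> j (T (S (f j))) = (\<Sum>i\<in>I. \<psi> j (T (\<phi> i (S (f j)) *\<^sub>R e i)))"
      using linear_sum[of "\<lambda>x. \<psi> j (T x)" "\<lambda>i. \<phi> i (S (f j)) *\<^sub>R e i" I] by simp
    then show ?thesis
      by (simp add: linear_cmul[OF \<open>linear (\<lambda>x. \<psi> j (T x))\<close>])
  qed
  ultimately show ?thesis
    by (simp add: mult.commute) (rule sum.swap)
qed

text \<open>Swapping \<open>T\<close> with the identity compares the basis chosen by
  \<open>trace_on\<close> with an arbitrary frame.\<close>

lemma trace_on_frame:
  assumes "subspace (V :: 'a set)" "frame V I e \<phi>" "linear T" "\<And>v. v \<in> V \<Longrightarrow> T v \<in> V"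
  shows "trace_on V T = (\<Sum>i\<in>I. \<phi> i (T (e i)))"
proof -
  obtain B \<psi> where B: "frame V B (\<lambda>b. b) \<psi>" "trace_on V T = (\<Sum>b\<in>B. \<psi> b (T b))"
    using ex_frame[OF assms(1)] assms(4) by metis
  show ?thesis
    using frame_swap[OF B(1) assms(2) assms(3) linear_id] assms(4) B(2) 
    frame_swap[OF B(1) assms(2) linear_id assms(3)] by simp
qed

lemma trace_on_commute:
  assumes "subspace (V :: 'a set)" "subspace (W :: 'a set)" "linear S" "linear T"
    "\<And>v. v \<in> V \<Longrightarrow> T v \<in> W" "\<And>w. w \<in> W \<Longrightarrow> S w \<in> V"
  shows "trace_on V (\<lambda>x. S (T x)) = trace_on W (\<lambda>x. T (S x))"
proof -
  obtain B \<phi> where B: "frame V B (\<lambda>b. b) \<phi>"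
    "\<And>T. (\<And>v. v \<in> V \<Longrightarrow> T v \<in> V) \<Longrightarrow> trace_on V T = (\<Sum>b\<in>B. \<phi> b (T b))"
    using ex_frame[OF assms(1)] by metis
  obtain C \<psi> where C: "frame W C (\<lambda>b. b) \<psi>"
    "\<And>T. (\<And>v. v \<in> W \<Longrightarrow> T v \<in> W) \<Longrightarrow> trace_on W T = (\<Sum>b\<in>C. \<psi> b (T b))"
    using ex_frame[OF assms(2)] by metis
  show ?thesis
    using frame_swap[OF B(1) C(1) assms(3-6)] B(2)[of "\<lambda>x. S (T x)"] C(2)[of "\<lambda>x. T (S x)"]
      assms(5,6) by auto
qed

lemma trace_on_cong:
  assumes "subspace (V :: 'a set)" "\<And>v. v \<in> V \<Longrightarrow> S v = T v" "\<And>v. v \<in> V \<Longrightarrow> T v \<in> V"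
  shows "trace_on V S = trace_on V T"
proof -
  obtain B \<phi> where B: "frame V B (\<lambda>b. b) \<phi>"
    "\<And>T. (\<And>v. v \<in> V \<Longrightarrow> T v \<in> V) \<Longrightarrow> trace_on V T = (\<Sum>b\<in>B. \<phi> b (T b))"
    using ex_frame[OF assms(1)] by metis
  have "B \<subseteq> V" using B(1) by (auto simp: frame_def)
  then show ?thesis
    using B(2)[of S] B(2)[of T] assms by (auto intro!: sum.cong)
qed

lemma trace_on_add:
  assumes "subspace (V :: 'a set)" "\<And>v. v \<in> V \<Longrightarrow> S v \<in> V" "\<And>v. v \<in> V \<Longrightarrow> T v \<in> V"
  shows "trace_on V (\<lambda>x. S x + T x) = trace_on V S + trace_on V T"
proof -
  obtain B \<phi> where B: "frame V B (\<lambda>b. b) \<phi>"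
    "\<And>T. (\<And>v. v \<in> V \<Longrightarrow> T v \<in> V) \<Longrightarrow> trace_on V T = (\<Sum>b\<in>B. \<phi> b (T b))"
    using ex_frame[OF assms(1)] by metis
  have "\<forall>b\<in>B. linear (\<phi> b)" using B(1) by (auto simp: frame_def)
  then show ?thesis
    using B(2) assms by (simp add: subspace_add linear_add sum.distrib)
qed

lemma trace_on_scale:
  fixes c :: real
  assumes "subspace (V :: 'a set)" "\<And>v. v \<in> V \<Longrightarrow> S v \<in> V"
  shows "trace_on V (\<lambda>x. c *\<^sub>R S x) = c * trace_on V S"
proof -
  obtain B \<phi> where B: "frame V B (\<lambda>b. b) \<phi>"
    "\<And>T. (\<And>v. v \<in> V \<Longrightarrow> T v \<in> V) \<Longrightarrow> trace_on V T = (\<Sum>b\<in>B. \<phi> b (T b))"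
    using ex_frame[OF assms(1)] by metis
  have "\<forall>b\<in>B. linear (\<phi> b)" using B(1) by (auto simp: frame_def)
  then show ?thesis
    using B(2) assms by (simp add: subspace_scale linear_cmul sum_distrib_left)
qed

lemma trace_on_zero: "subspace (V :: 'a set) \<Longrightarrow> trace_on V (\<lambda>x. 0) = 0"
  using trace_on_scale[of V "\<lambda>x. 0" 0] by (simp add: subspace_0)

lemma trace_on_minus:
  assumes "subspace (V :: 'a set)" "\<And>v. v \<in> V \<Longrightarrow> S v \<in> V"
  shows "trace_on V (\<lambda>x. - S x) = - trace_on V S"
  using trace_on_scale[OF assms, where c="-1"] by simp

lemma trace_on_diff:
  assumes "subspace (V :: 'a set)" "\<And>v. v \<in> V \<Longrightarrow> S v \<in> V" "\<And>v. v \<in> V \<Longrightarrow> T v \<in> V"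
  shows "trace_on V (\<lambda>x. S x - T x) = trace_on V S - trace_on V T"
  using trace_on_add[of V S "\<lambda>x. - T x"] trace_on_minus[of V T] assms
  by (simp add: subspace_neg)

lemma trace_on_sum:
  assumes "subspace (V :: 'a set)" "\<And>i v. i \<in> I \<Longrightarrow> v \<in> V \<Longrightarrow> S i v \<in> V"
  shows "trace_on V (\<lambda>x. \<Sum>i\<in>I. S i x) = (\<Sum>i\<in>I. trace_on V (S i))"
  using assms(2)
proof (induction I rule: infinite_finite_induct)
  case (insert i I)
  have "trace_on V (\<lambda>x. S i x + (\<Sum>i\<in>I. S i x)) = trace_on V (S i) + trace_on V (\<lambda>x. \<Sum>i\<in>I. S i x)"
    using insert by (intro trace_on_add assms(1)) (auto intro!: subspace_sum assms(1))
  then show ?case using insert by simp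
qed (auto simp: trace_on_zero assms(1))

lemma trace_on_id:
  assumes "subspace (V :: 'a set)"
  shows "trace_on V (\<lambda>x. x) = real (dim V)"
proof -
  obtain B where B: "independent B" "span B = V"
    using ex_frame[OF assms] by metis
  obtain \<phi> where \<phi>: "frame V B (\<lambda>b. b) \<phi>" "\<And>v b. v \<in> V \<Longrightarrow> representation B v b = \<phi> b v"
    using frame_basis[OF B(1)] B(2) by metis
  have "trace_on V (\<lambda>x. x) = (\<Sum>b\<in>B. \<phi> b b)"
    using trace_on_frame[OF assms \<phi>(1) linear_ident] by simp
  also have "\<dots> = (\<Sum>b\<in>B. 1)"
  proof (intro sum.cong refl)
    fix b assume "b \<in> B"
    then show "\<phi> b b = 1"
      using \<phi>(2)[of b b] representation_basis[OF B(1), of b] B(2) span_base by force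
  qed
  also have "\<dots> = real (dim V)"
    using dim_span_eq_card_independent[OF B(1)] B(2) by simp
  finally show ?thesis .
qed

lemma dim_pos:
  assumes "subspace (V :: 'a set)" "V \<noteq> {0}"
  shows "dim V > 0"
proof -
  obtain B where B: "independent B" "span B = V"
    using ex_frame[OF assms(1)] by metis
  then have "B \<noteq> {}" using assms(2) by auto
  then show ?thesis
    using dim_span_eq_card_independent[OF B(1)] B(2) basis_finite[OF B(1)] by (simp add: card_gt_0_iff)
qed

text \<open>The image of a basis is independent and has as many elements as the basis; a vector of
  \<open>V\<close> outside its span would yield too large an independent set.\<close>

lemma injective_on_imp_surjective_on:
  assumes V: "subspace (V :: 'a set)" and T: "linear T" "\<And>v. v \<in> V \<Longrightarrow> T v \<in> V"
    and inj: "\<And>v. v \<in> V \<Longrightarrow> T v = 0 \<Longrightarrow> v = 0" and w: "w \<in> V"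
  obtains v where "v \<in> V" "T v = w"
proof -
  obtain B where B: "independent B" "span B = V"
    using ex_frame[OF V] by metis
  have "inj_on T (span B)"
    using linear_injective_on_subspace_0[OF T(1), of V] V inj B by auto
  then have ind: "independent (T ` B)" and injB: "inj_on T B"
    using linear_independent_injective_image[OF T(1) B(1)] inj_on_subset[OF _ span_superset]
    by auto
  have sub: "T ` B \<subseteq> span B" using T(2) B span_base by blast
  have "span (T ` B) = span B"
  proof (rule ccontr)
    assume "span (T ` B) \<noteq> span B"
    then obtain u where u: "u \<in> span B" "u \<notin> span (T ` B)"
      by (metis sub span_minimal subset_antisym subsetI subspace_span)
    then have "independent (insert u (T ` B))" "u \<notin> T ` B"
      using ind by (auto simp: independent_insert span_base)
    moreover have "insert u (T ` B) \<subseteq> span B" using u sub by blast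
    ultimately have "card (insert u (T ` B)) \<le> card B"
      using independent_span_bound[OF basis_finite[OF B(1)]] by blast
    then show False
      using \<open>u \<notin> T ` B\<close> basis_finite[OF B(1)] injB by (simp add: card_image)
  qed
  then have "w \<in> T ` span B"
    using w B(2) linear_span_image[OF T(1)] by metis
  then show thesis using that B(2) by blast
qed

end

text \<open>In a dual frame, \<open>f b (d b')\<close> is the Kronecker delta if \<open>B\<close> is a basis.\<close>

definition dual_frame ::
    "'a::real_vector set \<Rightarrow> ('a \<Rightarrow> 'a \<Rightarrow> real) \<Rightarrow> 'a set \<Rightarrow> ('a \<Rightarrow> 'a) \<Rightarrow> bool" where
  "dual_frame V f B d \<longleftrightarrow> finite B \<and> B \<subseteq> V \<and> (\<forall>b\<in>B. d b \<in> V) \<and>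
     (\<forall>v\<in>V. v = (\<Sum>b\<in>B. f v (d b) *\<^sub>R b)) \<and> (\<forall>v\<in>V. v = (\<Sum>b\<in>B. f b v *\<^sub>R d b))"

definition nondeg_on :: "'a::real_vector set \<Rightarrow> ('a \<Rightarrow> 'a \<Rightarrow> real) \<Rightarrow> bool" where
  "nondeg_on V f \<longleftrightarrow> (\<forall>Y\<in>V. (\<forall>X\<in>V. f X Y = 0) \<longrightarrow> Y = 0)"

section \<open>Dual frames of a nondegenerate form, adjoints and complex structures\<close>

context finite_dim_space
begin

text \<open>Nondegeneracy makes the map \<open>L\<close> that sends \<open>Y\<close> to the
  combination of the basis with coefficients \<open>f b Y\<close> injective, hence onto. The dual
  vector \<open>d b\<close> is the preimage of \<open>b\<close>.\<close>

lemma ex_dual_frame: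
  assumes V: "subspace (V :: 'a set)" and f: "bilinear f" and nd: "nondeg_on V f"
  obtains B d where "dual_frame V f B d"
proof -
  obtain B \<phi> where B: "frame V B (\<lambda>b. b) \<phi>" "independent B" "span B = V"
    using ex_frame[OF V] by metis
  have fB: "finite B" "B \<subseteq> V" using B by (auto simp: frame_def)
  have lin1: "linear (\<lambda>X. f X Y)" and lin2: "linear (f X)" for X Y
    using f by (auto simp: bilinear_def)
  define L where "L Y = (\<Sum>b\<in>B. f b Y *\<^sub>R b)" for Y
  have L0: "\<forall>b\<in>B. f b Y = 0" if "L Y = 0" for Y
    using that independentD[OF B(2) fB(1) subset_refl, of "\<lambda>b. f b Y"] by (auto simp: L_def)
  have ext: "\<forall>X\<in>V. f X Y = 0" if "\<forall>b\<in>B. f b Y = 0" for Y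
    using linear_eq_0_on_span[OF lin1, of B Y] that B(3) by auto
  have "linear L"
    unfolding L_def
    by (intro linear_compose_sum ballI linearI) (auto simp: linear_add[OF lin2] linear_cmul[OF lin2] algebra_simps)
  moreover have "L v \<in> V" if "v \<in> V" for v
    unfolding L_def using V fB by (intro subspace_sum subspace_scale) auto
  moreover have "v = 0" if "v \<in> V" "L v = 0" for v
    using L0[OF that(2)] ext nd that(1) by (auto simp: nondeg_on_def)
  ultimately have "\<exists>v. v \<in> V \<and> L v = w" if "w \<in> V" for w
    using injective_on_imp_surjective_on[OF V _ _ _ that, of L] by metis
  then obtain d where d: "\<And>b. b \<in> B \<Longrightarrow> d b \<in> V \<and> L (d b) = b"
    using fB by (metis subsetD)
  have dual: "f b' (d b) = (if b' = b then 1 else 0)" if "b \<in> B" "b' \<in> B" for b b'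
  proof -
    have "(\<Sum>b'\<in>B. (f b' (d b) - (if b' = b then 1 else 0)) *\<^sub>R b') = L (d b) - (\<Sum>b'\<in>B. (if b' = b then 1 else 0) *\<^sub>R b')"
      by (simp add: L_def scaleR_diff_left sum_subtractf)
    also have "(\<Sum>b'\<in>B. (if b' = b then 1 else 0) *\<^sub>R b') = (\<Sum>b'\<in>B. (if b' = b then b' else 0))"
      by (intro sum.cong) auto
    also have "\<dots> = b"
      using fB(1) that by (simp add: sum.delta)
    finally have "(\<Sum>b'\<in>B. (f b' (d b) - (if b' = b then 1 else 0)) *\<^sub>R b') = 0"
      using d[OF that(1)] by simp
    then show ?thesis
      using independentD[OF B(2) fB(1) subset_refl _ that(2)] by fastforce
  qed
  have e1: "v = (\<Sum>b\<in>B. f v (d b) *\<^sub>R b)" if "v \<in> V" for v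
  proof -
    have v: "v = (\<Sum>b\<in>B. \<phi> b v *\<^sub>R b)" using B(1) that by (auto simp: frame_def)
    have "f v (d b) = \<phi> b v" if "b \<in> B" for b
    proof -
      have "f v (d b) = (\<Sum>b'\<in>B. f (\<phi> b' v *\<^sub>R b') (d b))"
        by (subst v) (rule linear_sum[OF lin1])
      also have "\<dots> = (\<Sum>b'\<in>B. if b' = b then \<phi> b v else 0)"
        using that by (intro sum.cong) (auto simp: linear_cmul[OF lin1] dual)
      finally show ?thesis using that fB(1) by simp
    qed
    then show ?thesis using v by simp
  qed
  have e2: "v = (\<Sum>b\<in>B. f b v *\<^sub>R d b)" if "v \<in> V" for v
  proof -
    \<comment> \<open>The error \<open>u\<close> pairs to zero with every basis vector, so
      nondegeneracy kills it.\<close>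
    define u where "u = v - (\<Sum>b\<in>B. f b v *\<^sub>R d b)"
    have "f b u = 0" if "b \<in> B" for b
    proof -
      have "f b (\<Sum>b'\<in>B. f b' v *\<^sub>R d b') = (\<Sum>b'\<in>B. f b (f b' v *\<^sub>R d b'))"
        by (rule linear_sum[OF lin2])
      also have "\<dots> = (\<Sum>b'\<in>B. if b' = b then f b v else 0)"
        using that by (intro sum.cong) (auto simp: linear_cmul[OF lin2] dual)
      also have "\<dots> = f b v" using that fB(1) by simp
      finally show ?thesis by (simp add: u_def linear_diff[OF lin2])
    qed
    moreover have "u \<in> V"
      unfolding u_def using that d V by (intro subspace_diff subspace_sum subspace_scale) auto
    ultimately have "u = 0" using ext nd by (auto simp: nondeg_on_def)
    then show ?thesis by (simp add: u_def)
  qed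
  have "dual_frame V f B d"
    unfolding dual_frame_def using fB d e1 e2 by blast
  then show thesis by (rule that)
qed

lemma trace_on_dual_frame:
  assumes "subspace (V :: 'a set)" "bilinear f" "dual_frame V f B d"
    and "linear T" "\<And>v. v \<in> V \<Longrightarrow> T v \<in> V"
  shows "trace_on V T = (\<Sum>b\<in>B. f (T b) (d b))"
proof -
  have "frame V B (\<lambda>b. b) (\<lambda>b v. f v (d b))"
    using assms(2,3) unfolding frame_def dual_frame_def bilinear_def by blast
  then show ?thesis by (rule trace_on_frame[OF assms(1) _ assms(4,5)])
qed

lemma trace_on_dual_frame':
  assumes "subspace (V :: 'a set)" "bilinear f" "dual_frame V f B d"
    and "linear T" "\<And>v. v \<in> V \<Longrightarrow> T v \<in> V"
  shows "trace_on V T = (\<Sum>b\<in>B. f b (T (d b)))"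
proof -
  have "frame V B d (\<lambda>b. f b)"
    using assms(2,3) unfolding frame_def dual_frame_def bilinear_def by blast
  then show ?thesis by (rule trace_on_frame[OF assms(1) _ assms(4,5)])
qed

text \<open>The trace of \<open>S\<close> computed on the frame and that of \<open>T\<close>
  computed on the dual vectors have the same terms,
  \<open>f (S b) (d b) = f b (T (d b))\<close>.\<close>

lemma trace_on_adjoint:
  assumes V: "subspace (V :: 'a set)" and f: "bilinear f" and nd: "nondeg_on V f"
    and S: "linear S" "\<And>v. v \<in> V \<Longrightarrow> S v \<in> V" and T: "linear T" "\<And>v. v \<in> V \<Longrightarrow> T v \<in> V"
    and adj: "\<And>v w. v \<in> V \<Longrightarrow> w \<in> V \<Longrightarrow> f (S v) w = f v (T w)"
  shows "trace_on V S = trace_on V T"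
proof -
  obtain B d where B: "dual_frame V f B d"
    by (rule ex_dual_frame[OF V f nd])
  have "trace_on V T = (\<Sum>b\<in>B. f b (T (d b)))"
    by (rule trace_on_dual_frame'[OF V f B T])
  also have "\<dots> = trace_on V S"
    using trace_on_dual_frame[OF V f B S] adj B by (auto simp: dual_frame_def intro!: sum.cong)
  finally show ?thesis by simp
qed

text \<open>Once \<open>J\<close> is skew for a nondegenerate form, \<open>trace_on_adjoint\<close>
  equates its trace with that of \<open>- J\<close>.\<close>

lemma trace_on_complex_structure:
  assumes V: "subspace (V :: 'a set)" and J: "linear J" "\<And>v. v \<in> V \<Longrightarrow> J v \<in> V"
    and JJ: "\<And>v. v \<in> V \<Longrightarrow> J (J v) = - v"
  shows "trace_on V J = 0"
proof -
  obtain B \<phi> where B: "frame V B (\<lambda>b. b) \<phi>"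
    using ex_frame[OF V] by metis
  have fin: "finite B" and lin: "\<And>b. b \<in> B \<Longrightarrow> linear (\<phi> b)" 
    and rep: "\<And>v. v \<in> V \<Longrightarrow> v = (\<Sum>b\<in>B. \<phi> b v *\<^sub>R b)"
    using B by (auto simp: frame_def)
  \<comment> \<open>an inner product on \<open>V\<close> for which \<open>J\<close> is skew\<close>
  define h where "h v w = (\<Sum>b\<in>B. \<phi> b v * \<phi> b w + \<phi> b (J v) * \<phi> b (J w))" for v w
  have lh: "linear (h v)" for v
    unfolding h_def
    by (intro linear_compose_sum ballI linearI) 
      (auto simp: linear_add[OF lin] linear_cmul[OF lin] linear_add[OF J(1)] linear_cmul[OF J(1)] algebra_simps)
  have sym: "h v w = h w v" for v w by (simp add: h_def mult.commute)
  have "bilinear h"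
    unfolding bilinear_def using lh sym by (metis (no_types, lifting) ext)
  moreover have "nondeg_on V h"
    unfolding nondeg_on_def
  proof (intro ballI impI)
    fix Y assume Y: "Y \<in> V" "\<forall>X\<in>V. h X Y = 0"
    then have "(\<Sum>b\<in>B. \<phi> b Y * \<phi> b Y + \<phi> b (J Y) * \<phi> b (J Y)) = 0" by (simp add: h_def)
    then have "\<forall>b\<in>B. \<phi> b Y * \<phi> b Y + \<phi> b (J Y) * \<phi> b (J Y) = 0"
      by (subst (asm) sum_nonneg_eq_0_iff[OF fin]) (auto intro: add_nonneg_nonneg)
    then have "\<forall>b\<in>B. \<phi> b Y = 0"
      by (metis sum_squares_eq_zero_iff)
    then show "Y = 0" using rep[OF Y(1)] by simp
  qed
  \<comment> \<open>Because \<open>J (J v) = - v\<close>, applying \<open>J\<close> exchanges the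
    two summands of \<open>h\<close> up to sign.\<close>
  moreover have "h (J v) w = h v (- J w)" if "v \<in> V" "w \<in> V" for v w
    using JJ[OF that(1)] JJ[OF that(2)]
    by (simp add: h_def linear_neg[OF lin] linear_neg[OF J(1)] sum_negf[symmetric] algebra_simps)
  ultimately have "trace_on V J = trace_on V (\<lambda>v. - J v)"
    using J V by (intro trace_on_adjoint[of V h]) (auto intro: linear_compose_neg subspace_neg)
  then show ?thesis using trace_on_minus[OF V J(2)] by simp
qed

end

section \<open>Components of a direct sum\<close>

text \<open>\<open>component\<close> inverts the sum on extensional families, so \<open>f\<close>
  has to be restricted to \<open>I\<close> before the inverse can be evaluated.\<close>

lemma component_sum:
  assumes ds: "direct_sum I V W" and f: "\<And>i. i \<in> I \<Longrightarrow> f i \<in> V i" and i: "i \<in> I"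
  shows "component I V i (sum f I) = f i"
proof -
  have inj: "inj_on (\<lambda>f. sum f I) (Pi\<^sub>E I V)"
    using ds by (simp add: direct_sum_def bij_betw_def)
  have "sum f I = sum (restrict f I) I" by (intro sum.cong) auto
  moreover have "restrict f I \<in> Pi\<^sub>E I V" using f by auto
  ultimately have "inv_into (Pi\<^sub>E I V) (\<lambda>f. sum f I) (sum f I) = restrict f I"
    using inv_into_f_f[OF inj] by metis
  then show ?thesis using i by (simp add: component_def)
qed

lemma direct_sum_ex:
  assumes ds: "direct_sum I V W" and "x \<in> W"
  obtains f where "\<And>i. i \<in> I \<Longrightarrow> f i \<in> V i" "x = sum f I"
proof -
  have "x \<in> (\<lambda>f. sum f I) ` Pi\<^sub>E I V"
    using assms by (simp add: direct_sum_def bij_betw_def)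
  then show thesis using that by auto
qed

lemma component_mem:
  assumes "direct_sum I V W" "x \<in> W" "i \<in> I"
  shows "component I V i x \<in> V i"
proof -
  obtain f where f: "\<And>i. i \<in> I \<Longrightarrow> f i \<in> V i" "x = sum f I"
    using direct_sum_ex[OF assms(1,2)] by metis
  then show ?thesis using component_sum[OF assms(1) f(1) assms(3)] assms(3) by simp
qed

lemma sum_component:
  assumes "direct_sum I V W" "x \<in> W"
  shows "(\<Sum>i\<in>I. component I V i x) = x"
proof -
  obtain f where f: "\<And>i. i \<in> I \<Longrightarrow> f i \<in> V i" "x = sum f I"
    using direct_sum_ex[OF assms(1,2)] by metis
  then show ?thesis using component_sum[OF assms(1) f(1)] by simp
qed

lemma direct_sum_subspace: "direct_sum I V W \<Longrightarrow> i \<in> I \<Longrightarrow> subspace (V i)"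
  by (simp add: direct_sum_def)

lemma component_add:
  assumes ds: "direct_sum I V W" and "x \<in> W" "y \<in> W" "i \<in> I"
  shows "component I V i (x + y) = component I V i x + component I V i y"
proof -
  have "x + y = (\<Sum>i\<in>I. component I V i x + component I V i y)"
    using sum_component[OF ds] assms by (simp add: sum.distrib)
  then show ?thesis
    using component_sum[OF ds, of "\<lambda>i. component I V i x + component I V i y" i] assms
    by (simp add: component_mem direct_sum_subspace subspace_add)
qed

lemma component_scale:
  assumes ds: "direct_sum I V W" and "x \<in> W" "i \<in> I"
  shows "component I V i (c *\<^sub>R x) = c *\<^sub>R component I V i x"
proof -
  have "c *\<^sub>R x = (\<Sum>i\<in>I. c *\<^sub>R component I V i x)"
    using sum_component[OF ds] assms by (simp add: scaleR_sum_right[symmetric])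
  then show ?thesis
    using component_sum[OF ds, of "\<lambda>i. c *\<^sub>R component I V i x" i] assms
    by (simp add: component_mem direct_sum_subspace subspace_scale)
qed

lemma direct_sum_summand:
  assumes ds: "direct_sum I V W" and i: "i \<in> I" and x: "x \<in> V i"
  shows direct_sum_mem: "x \<in> W"
    and component_summand: "j \<in> I \<Longrightarrow> component I V j x = (if j = i then x else 0)"
proof -
  define f where "f j = (if j = i then x else 0)" for j
  have f: "f j \<in> V j" if "j \<in> I" for j
    using direct_sum_subspace[OF ds] that x by (auto simp: f_def subspace_0)
  have fin: "finite I" using ds by (simp add: direct_sum_def)
  have sx: "sum f I = x" using i fin by (simp add: f_def)
  have "restrict f I \<in> Pi\<^sub>E I V" using f by auto
  moreover have "sum (restrict f I) I = x"
    using sx by simp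
  ultimately show "x \<in> W"
    using ds unfolding direct_sum_def bij_betw_def by blast
  show "component I V j x = (if j = i then x else 0)" if "j \<in> I"
    using component_sum[OF ds f that] sx by (simp add: f_def)
qed

section \<open>The super Killing form\<close>

lemma bit_add_cancel: "q + (q + r) = (r :: bit)"
  by (cases q; cases r) simp_all

lemma UNIV_bit: "(UNIV :: bit set) = {0, 1}"
  by (metis (full_types) UNIV_eq_I bit_not_one_iff insertCI)

lemma sum_UNIV_bit: "(\<Sum>p\<in>UNIV. f p) = f (0 :: bit) + (f 1 :: 'b::comm_monoid_add)"
  by (simp add: UNIV_bit)

sublocale lie_superalgebra \<subseteq> finite_dim_space "TYPE('a)"
  by unfold_locales (rule finite_dim)

context lie_superalgebra
begin

lemma subspace_gr: "subspace (gr p)"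
  using direct_sum_subspace[OF grading] by blast

lemma part_mem: "part gr p X \<in> gr p"
  using component_mem[OF grading] by blast

lemma part_sum: "X = part gr 0 X + part gr 1 X"
  using sum_component[OF grading, of X] by (simp add: sum_UNIV_bit)

lemma linear_part: "linear (part gr p)"
  by (intro linearI) (simp_all add: component_add[OF grading] component_scale[OF grading])

lemma part_homogeneous: "X \<in> gr q \<Longrightarrow> part gr p X = (if p = q then X else 0)"
  using component_summand[OF grading] by blast

lemma homogeneous_cases [case_names homogeneous add]:
  assumes "\<And>p X. X \<in> gr p \<Longrightarrow> P X" "\<And>X Y. P X \<Longrightarrow> P Y \<Longrightarrow> P (X + Y)"
  shows "P X"
  using assms part_sum part_mem by metis

lemma linear_br: "linear (br X)" and linear_br_left: "linear (\<lambda>X. br X Y)"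
  using bilinear by (auto simp: bilinear_def)

lemmas br_add = linear_add[OF linear_br] linear_add[OF linear_br_left]
lemmas br_diff = linear_diff[OF linear_br] linear_diff[OF linear_br_left]
lemmas br_scale = linear_cmul[OF linear_br] linear_cmul[OF linear_br_left]
lemmas br_neg = linear_neg[OF linear_br] linear_neg[OF linear_br_left]
lemmas br_0 = linear_0[OF linear_br] linear_0[OF linear_br_left]
lemmas br_sum = linear_sum[OF linear_br] linear_sum[OF linear_br_left]
lemmas br_linear = br_add br_diff br_scale br_neg br_0

lemma br_mem: "X \<in> gr p \<Longrightarrow> Y \<in> gr q \<Longrightarrow> br X Y \<in> gr (p + q)"
  using even by (simp add: even_map_def)

lemma br_mem_eq: "X \<in> gr p \<Longrightarrow> Y \<in> gr q \<Longrightarrow> r = p + q \<Longrightarrow> br X Y \<in> gr r"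
  using br_mem by simp

section \<open>Supertraces of even, odd and commuted maps\<close>

lemma supertrace_add:
  "supertrace gr (\<lambda>x. S x + T x) = supertrace gr S + supertrace gr T"
  unfolding supertrace_def o_def
  by (simp add: linear_add[OF linear_part] trace_on_add[OF subspace_gr part_mem part_mem])

lemma supertrace_scale: "supertrace gr (\<lambda>x. c *\<^sub>R S x) = c * supertrace gr S"
  unfolding supertrace_def o_def
  by (simp add: linear_cmul[OF linear_part] trace_on_scale[OF subspace_gr part_mem] algebra_simps)

lemma supertrace_diff:
  "supertrace gr (\<lambda>x. S x - T x) = supertrace gr S - supertrace gr T"
  using supertrace_add[of S "\<lambda>x. (-1) *\<^sub>R T x"] supertrace_scale[of "-1" T] by simp

lemma supertrace_even:
  assumes "\<And>p X. X \<in> gr p \<Longrightarrow> T X \<in> gr p"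
  shows "supertrace gr T = trace_on (gr 0) T - trace_on (gr 1) T"
proof -
  have "trace_on (gr p) (part gr p \<circ> T) = trace_on (gr p) T" for p
  proof (rule trace_on_cong[OF subspace_gr])
    show "(part gr p \<circ> T) v = T v" if "v \<in> gr p" for v
      using part_homogeneous[OF assms[OF that], of p] by simp
  qed (rule assms)
  then show ?thesis by (simp add: supertrace_def)
qed

lemma supertrace_odd:
  assumes "\<And>p X. X \<in> gr p \<Longrightarrow> T X \<in> gr (1 + p)"
  shows "supertrace gr T = 0"
proof -
  have "trace_on (gr p) (part gr p \<circ> T) = trace_on (gr p) (\<lambda>x. 0)" for p
  proof (rule trace_on_cong[OF subspace_gr])
    show "(part gr p \<circ> T) v = 0" if "v \<in> gr p" for v
      using part_homogeneous[OF assms[OF that], of p] by simp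
  qed (simp add: subspace_0 subspace_gr)
  then show ?thesis by (simp add: supertrace_def trace_on_zero subspace_gr)
qed

text \<open>For equal parities the block of \<open>S T\<close> on \<open>gr r\<close> has the trace
  of the block of \<open>T S\<close> on \<open>gr (q + r)\<close>; for odd maps this exchanges the
  two blocks, whence the sign. For different parities both products are odd and both supertraces
  vanish.\<close>

lemma supertrace_commute:
  assumes S: "linear S" "\<And>r X. X \<in> gr r \<Longrightarrow> S X \<in> gr (p + r)"
    and T: "linear T" "\<And>r X. X \<in> gr r \<Longrightarrow> T X \<in> gr (q + r)"
  shows "supertrace gr (\<lambda>x. S (T x)) = sgn2 p q * supertrace gr (\<lambda>x. T (S x))"
proof (cases "p = q")
  case True
  have TS: "X \<in> gr r \<Longrightarrow> T (S X) \<in> gr r" and ST: "X \<in> gr r \<Longrightarrow> S (T X) \<in> gr r" for X r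
    using T(2)[OF S(2)[of X r]] S(2)[OF T(2)[of X r]] True bit_add_cancel[of q r] by metis+
  have tr: "trace_on (gr r) (\<lambda>x. S (T x)) = trace_on (gr (q + r)) (\<lambda>x. T (S x))" for r
    using S T True S(2)[of _ "q + r"] bit_add_cancel[of q r]
    by (intro trace_on_commute subspace_gr) auto
  have "supertrace gr (\<lambda>x. S (T x)) = trace_on (gr (q + 0)) (\<lambda>x. T (S x)) - trace_on (gr (q + 1)) (\<lambda>x. T (S x))"
    by (subst supertrace_even[OF ST]) (simp_all only: tr)
  moreover have "supertrace gr (\<lambda>x. T (S x)) = trace_on (gr 0) (\<lambda>x. T (S x)) - trace_on (gr 1) (\<lambda>x. T (S x))"
    by (rule supertrace_even[OF TS])
  ultimately show ?thesis
    using True by (cases q) (simp_all add: sgn2_def)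
next
  case False
  then have pq: "p + q = 1" "q + p = 1" by (cases p; cases q; simp)+
  have "supertrace gr (\<lambda>x. S (T x)) = 0"
    using S(2)[OF T(2)] pq by (intro supertrace_odd) (metis add.assoc)
  moreover have "supertrace gr (\<lambda>x. T (S x)) = 0"
    using T(2)[OF S(2)] pq by (intro supertrace_odd) (metis add.assoc)
  ultimately show ?thesis by simp
qed

section \<open>The Killing form and its invariance\<close>

abbreviation K :: "'a \<Rightarrow> 'a \<Rightarrow> real" where
  "K \<equiv> super_killing gr br"

lemma bilinear_K: "bilinear K"
proof -
  have K: "K X Y = supertrace gr (\<lambda>Z. br X (br Y Z))" for X Y
    by (simp add: super_killing_def o_def)
  show ?thesis
    unfolding bilinear_def
    by (intro conjI allI linearI) (simp_all add: K br_linear supertrace_add supertrace_scale)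
qed

lemma linear_K: "linear (K X)" and linear_K_left: "linear (\<lambda>X. K X Y)"
  using bilinear_K by (auto simp: bilinear_def)

lemmas K_linear = 
  linear_add[OF linear_K] linear_add[OF linear_K_left] linear_diff[OF linear_K] linear_diff[OF linear_K_left]
  linear_cmul[OF linear_K] linear_cmul[OF linear_K_left] linear_neg[OF linear_K] linear_neg[OF linear_K_left]
  linear_0[OF linear_K] linear_0[OF linear_K_left]
lemmas K_sum = linear_sum[OF linear_K] linear_sum[OF linear_K_left]

lemma K_supersymmetric:
  assumes "X \<in> gr p" "Y \<in> gr q"
  shows "K X Y = sgn2 p q * K Y X"
  unfolding super_killing_def o_def
  using assms by (intro supertrace_commute linear_br br_mem)

lemma K_mixed:
  assumes "X \<in> gr p" "Y \<in> gr q" "p \<noteq> q"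
  shows "K X Y = 0"
  unfolding super_killing_def o_def
proof (rule supertrace_odd)
  fix r Z assume "Z \<in> gr r"
  then have "br X (br Y Z) \<in> gr (p + (q + r))" using assms br_mem by blast
  moreover have "p + (q + r) = 1 + r" using assms(3) by (cases p; cases q; cases r) auto
  ultimately show "br X (br Y Z) \<in> gr (1 + r)" by simp
qed

lemma jacobi_left:
  assumes "X \<in> gr p" "Y \<in> gr q"
  shows "br (br X Y) Z = br X (br Y Z) - sgn2 p q *\<^sub>R br Y (br X Z)"
  using super_jacobi[OF assms] by simp

text \<open>Both sides are expanded by the Jacobi identity. They share the term
  \<open>ad X ad Y ad Z\<close>, and the other two terms differ by a cyclic rotation under the
  supertrace.\<close>

lemma K_invariant:
  assumes X: "X \<in> gr p" and Y: "Y \<in> gr q" and Z: "Z \<in> gr r"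
  shows "K (br X Y) Z = K X (br Y Z)"
proof -
  have "K (br X Y) Z = supertrace gr (\<lambda>W. br X (br Y (br Z W)))
      - sgn2 p q * supertrace gr (\<lambda>W. br Y (br X (br Z W)))"
    unfolding super_killing_def o_def
    by (simp add: jacobi_left[OF X Y] supertrace_diff supertrace_scale)
  also have "supertrace gr (\<lambda>W. br Y (br X (br Z W)))
      = sgn2 q (p + r) * supertrace gr (\<lambda>W. br X (br Z (br Y W)))"
  proof (rule supertrace_commute[where T = "\<lambda>W. br X (br Z W)"])
    show "linear (\<lambda>W. br X (br Z W))"
      using linear_compose[OF linear_br linear_br] by (simp add: o_def)
    show "br X (br Z W) \<in> gr (p + r + s)" if "W \<in> gr s" for W s
      using br_mem[OF X br_mem[OF Z that]] by (simp only: add.assoc)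
  qed (rule linear_br br_mem[OF Y] | assumption)+
  \<comment> \<open>Rotating \<open>br Y\<close> past a map of parity \<open>p + r\<close>
    contributes a second factor \<open>sgn2 p q\<close>, which cancels the one from the Jacobi
    identity.\<close>
  also have "sgn2 p q * (sgn2 q (p + r) * supertrace gr (\<lambda>W. br X (br Z (br Y W))))
      = sgn2 q r * supertrace gr (\<lambda>W. br X (br Z (br Y W)))"
    by (cases p; cases q; cases r) (simp_all add: sgn2_def)
  also have "supertrace gr (\<lambda>W. br X (br Y (br Z W))) - \<dots> = K X (br Y Z)"
    unfolding super_killing_def o_def
    by (simp add: jacobi_left[OF Y Z] br_linear supertrace_diff supertrace_scale)
  finally show ?thesis .
qed

end

section \<open>Consequences of a nondegenerate Killing form\<close>

locale nondegenerate_killing = lie_superalgebra +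
  assumes K_nondegenerate: "nondegenerate (super_killing gr br)"
begin

lemma K_eq_0:
  assumes "\<And>p Y. Y \<in> gr p \<Longrightarrow> K X Y = 0"
  shows "X = 0"
proof -
  have "K X Y = 0" for Y
    by (induction Y rule: homogeneous_cases) (auto simp: assms K_linear)
  then show ?thesis using K_nondegenerate by (simp add: nondegenerate_def)
qed

lemma K_skew:
  assumes X: "X \<in> gr p" and Y: "Y \<in> gr q" and Z: "Z \<in> gr r"
  shows "K (br X Y) Z = - (sgn2 p q * K Y (br X Z))"
  using K_invariant[OF Y X Z] super_skew[OF X Y] by (simp add: K_linear)

text \<open>The even and odd parts are orthogonal, so a vector of one part orthogonal to that part
  is orthogonal to everything.\<close>

lemma nondeg_on_K: "nondeg_on (gr p) K"
  unfolding nondeg_on_def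
proof (intro ballI impI)
  fix Y assume Y: "Y \<in> gr p" "\<forall>X\<in>gr p. K X Y = 0"
  show "Y = 0"
  proof (rule K_eq_0)
    fix q X assume X: "X \<in> gr q"
    show "K Y X = 0"
      using K_supersymmetric[OF Y(1) X] K_mixed[OF Y(1) X] Y(2) X by (cases "p = q") auto
  qed
qed

lemma linear_br2: "linear (\<lambda>Z. br X (br Y Z))"
  using linear_compose[OF linear_br linear_br] by (simp add: o_def)

lemma br00: "X \<in> gr 0 \<Longrightarrow> Y \<in> gr p \<Longrightarrow> br X Y \<in> gr p"
  by (rule br_mem_eq) auto

lemma br11: "X \<in> gr 1 \<Longrightarrow> Y \<in> gr 1 \<Longrightarrow> br X Y \<in> gr 0"
  by (rule br_mem_eq) auto

lemma br10: "X \<in> gr 1 \<Longrightarrow> Y \<in> gr 0 \<Longrightarrow> br X Y \<in> gr 1"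
  by (rule br_mem_eq) auto

lemma br_swap:
  "X \<in> gr 0 \<Longrightarrow> Y \<in> gr p \<Longrightarrow> br Y X = - br X Y"
  "X \<in> gr 1 \<Longrightarrow> Y \<in> gr 1 \<Longrightarrow> br Y X = br X Y"
  using super_skew[of X 0 Y p] super_skew[of X 1 Y 1] by (simp_all add: sgn2_def)

lemma jacobi_even: "X \<in> gr 0 \<Longrightarrow> Y \<in> gr p \<Longrightarrow> br (br X Y) Z = br X (br Y Z) - br Y (br X Z)"
  using jacobi_left[of X 0 Y p Z] by (simp add: sgn2_def)

lemma jacobi_odd: "X \<in> gr 1 \<Longrightarrow> Y \<in> gr 1 \<Longrightarrow> br (br X Y) Z = br X (br Y Z) + br Y (br X Z)"
  using jacobi_left[of X 1 Y 1 Z] by (simp add: sgn2_def)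

text \<open>For even \<open>W\<close> the map \<open>br W\<close> is skew with respect to
  \<open>K\<close>, so its trace is its own negative.\<close>

lemma trace_ad:
  assumes W: "W \<in> gr 0"
  shows "trace_on (gr p) (br W) = 0"
proof -
  have "trace_on (gr p) (br W) = trace_on (gr p) (\<lambda>Z. - br W Z)"
  proof (rule trace_on_adjoint[OF subspace_gr bilinear_K nondeg_on_K])
    show "K (br W v) w = K v (- br W w)" if "v \<in> gr p" "w \<in> gr p" for v w
      using K_skew[OF W that] by (simp add: sgn2_def K_linear)
  qed (auto simp: br00 assms subspace_neg subspace_gr linear_br intro: linear_compose_neg[OF linear_br])
  then show ?thesis using trace_on_minus[OF subspace_gr br00[OF W]] by simp
qed

text \<open>Used for odd \<open>X\<close> and \<open>Y\<close> and an endomorphism \<open>Q\<close>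
  of the even part. All traces in the Ricci form of odd vectors reduce to this one, with
  \<open>Q\<close> the identity or the operator \<open>A\<close>.\<close>

definition even_trace :: "('a \<Rightarrow> 'a) \<Rightarrow> 'a \<Rightarrow> 'a \<Rightarrow> real" where
  "even_trace Q X Y = trace_on (gr 0) (\<lambda>Z. Q (br X (br Y Z)))"

lemma even_trace_right:
  assumes "linear Q" "\<And>Z. Z \<in> gr 0 \<Longrightarrow> Q Z \<in> gr 0" "X \<in> gr 1" "Y \<in> gr 1"
  shows "trace_on (gr 0) (\<lambda>Z. br X (br Y (Q Z))) = even_trace Q X Y"
  unfolding even_trace_def
  using assms by (intro trace_on_commute subspace_gr linear_br2) (auto intro: br11 br10)

text \<open>Cyclicity between \<open>gr 1\<close> and \<open>gr 0\<close> moves the trace to the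
  even part; \<open>X\<close> and \<open>Y\<close> change places on the way.\<close>

lemma odd_trace:
  assumes "linear Q" "\<And>Z. Z \<in> gr 0 \<Longrightarrow> Q Z \<in> gr 0" "X \<in> gr 1" "Y \<in> gr 1"
  shows "trace_on (gr 1) (\<lambda>Z. br X (Q (br Y Z))) = even_trace Q Y X"
proof -
  have "trace_on (gr 1) (\<lambda>Z. br X (Q (br Y Z))) = trace_on (gr 0) (\<lambda>Z. br Y (br X (Q Z)))"
    using assms linear_compose[OF assms(1) linear_br, of X]
    by (intro trace_on_commute subspace_gr linear_br) (auto simp: o_def intro: br11 br10)
  then show ?thesis using even_trace_right assms by simp
qed

text \<open>On \<open>gr 0\<close> the \<open>K\<close>-adjoint of \<open>Q (br X (br Y Z))\<close>
  is \<open>- br Y (br X (Q Z))\<close>, and adjoint maps have equal traces.\<close>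

lemma even_trace_skew:
  assumes Q: "linear Q" "\<And>Z. Z \<in> gr 0 \<Longrightarrow> Q Z \<in> gr 0" 
    and sym: "\<And>Z W. Z \<in> gr 0 \<Longrightarrow> W \<in> gr 0 \<Longrightarrow> K (Q Z) W = K Z (Q W)"
    and X: "X \<in> gr 1" and Y: "Y \<in> gr 1"
  shows "even_trace Q X Y = - even_trace Q Y X"
proof -
  have mem: "br X (br Y Z) \<in> gr 0" "br Y (br X Z) \<in> gr 0" if "Z \<in> gr 0" for Z
    using that X Y by (auto intro: br11 br10)
  have "even_trace Q X Y = trace_on (gr 0) (\<lambda>Z. - br Y (br X (Q Z)))"
    unfolding even_trace_def
  proof (rule trace_on_adjoint[OF subspace_gr bilinear_K nondeg_on_K])
    fix v w assume vw: "v \<in> gr 0" "w \<in> gr 0"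
    have "K (Q (br X (br Y v))) w = K (br X (br Y v)) (Q w)"
      using sym mem vw by blast
    \<comment> \<open>Moving \<open>br X\<close> off an odd vector costs no sign, moving
      \<open>br Y\<close> off an even one does; a single minus sign survives.\<close>
    also have "\<dots> = K (br Y v) (br X (Q w))"
      using K_skew[OF X br10[OF Y vw(1)] Q(2)[OF vw(2)]] by (simp add: sgn2_def)
    also have "\<dots> = K v (- br Y (br X (Q w)))"
      using K_skew[OF Y vw(1) br10[OF X Q(2)[OF vw(2)]]] by (simp add: sgn2_def K_linear)
    finally show "K (Q (br X (br Y v))) w = K v (- br Y (br X (Q w)))" .
  next
    show "linear (\<lambda>Z. Q (br X (br Y Z)))"
      using linear_compose[OF linear_br2 Q(1)] by (simp add: o_def)
    show "linear (\<lambda>Z. - br Y (br X (Q Z)))"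
      using linear_compose_neg[OF linear_compose[OF Q(1) linear_br2]] by (simp add: o_def)
  qed (use mem Q(2) in \<open>auto intro: subspace_neg[OF subspace_gr]\<close>)
  also have "\<dots> = - even_trace Q Y X"
    using even_trace_right[OF Q Y X] mem Q(2)
    by (subst trace_on_minus[OF subspace_gr]) auto
  finally show ?thesis .
qed

text \<open>The odd block of the supertrace is the even block with \<open>X\<close> and
  \<open>Y\<close> exchanged, hence its negative, so the two blocks add up.\<close>

lemma K_odd:
  assumes X: "X \<in> gr 1" and Y: "Y \<in> gr 1"
  shows "K X Y = 2 * even_trace (\<lambda>Z. Z) X Y"
proof -
  have "K X Y = even_trace (\<lambda>Z. Z) X Y - trace_on (gr 1) (\<lambda>Z. br X (br Y Z))"
    unfolding super_killing_def o_def even_trace_def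
    by (rule supertrace_even) (metis br_mem X Y bit_add_cancel)
  also have "trace_on (gr 1) (\<lambda>Z. br X (br Y Z)) = even_trace (\<lambda>Z. Z) Y X"
    using odd_trace[of "\<lambda>Z. Z", OF linear_ident _ X Y] by simp
  also have "\<dots> = - even_trace (\<lambda>Z. Z) X Y"
    using even_trace_skew[of "\<lambda>Z. Z", OF linear_ident _ _ Y X] by simp
  finally show ?thesis by simp
qed

end

section \<open>The Levi-Civita connection\<close>

text \<open>The connection and the Ricci form are computed from these properties of \<open>A\<close>
  alone; the decomposition into ideals enters only later, when \<open>scaling x\<close> is put for
  \<open>A\<close>.\<close>

locale rescaled_killing_metric = nondegenerate_killing +
  fixes A :: "'a \<Rightarrow> 'a"
  assumes linear_A: "linear A"
    and A_even: "X \<in> gr 0 \<Longrightarrow> A X \<in> gr 0"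
    and A_odd: "X \<in> gr 1 \<Longrightarrow> A X = X"
    and A_br: "X \<in> gr 0 \<Longrightarrow> Y \<in> gr 0 \<Longrightarrow> A (br X Y) = br (A X) Y"
    and A_symmetric_even: "X \<in> gr 0 \<Longrightarrow> Y \<in> gr 0 \<Longrightarrow> K (A X) Y = K X (A Y)"
    and A_injective_even: "X \<in> gr 0 \<Longrightarrow> A X = 0 \<Longrightarrow> X = 0"
begin

definition metric :: "'a \<Rightarrow> 'a \<Rightarrow> real" where
  "metric X Y = K (A X) Y"

lemmas A_linear = linear_add[OF linear_A] linear_diff[OF linear_A] linear_cmul[OF linear_A]
  linear_neg[OF linear_A] linear_0[OF linear_A]

lemma A_mem: "X \<in> gr p \<Longrightarrow> A X \<in> gr p"
  using A_even A_odd by (cases p) auto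

lemma A_br_right:
  assumes "X \<in> gr 0" "Y \<in> gr 0"
  shows "A (br X Y) = br X (A Y)"
  using A_br[OF assms(2,1)] super_skew[OF assms] super_skew[OF assms(1) A_even[OF assms(2)]]
  by (simp add: sgn2_def A_linear)

lemma A_symmetric:
  assumes "X \<in> gr p" "Y \<in> gr q"
  shows "K (A X) Y = K X (A Y)"
proof (cases "p = q")
  case True
  then show ?thesis using assms A_symmetric_even A_odd by (cases p) auto
next
  case False
  then show ?thesis using assms K_mixed A_mem by metis
qed

lemma A_injective:
  assumes "A X = 0"
  shows "X = 0"
proof -
  have "A (part gr 0 X) + A (part gr 1 X) = 0"
    using assms part_sum[of X] linear_add[OF linear_A] by metis
  then have "A (part gr 0 X) + part gr 1 X = 0"
    by (simp only: A_odd[OF part_mem])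
  then have "part gr p (A (part gr 0 X) + part gr 1 X) = part gr p 0" for p
    by (rule arg_cong)
  then have "part gr p (A (part gr 0 X)) + part gr p (part gr 1 X) = 0" for p
    by (simp only: linear_add[OF linear_part] linear_0[OF linear_part])
  from this[of 0] this[of 1] have "A (part gr 0 X) = 0" "part gr 1 X = 0"
    by (simp_all add: part_homogeneous[OF A_even[OF part_mem]] part_homogeneous[OF part_mem]
        linear_0[OF linear_part])
  then show ?thesis using A_injective_even[OF part_mem] part_sum[of X] by (metis add_0)
qed

lemma metric_supersymmetric:
  assumes "X \<in> gr p" "Y \<in> gr q"
  shows "metric X Y = sgn2 p q * metric Y X"
  using K_supersymmetric[OF assms(1) A_mem[OF assms(2)]] A_symmetric[OF assms]
  by (simp add: metric_def)

lemma metric_mixed: "X \<in> gr p \<Longrightarrow> Y \<in> gr q \<Longrightarrow> p \<noteq> q \<Longrightarrow> metric X Y = 0"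
  using K_mixed[OF A_mem] by (simp add: metric_def)

lemma bilinear_metric: "bilinear metric"
  unfolding bilinear_def
  by (intro conjI allI linearI) (simp_all add: metric_def A_linear K_linear)

lemmas metric_linear = 
  linear_add[OF conjunct1[OF bilinear_metric[unfolded bilinear_def], rule_format]]
  linear_diff[OF conjunct1[OF bilinear_metric[unfolded bilinear_def], rule_format]]
  linear_add[OF conjunct2[OF bilinear_metric[unfolded bilinear_def], rule_format]]
  linear_diff[OF conjunct2[OF bilinear_metric[unfolded bilinear_def], rule_format]]

lemma metric_eq_0:
  assumes "\<And>p Y. Y \<in> gr p \<Longrightarrow> metric X Y = 0"
  shows "X = 0"
  using A_injective K_eq_0 assms by (simp add: metric_def)

lemma is_metric: "is_metric gr metric"
  unfolding is_metric_def even_form_def supersymmetric_def nondegenerate_def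
  using bilinear_metric metric_mixed metric_supersymmetric metric_eq_0
  by (metis zero_neq_one)

text \<open>The Koszul formula would apply the inverse of \<open>A\<close> to
  \<open>br X (A Y) - br (A X) Y\<close>. This vector is zero if the parities agree and odd
  otherwise, so the inverse acts on it as the identity.\<close>

definition conn :: "'a \<Rightarrow> 'a \<Rightarrow> 'a" where
  "conn X Y = (1/2) *\<^sub>R (br X Y + br X (A Y) - br (A X) Y)"

lemma bilinear_conn: "bilinear conn"
  unfolding bilinear_def
  by (intro conjI allI linearI) (simp_all add: conn_def A_linear br_linear algebra_simps)

lemma linear_conn: "linear (conn X)" and linear_conn_left: "linear (\<lambda>X. conn X Y)"
  using bilinear_conn by (auto simp: bilinear_def)

lemma conn_mem: "X \<in> gr p \<Longrightarrow> Y \<in> gr q \<Longrightarrow> conn X Y \<in> gr (p + q)"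
  unfolding conn_def
  by (intro subspace_scale subspace_add subspace_diff subspace_gr br_mem A_mem)

text \<open>The correction \<open>br X (A Y) - br (A X) Y\<close> is fixed by \<open>A\<close>: it
  vanishes on pairs of equal parity and is odd on mixed pairs.\<close>

lemma A_conn:
  assumes X: "X \<in> gr p" and Y: "Y \<in> gr q"
  shows "A (conn X Y) = (1/2) *\<^sub>R (A (br X Y) + br X (A Y) - br (A X) Y)"
proof (cases "p = q")
  case True
  show ?thesis
  proof (cases "p = 0")
    case True
    with \<open>p = q\<close> X Y have "br X (A Y) = br (A X) Y"
      using A_br A_br_right by metis
    then show ?thesis by (simp add: conn_def A_linear)
  next
    case False
    with \<open>p = q\<close> X Y show ?thesis by (simp add: conn_def A_odd A_linear)
  qed
next
  case False
  then have "p + q = 1" by (cases p; cases q) auto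
  then have "br X Y \<in> gr 1" "br X (A Y) \<in> gr 1" "br (A X) Y \<in> gr 1"
    using br_mem[OF X Y] br_mem[OF X A_mem[OF Y]] br_mem[OF A_mem[OF X] Y] by simp_all
  then show ?thesis by (simp add: conn_def A_linear A_odd)
qed

text \<open>By \<open>A_conn\<close> the claim is that \<open>A\<close> after \<open>conn X\<close>
  is \<open>K\<close>-skew: taking adjoints exchanges \<open>A (br X Y)\<close> with
  \<open>br X (A Y)\<close> up to sign, and \<open>br (A X)\<close> is skew by itself.\<close>

lemma conn_metric:
  assumes X: "X \<in> gr p" and Y: "Y \<in> gr q" and Z: "Z \<in> gr r"
  shows "metric (conn X Y) Z + sgn2 p q * metric Y (conn X Z) = 0"
proof -
  have "K (A (br X Y)) Z = - (sgn2 p q * K Y (br X (A Z)))"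
    using A_symmetric[OF br_mem[OF X Y] Z] K_skew[OF X Y A_mem[OF Z]] by simp
  moreover have "K (br X (A Y)) Z = - (sgn2 p q * K Y (A (br X Z)))"
    using A_symmetric[OF Y br_mem[OF X Z]] K_skew[OF X A_mem[OF Y] Z] by simp
  moreover have "K (br (A X) Y) Z = - (sgn2 p q * K Y (br (A X) Z))"
    using K_skew[OF A_mem[OF X] Y Z] .
  moreover have "metric Y (conn X Z) = K Y (A (conn X Z))"
    using A_symmetric[OF Y conn_mem[OF X Z]] by (simp add: metric_def)
  ultimately show ?thesis
    by (cases p; cases q)
      (simp_all add: sgn2_def metric_def A_conn[OF X Y] A_conn[OF X Z] K_linear algebra_simps)
qed

text \<open>The correction is supersymmetric in \<open>X\<close> and \<open>Y\<close> and cancels,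
  while the two halves of the bracket add up.\<close>

lemma conn_torsion_free:
  assumes X: "X \<in> gr p" and Y: "Y \<in> gr q"
  shows "conn X Y - sgn2 p q *\<^sub>R conn Y X = br X Y"
proof -
  have skew: "sgn2 p q *\<^sub>R br Y X = - br X Y" "sgn2 p q *\<^sub>R br (A Y) X = - br X (A Y)"
    "sgn2 p q *\<^sub>R br Y (A X) = - br (A X) Y"
    using super_skew[OF X Y] super_skew[OF X A_mem[OF Y]] super_skew[OF A_mem[OF X] Y] by simp_all
  have "sgn2 p q *\<^sub>R conn Y X
    = (1/2) *\<^sub>R (sgn2 p q *\<^sub>R br Y X + sgn2 p q *\<^sub>R br Y (A X) - sgn2 p q *\<^sub>R br (A Y) X)"
    by (simp add: conn_def scaleR_add_right scaleR_diff_right scaleR_left_commute)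
  also have "\<dots> = (1/2) *\<^sub>R (br X (A Y) - br (A X) Y - br X Y)"
    unfolding skew by simp
  finally have "conn X Y - sgn2 p q *\<^sub>R conn Y X = (1/2 + 1/2) *\<^sub>R br X Y"
    by (simp only: conn_def scaleR_add_right scaleR_diff_right scaleR_add_left) simp
  then show ?thesis by simp
qed

lemma is_levi_civita_conn: "is_levi_civita gr br metric conn"
  unfolding is_levi_civita_def even_map_def
  using bilinear_conn conn_mem conn_metric conn_torsion_free by blast

text \<open>Needed to evaluate the definite description in \<open>levi_civita\<close>. For the
  difference \<open>E\<close> of two connections, vanishing torsion makes \<open>t\<close>
  supersymmetric in its first two arguments, and compatibility with the metric makes it skew in the
  last two.\<close>

lemma levi_civita_unique:
  assumes D: "is_levi_civita gr br metric D" and D': "is_levi_civita gr br metric D'"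
  shows "D = D'"
proof -
  define E where "E X Y = D X Y - D' X Y" for X Y
  define t where "t X Y Z = metric (E X Y) Z" for X Y Z
  have mem: "E X Y \<in> gr (p + q)" if "X \<in> gr p" "Y \<in> gr q" for X Y p q
    using D D' that unfolding is_levi_civita_def even_map_def E_def
    by (meson subspace_diff subspace_gr)
  have t1: "t X Y Z = sgn2 p q * t Y X Z"
    if "X \<in> gr p" "Y \<in> gr q" for X Y Z p q
  proof -
    have "D X Y - sgn2 p q *\<^sub>R D Y X = D' X Y - sgn2 p q *\<^sub>R D' Y X"
      using D D' that unfolding is_levi_civita_def by metis
    then have "E X Y = sgn2 p q *\<^sub>R E Y X"
      unfolding E_def by (simp add: algebra_simps)
    then show ?thesis by (simp add: t_def metric_def A_linear K_linear)
  qed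
  have t2: "t X Y Z = - (sgn2 q r * t X Z Y)"
    if X: "X \<in> gr p" and Y: "Y \<in> gr q" and Z: "Z \<in> gr r" for X Y Z p q r
  proof -
    have "metric (D X Y) Z + sgn2 p q * metric Y (D X Z) = 0"
      "metric (D' X Y) Z + sgn2 p q * metric Y (D' X Z) = 0"
      using D D' that unfolding is_levi_civita_def by metis+
    then have "t X Y Z + sgn2 p q * metric Y (E X Z) = 0"
      by (simp add: t_def E_def metric_linear algebra_simps)
    moreover have "metric Y (E X Z) = sgn2 q (p + r) * t X Z Y"
      unfolding t_def by (rule metric_supersymmetric[OF Y mem[OF X Z]])
    ultimately show ?thesis
      by (cases p; cases q; cases r) (simp_all add: sgn2_def)
  qed
  have t0: "t X Y Z = 0"
    if X: "X \<in> gr p" and Y: "Y \<in> gr q" and Z: "Z \<in> gr r" for X Y Z p q r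
    \<comment> \<open>the braid relation in \<open>S\<^sub>3\<close>: \<open>t\<close> is symmetric in the first and skew in the last pair\<close>
    using t2[OF X Y Z] t1[OF X Z, of Y] t2[OF Z X Y] t1[OF Z Y, of X] t2[OF Y Z X] t1[OF X Y, of Z]
    by (cases p; cases q; cases r) (simp_all add: sgn2_def)
  have E0: "E X Y = 0" if "X \<in> gr p" "Y \<in> gr q" for X Y p q
    using t0[OF that] metric_eq_0[of "E X Y"] by (simp add: t_def)
  have bil: "bilinear D" "bilinear D'"
    using D D' by (simp_all add: is_levi_civita_def)
  have "D X Y = D' X Y" for X Y
  proof (induction X rule: homogeneous_cases)
    case (homogeneous p X)
    show ?case
      by (induction Y rule: homogeneous_cases)
        (use E0 homogeneous in \<open>auto simp: E_def bilinear_radd[OF bil(1)] bilinear_radd[OF bil(2)]\<close>)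
  qed (simp add: bilinear_ladd[OF bil(1)] bilinear_ladd[OF bil(2)])
  then show ?thesis by blast
qed

lemma levi_civita_eq: "levi_civita gr br metric = conn"
  unfolding levi_civita_def
  using is_levi_civita_conn levi_civita_unique by blast

end

section \<open>The Ricci curvature\<close>

context rescaled_killing_metric
begin

lemma curvature_add:
  "curvature gr br metric Z (X + X') Y = curvature gr br metric Z X Y + curvature gr br metric Z X' Y"
  "curvature gr br metric Z X (Y + Y') = curvature gr br metric Z X Y + curvature gr br metric Z X Y'"
  unfolding curvature_def Let_def levi_civita_eq sum_UNIV_bit
  by (simp_all add: linear_add[OF linear_part] linear_add[OF linear_conn] linear_add[OF linear_conn_left]
      br_linear scaleR_add_right)

lemma ricci_add:
  "ricci gr br metric (X + X') Y = ricci gr br metric X Y + ricci gr br metric X' Y"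
  "ricci gr br metric X (Y + Y') = ricci gr br metric X Y + ricci gr br metric X Y'"
  unfolding ricci_def by (simp_all add: curvature_add supertrace_add)

lemma curvature_homogeneous:
  assumes Z: "Z \<in> gr p" and X: "X \<in> gr q"
  shows "curvature gr br metric Z X Y
    = conn Z (conn X Y) - sgn2 p q *\<^sub>R conn X (conn Z Y) - conn (br Z X) Y"
  unfolding curvature_def Let_def levi_civita_eq sum_UNIV_bit
  by (cases p; cases q)
    (simp_all add: part_homogeneous[OF Z] part_homogeneous[OF X] linear_0[OF linear_conn] linear_0[OF linear_conn_left])

lemma curvature_mem:
  assumes Z: "Z \<in> gr p" and X: "X \<in> gr q" and Y: "Y \<in> gr r"
  shows "curvature gr br metric Z X Y \<in> gr (q + r + p)"
proof -
  have "conn Z (conn X Y) \<in> gr (p + (q + r))" "conn X (conn Z Y) \<in> gr (q + (p + r))"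
    "conn (br Z X) Y \<in> gr (p + q + r)"
    by (intro conn_mem br_mem assms)+
  moreover have "p + (q + r) = q + r + p" "q + (p + r) = q + r + p" "p + q + r = q + r + p"
    by (simp_all only: ac_simps)
  ultimately show ?thesis
    unfolding curvature_homogeneous[OF Z X]
    by (metis subspace_diff subspace_gr subspace_scale)
qed

lemma ricci_mixed:
  assumes "X \<in> gr p" "Y \<in> gr q" "p \<noteq> q"
  shows "ricci gr br metric X Y = 0"
proof -
  have "p + q = 1" using assms(3) by (cases p; cases q) auto
  then show ?thesis
    unfolding ricci_def using curvature_mem[OF _ assms(1,2)] by (intro supertrace_odd) metis
qed

section \<open>The curvature in each parity and its traces\<close>

lemma conn_simps:
  "X \<in> gr 0 \<Longrightarrow> Y \<in> gr 0 \<Longrightarrow> conn X Y = (1/2) *\<^sub>R br X Y"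
  "X \<in> gr 1 \<Longrightarrow> Y \<in> gr 1 \<Longrightarrow> conn X Y = (1/2) *\<^sub>R br X Y"
  "X \<in> gr 0 \<Longrightarrow> Y \<in> gr 1 \<Longrightarrow> conn X Y = br X Y - (1/2) *\<^sub>R br (A X) Y"
  "X \<in> gr 1 \<Longrightarrow> Y \<in> gr 0 \<Longrightarrow> conn X Y = (1/2) *\<^sub>R br X (A Y)"
  using A_br[of X Y] A_br_right[of X Y]
  by (simp_all add: conn_def A_odd algebra_simps flip: scaleR_add_left)

text \<open>The digits in the name are the parities of \<open>Z\<close>, \<open>X\<close>,
  \<open>Y\<close>. Here \<open>A\<close> drops out, as for a bi-invariant metric on a Lie algebra.
  In this lemma and the next three, \<open>Z\<close> is moved to the innermost position, so that the
  right-hand side is an operator in \<open>Z\<close> ready for the trace.\<close>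

lemma curvature_000:
  assumes Z: "Z \<in> gr 0" and X: "X \<in> gr 0" and Y: "Y \<in> gr 0"
  shows "curvature gr br metric Z X Y = (-1/4) *\<^sub>R br Y (br X Z)"
proof -
  note m = br00[OF X Y] br00[OF Z Y] br00[OF Z X] br00[OF X Z]
  have "curvature gr br metric Z X Y
    = (1/4) *\<^sub>R (br Z (br X Y) - br X (br Z Y) - br (br Z X) Y) - (1/4) *\<^sub>R br (br Z X) Y"
    by (simp add: curvature_homogeneous[OF Z X] conn_simps(1) assms m sgn2_def br_linear linear_cmul[OF linear_conn]
        algebra_simps flip: scaleR_add_left)
  also have "\<dots> = (-1/4) *\<^sub>R br (br Z X) Y"
    by (simp add: jacobi_even[OF Z X])
  also have "br (br Z X) Y = br Y (br X Z)"
    using br_swap(1)[OF X Z] br_swap(1)[OF Y m(4)] by (simp add: br_linear)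
  finally show ?thesis .
qed

lemma curvature_100:
  assumes Z: "Z \<in> gr 1" and X: "X \<in> gr 0" and Y: "Y \<in> gr 0"
  shows "curvature gr br metric Z X Y = (-1/4) *\<^sub>R br (A (br X Y)) Z + (1/2) *\<^sub>R br X (br (A Y) Z)
    - (1/4) *\<^sub>R br (A X) (br (A Y) Z) - (1/2) *\<^sub>R br (A Y) (br X Z)"
proof -
  note mA = A_even[OF X] A_even[OF Y]
  note m = br00[OF X Y] A_even[OF br00[OF X Y]] br00[OF X Z] br10[OF Z X] br10[OF Z mA(2)] br10[OF Z A_even[OF br00[OF X Y]]]
  have "curvature gr br metric Z X Y = (1/4) *\<^sub>R br Z (A (br X Y)) - (1/2) *\<^sub>R br X (br Z (A Y))
      + (1/4) *\<^sub>R br (A X) (br Z (A Y)) - (1/2) *\<^sub>R br (br Z X) (A Y)"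
    by (simp add: curvature_homogeneous[OF Z X] conn_simps assms m sgn2_def br_linear 
        linear_cmul[OF linear_conn] algebra_simps)
  also have "br Z (A (br X Y)) = - br (A (br X Y)) Z"
    by (rule br_swap(1)[OF m(2) Z])
  also have "br Z (A Y) = - br (A Y) Z"
    by (rule br_swap(1)[OF mA(2) Z])
  also have "br (br Z X) (A Y) = br (A Y) (br X Z)"
    using br_swap(1)[OF mA(2) m(4)] br_swap(1)[OF X Z] by (simp add: br_linear)
  finally show ?thesis by (simp add: br_linear)
qed

lemma curvature_011:
  assumes Z: "Z \<in> gr 0" and X: "X \<in> gr 1" and Y: "Y \<in> gr 1"
  shows "curvature gr br metric Z X Y = (1/4) *\<^sub>R br (br X Y) Z - (1/4) *\<^sub>R br X (br Y (A Z))"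
proof -
  note m = br11[OF X Y] br00[OF Z Y] br00[OF A_even[OF Z] Y] br00[OF Z X]
  have "curvature gr br metric Z X Y = (1/4) *\<^sub>R br Z (br X Y) - (1/2) *\<^sub>R (br X (br Z Y) + br (br Z X) Y)
      + (1/4) *\<^sub>R br X (br (A Z) Y)"
    by (simp add: curvature_homogeneous[OF Z X] conn_simps assms m sgn2_def br_linear linear_diff[OF linear_conn]
        linear_cmul[OF linear_conn] algebra_simps)
  \<comment> \<open>This turns the coefficient 1/4 of \<open>br Z (br X Y)\<close> into -1/4;
    exchanging \<open>Z\<close> and \<open>br X Y\<close> then makes it positive.\<close>
  also have "br X (br Z Y) + br (br Z X) Y = br Z (br X Y)"
    by (simp add: jacobi_even[OF Z X])
  also have "br Z (br X Y) = - br (br X Y) Z"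
    by (rule br_swap(1)[OF m(1) Z])
  also have "br (A Z) Y = - br Y (A Z)"
    using br_swap(1)[OF A_even[OF Z] Y] by simp
  finally show ?thesis
    by (simp add: br_linear flip: scaleR_left_diff_distrib)
qed

lemma curvature_111:
  assumes Z: "Z \<in> gr 1" and X: "X \<in> gr 1" and Y: "Y \<in> gr 1"
  shows "curvature gr br metric Z X Y = (-1/4) *\<^sub>R br (A (br X Y)) Z + (1/4) *\<^sub>R br X (A (br Y Z))
    + br Y (br X Z) - (1/2) *\<^sub>R br Y (A (br X Z))"
proof -
  note m = br11[OF X Y] br11[OF Z Y] br11[OF Z X] A_even[OF br11[OF X Y]]
  have "curvature gr br metric Z X Y = (1/4) *\<^sub>R br Z (A (br X Y)) + (1/4) *\<^sub>R br X (A (br Z Y))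
      - br (br Z X) Y + (1/2) *\<^sub>R br (A (br Z X)) Y"
    by (simp add: curvature_homogeneous[OF Z X] conn_simps assms m sgn2_def br_linear A_linear
        linear_cmul[OF linear_conn] algebra_simps)
  also have "br Z (A (br X Y)) = - br (A (br X Y)) Z"
    by (rule br_swap(1)[OF m(4) Z])
  also have "br Z Y = br Y Z"
    by (rule br_swap(2)[OF Y Z])
  also have "br Z X = br X Z"
    by (rule br_swap(2)[OF X Z])
  also have "br (br X Z) Y = - br Y (br X Z)"
    using br_swap(1)[OF br11[OF X Z] Y] by simp
  also have "br (A (br X Z)) Y = - br Y (A (br X Z))"
    using br_swap(1)[OF A_even[OF br11[OF X Z]] Y] by simp
  finally show ?thesis by simp
qed

text \<open>The supertrace subtracts the odd block, which is why the second term changes sign from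
  \<open>tr1\<close> to the result.\<close>

lemma ricci_even:
  assumes X: "X \<in> gr 0" and Y: "Y \<in> gr 0"
  shows "ricci gr br metric X Y
    = - (1/4) * trace_form br (gr 0) X Y + (1/4) * trace_form br (gr 1) (A X) (A Y)"
proof -
  have mem: "curvature gr br metric Z X Y \<in> gr p" if "Z \<in> gr p" for Z p
    using curvature_mem[OF that X Y] by (cases p) simp_all
  note A = A_even[OF X] A_even[OF Y] A_even[OF br00[OF X Y]]
  have tr0: "trace_on (gr 0) (\<lambda>Z. curvature gr br metric Z X Y) = - (1/4) * trace_form br (gr 0) X Y"
  proof -
    have "trace_on (gr 0) (\<lambda>Z. curvature gr br metric Z X Y)
      = trace_on (gr 0) (\<lambda>Z. (-1/4) *\<^sub>R br Y (br X Z))"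
      using curvature_000[OF _ X Y]
      by (intro trace_on_cong subspace_gr subspace_scale[OF subspace_gr] br00 X Y)
    also have "\<dots> = (-1/4) * trace_on (gr 0) (\<lambda>Z. br Y (br X Z))"
      by (intro trace_on_scale subspace_gr br00 X Y)
    also have "trace_on (gr 0) (\<lambda>Z. br Y (br X Z)) = trace_on (gr 0) (\<lambda>Z. br X (br Y Z))"
      by (intro trace_on_commute subspace_gr linear_br br00 X Y)
    finally show ?thesis by (simp add: trace_form_def o_def)
  qed
  have tr1: "trace_on (gr 1) (\<lambda>Z. curvature gr br metric Z X Y) = - (1/4) * trace_form br (gr 1) (A X) (A Y)"
  proof -
    note mem1 = subspace_add[OF subspace_gr] subspace_diff[OF subspace_gr] subspace_scale[OF subspace_gr]
      br00[OF A(1)] br00[OF A(2)] br00[OF A(3)] br00[OF X]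
    have "trace_on (gr 1) (\<lambda>Z. curvature gr br metric Z X Y)
      = trace_on (gr 1) (\<lambda>Z. (-1/4) *\<^sub>R br (A (br X Y)) Z + (1/2) *\<^sub>R br X (br (A Y) Z)
          - (1/4) *\<^sub>R br (A X) (br (A Y) Z) - (1/2) *\<^sub>R br (A Y) (br X Z))"
      using curvature_100[OF _ X Y] by (intro trace_on_cong subspace_gr mem1)
    also have "\<dots> = (-1/4) * trace_on (gr 1) (br (A (br X Y))) + (1/2) * trace_on (gr 1) (\<lambda>Z. br X (br (A Y) Z))
        - (1/4) * trace_on (gr 1) (\<lambda>Z. br (A X) (br (A Y) Z)) - (1/2) * trace_on (gr 1) (\<lambda>Z. br (A Y) (br X Z))"
      using mem1 by (simp only: trace_on_add[OF subspace_gr] trace_on_diff[OF subspace_gr] trace_on_scale[OF subspace_gr])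
    \<comment> \<open>The two terms with coefficient 1/2 have equal traces and cancel.\<close>
    also have "trace_on (gr 1) (\<lambda>Z. br (A Y) (br X Z)) = trace_on (gr 1) (\<lambda>Z. br X (br (A Y) Z))"
      by (intro trace_on_commute subspace_gr linear_br br00 X A)
    also have "trace_on (gr 1) (br (A (br X Y))) = 0"
      by (rule trace_ad[OF A(3)])
    finally show ?thesis by (simp add: trace_form_def o_def)
  qed
  show ?thesis
    unfolding ricci_def using supertrace_even[of "\<lambda>Z. curvature gr br metric Z X Y", OF mem] tr0 tr1 by simp
qed

text \<open>The even block gives -1/4 and the odd block -3/4 of \<open>even_trace A X Y\<close>, the
  latter together with half of \<open>K X Y\<close>; their difference is the claim.\<close>

lemma ricci_odd:
  assumes X: "X \<in> gr 1" and Y: "Y \<in> gr 1"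
  shows "ricci gr br metric X Y = (1/2) * even_trace A X Y - (1/2) * K X Y"
proof -
  have mem: "curvature gr br metric Z X Y \<in> gr p" if "Z \<in> gr p" for Z p
    using curvature_mem[OF that X Y] by (cases p) simp_all
  note mem1 = subspace_add[OF subspace_gr] subspace_diff[OF subspace_gr] subspace_scale[OF subspace_gr]
    br11[OF X] br11[OF Y] br10[OF X] br10[OF Y] br00[OF br11[OF X Y]] br00[OF A_even[OF br11[OF X Y]]] A_even
  have skew: "even_trace A Y X = - even_trace A X Y"
    by (rule even_trace_skew[OF linear_A A_even A_symmetric_even Y X])
  have tr0: "trace_on (gr 0) (\<lambda>Z. curvature gr br metric Z X Y) = - (1/4) * even_trace A X Y"
  proof -
    have "trace_on (gr 0) (\<lambda>Z. curvature gr br metric Z X Y)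
      = trace_on (gr 0) (\<lambda>Z. (1/4) *\<^sub>R br (br X Y) Z - (1/4) *\<^sub>R br X (br Y (A Z)))"
      using curvature_011[OF _ X Y] by (intro trace_on_cong subspace_gr mem1)
    also have "\<dots> = (1/4) * trace_on (gr 0) (br (br X Y)) - (1/4) * trace_on (gr 0) (\<lambda>Z. br X (br Y (A Z)))"
      using mem1 by (simp only: trace_on_add[OF subspace_gr] trace_on_diff[OF subspace_gr] trace_on_scale[OF subspace_gr])
    finally show ?thesis
      using trace_ad[OF br11[OF X Y]] even_trace_right[OF linear_A A_even X Y] by simp
  qed
  \<comment> \<open>The coefficient -3/4 collects -1/4 from the second term, whose trace is
    \<open>even_trace A Y X\<close>, and -1/2 from the last one.\<close>
  have tr1: "trace_on (gr 1) (\<lambda>Z. curvature gr br metric Z X Y) = (1/2) * K X Y - (3/4) * even_trace A X Y"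
  proof -
    have "trace_on (gr 1) (\<lambda>Z. curvature gr br metric Z X Y)
      = trace_on (gr 1) (\<lambda>Z. (-1/4) *\<^sub>R br (A (br X Y)) Z + (1/4) *\<^sub>R br X (A (br Y Z))
          + br Y (br X Z) - (1/2) *\<^sub>R br Y (A (br X Z)))"
      using curvature_111[OF _ X Y] by (intro trace_on_cong subspace_gr mem1)
    also have "\<dots> = (-1/4) * trace_on (gr 1) (br (A (br X Y))) + (1/4) * trace_on (gr 1) (\<lambda>Z. br X (A (br Y Z)))
        + trace_on (gr 1) (\<lambda>Z. br Y (br X Z)) - (1/2) * trace_on (gr 1) (\<lambda>Z. br Y (A (br X Z)))"
      using mem1 by (simp only: trace_on_add[OF subspace_gr] trace_on_diff[OF subspace_gr] trace_on_scale[OF subspace_gr])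
    also have "trace_on (gr 1) (\<lambda>Z. br Y (br X Z)) = (1/2) * K X Y"
      using odd_trace[of "\<lambda>Z. Z", OF linear_ident _ Y X] K_odd[OF X Y] by simp
    finally show ?thesis
      using trace_ad[OF A_even[OF br11[OF X Y]]] odd_trace[OF linear_A A_even X Y] 
        odd_trace[OF linear_A A_even Y X] skew by simp
  qed
  show ?thesis
    unfolding ricci_def using supertrace_even[of "\<lambda>Z. curvature gr br metric Z X Y", OF mem] tr0 tr1 by simp
qed

text \<open>Mixed pairs satisfy the equation trivially, both sides being zero by parity; on odd
  pairs \<open>ricci_odd\<close> is multiplied by 2 and the \<open>K\<close> terms are
  collected.\<close>

lemma einstein_iff:
  "einstein gr br metric c \<longleftrightarrow>
     (\<forall>X\<in>gr 0. \<forall>Y\<in>gr 0. - (1/4) * trace_form br (gr 0) X Y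
        + (1/4) * trace_form br (gr 1) (A X) (A Y) = c * K (A X) Y) \<and>
     (\<forall>X\<in>gr 1. \<forall>Y\<in>gr 1. even_trace A X Y = (2 * c + 1) * K X Y)"
  (is "_ \<longleftrightarrow> ?E \<and> ?O")
proof -
  have odd: "ricci gr br metric X Y = c * metric X Y \<longleftrightarrow> even_trace A X Y = (2 * c + 1) * K X Y"
    if "X \<in> gr 1" "Y \<in> gr 1" for X Y
    unfolding ricci_odd[OF that] metric_def A_odd[OF that(1)] by (simp add: field_simps)
  have even: "ricci gr br metric X Y = c * metric X Y \<longleftrightarrow> - (1/4) * trace_form br (gr 0) X Y
        + (1/4) * trace_form br (gr 1) (A X) (A Y) = c * K (A X) Y"
    if "X \<in> gr 0" "Y \<in> gr 0" for X Y
    unfolding ricci_even[OF that] metric_def ..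
  have "ricci gr br metric X Y = c * metric X Y" if "?E" "?O" for X Y
  proof (induction X rule: homogeneous_cases)
    case (homogeneous p X)
    show ?case
    proof (induction Y rule: homogeneous_cases)
      case (homogeneous q Y)
      show ?case
      proof (cases "p = q")
        case True
        then show ?thesis
          using even[of X Y] odd[of X Y] \<open>?E\<close> \<open>?O\<close> homogeneous \<open>X \<in> gr p\<close> by (cases p) auto
      next
        case False
        then show ?thesis
          using ricci_mixed metric_mixed homogeneous \<open>X \<in> gr p\<close> by (metis mult_zero_right)
      qed
    qed (simp add: ricci_add metric_linear distrib_left)
  qed (simp add: ricci_add metric_linear distrib_left)
  then show ?thesis
    unfolding einstein_def using is_metric even odd by auto
qed

end

section \<open>Real endomorphisms and quadratic factors\<close>

text \<open>A complex root \<open>z\<close> yields a real linear factor if it is real, and otherwise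
  the real quadratic with the roots \<open>z\<close> and its conjugate; \<open>a\<close> and
  \<open>b\<close> are the real and imaginary parts of \<open>z\<close>.\<close>

lemma real_poly_factor:
  fixes p :: "real poly"
  assumes "degree p > 0"
  obtains a q where "p = [:- a, 1:] * q"
  | a b q where "p = [:a\<^sup>2 + b\<^sup>2, - 2 * a, 1:] * q"
proof -
  define ev where "ev p z = poly (map_poly complex_of_real p) z" for p z
  have ev_mult: "ev (p * q) z = ev p z * ev q z" for p q z
  proof -
    have "map_poly complex_of_real (p * q) = map_poly of_real p * map_poly of_real q"
      by (rule poly_eqI) (simp add: coeff_map_poly coeff_mult)
    then show ?thesis by (simp add: ev_def)
  qed
  have ev_add: "ev (p + q) z = ev p z + ev q z" for p q z
  proof -
    have "map_poly complex_of_real (p + q) = map_poly of_real p + map_poly of_real q"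
      by (rule poly_eqI) (simp add: coeff_map_poly)
    then show ?thesis by (simp add: ev_def)
  qed
  have ev_of_real: "ev p (of_real x) = of_real (poly p x)" for p x
    by (induction p) (simp_all add: ev_def map_poly_pCons)
  have "degree (map_poly complex_of_real p) = degree p"
    by (simp add: degree_map_poly)
  then have "\<not> (\<exists>a l. a \<noteq> 0 \<and> l = 0 \<and> map_poly complex_of_real p = pCons a l)"
    using assms by force
  then obtain z where z: "ev p z = 0"
    using fundamental_theorem_of_algebra_alt unfolding ev_def by blast
  show thesis
  proof (cases "Im z = 0")
    case True
    then have "z = of_real (Re z)" by (simp add: complex_eq_iff)
    then have "complex_of_real (poly p (Re z)) = 0"
      using z ev_of_real by metis
    then have "[:- Re z, 1:] dvd p" by (simp add: poly_eq_0_iff_dvd)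
    then show thesis using that(1) by (auto elim: dvdE)
  next
    case False
    define f where "f = [:(Re z)\<^sup>2 + (Im z)\<^sup>2, - 2 * Re z, 1:]"
    have f: "ev f z = 0" 
      by (simp add: ev_def f_def map_poly_pCons complex_eq_iff power2_eq_square algebra_simps)
    have "degree (p mod f) < 2"
      using degree_mod_less[of f p] by (force simp: f_def)
    then obtain r0 r1 where r: "p mod f = [:r0, r1:]"
      using that by (metis less_2_cases_iff degree_0_id degree_eq_zeroE pCons_0_0 pCons_cases degree_pCons_eq Suc_inject One_nat_def)
    have "ev p z = ev (p div f) z * ev f z + ev (p mod f) z"
      by (metis div_mult_mod_eq ev_add ev_mult)
    then have "of_real r0 + z * of_real r1 = 0"
      using f z by (simp add: r ev_def map_poly_pCons)
    \<comment> \<open>A real polynomial of degree at most 1 with a nonreal root is zero, so the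
      remainder vanishes.\<close>
    then have "r1 = 0 \<and> r0 = 0" using False by (auto simp: complex_eq_iff)
    then have "p = f * (p div f)" using r by (metis div_mult_mod_eq add.right_neutral mult.commute pCons_0_0)
    then show thesis using that(2) unfolding f_def by blast
  qed
qed

section \<open>Polynomials in an endomorphism\<close>

definition poly_op :: "('a::real_vector \<Rightarrow> 'a) \<Rightarrow> real poly \<Rightarrow> 'a \<Rightarrow> 'a" where
  "poly_op T p u = (\<Sum>i\<le>degree p. coeff p i *\<^sub>R (T ^^ i) u)"

lemma poly_op_bound:
  assumes "degree p \<le> n"
  shows "poly_op T p u = (\<Sum>i\<le>n. coeff p i *\<^sub>R (T ^^ i) u)"
  unfolding poly_op_def
  using assms by (intro sum.mono_neutral_left) (auto simp: coeff_eq_0)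

lemma poly_op_add: "poly_op T (p + q) u = poly_op T p u + poly_op T q u"
  using poly_op_bound[of p "max (degree p) (degree q)" T u]
    poly_op_bound[of q "max (degree p) (degree q)" T u]
    poly_op_bound[of "p + q" "max (degree p) (degree q)" T u]
  by (simp add: degree_add_le_max scaleR_add_left sum.distrib)

lemma poly_op_smult: "poly_op T (smult c p) u = c *\<^sub>R poly_op T p u"
  using poly_op_bound[of "smult c p" "degree p" T u] poly_op_bound[of p "degree p" T u]
  by (simp add: scaleR_sum_right)

lemma poly_op_pCons:
  assumes "linear T"
  shows "poly_op T (pCons c p) u = c *\<^sub>R u + T (poly_op T p u)"
proof -
  have "poly_op T (pCons c p) u = (\<Sum>i\<le>Suc (degree p). coeff (pCons c p) i *\<^sub>R (T ^^ i) u)"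
    by (rule poly_op_bound) (simp add: degree_pCons_le)
  also have "\<dots> = c *\<^sub>R u + (\<Sum>i\<le>degree p. coeff p i *\<^sub>R T ((T ^^ i) u))"
    by (subst sum.atMost_Suc_shift) simp
  also have "\<dots> = c *\<^sub>R u + T (poly_op T p u)"
    by (simp add: poly_op_def linear_sum[OF assms] linear_cmul[OF assms])
  finally show ?thesis .
qed

lemma poly_op_mem:
  assumes "subspace V" "\<And>v. v \<in> V \<Longrightarrow> T v \<in> V" "u \<in> V"
  shows "poly_op T p u \<in> V"
proof -
  have "(T ^^ i) u \<in> V" for i by (induction i) (auto simp: assms)
  then show ?thesis
    unfolding poly_op_def by (intro subspace_sum subspace_scale assms(1))
qed

context finite_dim_space
begin

text \<open>Finite dimension forces some iterate \<open>(T ^^ n) u\<close> into the span of the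
  earlier ones. That relation is a monic polynomial of degree \<open>n\<close> killing
  \<open>u\<close>.\<close>

lemma ex_annihilating_poly:
  fixes u :: 'a
  shows "\<exists>p. p \<noteq> 0 \<and> poly_op T p u = 0"
proof -
  define S where "S n = (\<lambda>i. (T ^^ i) u) ` {..<n}" for n :: nat
  have S_Suc: "S (Suc n) = insert ((T ^^ n) u) (S n)" for n
    by (simp add: S_def lessThan_Suc)
  have "\<exists>n. (T ^^ n) u \<in> span (S n)"
  proof (rule ccontr)
    assume *: "\<nexists>n. (T ^^ n) u \<in> span (S n)"
    have ind: "independent (S n) \<and> card (S n) = n" for n
    proof (induction n)
      case 0
      then show ?case by (simp add: S_def independent_empty)
    next
      case (Suc n)
      have "finite (S n)" by (simp add: S_def)
      moreover have "(T ^^ n) u \<notin> S n" using * span_base by blast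
      ultimately show ?case
        using * Suc by (simp add: S_Suc independent_insert)
    qed
    obtain B where B: "finite B" "span B = (UNIV :: 'a set)" using fin_dim by blast
    show False
      using independent_span_bound[OF B(1), of "S (Suc (card B))"] ind[of "Suc (card B)"] B(2) by auto
  qed
  then obtain n where n: "(T ^^ n) u \<in> span (S n)" by blast
  \<comment> \<open>All values of polynomials of degree below \<open>n\<close>: a subspace
    containing \<open>S n\<close>, so that membership in \<open>span (S n)\<close> becomes a
    polynomial expression.\<close>
  define P where "P = {poly_op T p u | p. \<forall>i\<ge>n. coeff p i = 0}"
  have "subspace P"
  proof (rule subspaceI)
    have "poly_op T 0 u = 0" by (simp add: poly_op_def)
    then show "0 \<in> P" unfolding P_def by (intro CollectI exI[of _ 0]) simp
  next
    fix x y assume "x \<in> P" "y \<in> P"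
    then obtain p q where "x = poly_op T p u" "y = poly_op T q u" "\<forall>i\<ge>n. coeff p i = 0" "\<forall>i\<ge>n. coeff q i = 0"
      by (auto simp: P_def)
    then show "x + y \<in> P"
      unfolding P_def by (intro CollectI exI[of _ "p + q"]) (simp add: poly_op_add)
  next
    fix c x assume "x \<in> P"
    then obtain p where "x = poly_op T p u" "\<forall>i\<ge>n. coeff p i = 0"
      by (auto simp: P_def)
    then show "c *\<^sub>R x \<in> P"
      unfolding P_def by (intro CollectI exI[of _ "smult c p"]) (simp add: poly_op_smult)
  qed
  have mon: "poly_op T (monom 1 i) u = (T ^^ i) u" for i
  proof -
    have "poly_op T (monom 1 i) u = (\<Sum>j\<le>i. coeff (monom 1 i) j *\<^sub>R (T ^^ j) u)"
      by (rule poly_op_bound) (rule degree_monom_le)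
    also have "\<dots> = (\<Sum>j\<le>i. if i = j then (T ^^ j) u else 0)"
      by (rule sum.cong) auto
    finally show ?thesis by simp
  qed
  have "S n \<subseteq> P"
    unfolding S_def P_def using mon by (auto intro!: exI[of _ "monom 1 _"] simp: coeff_monom)
  then have "(T ^^ n) u \<in> P"
    using n \<open>subspace P\<close> span_minimal by blast
  then obtain p where p: "(T ^^ n) u = poly_op T p u" "\<forall>i\<ge>n. coeff p i = 0"
    by (auto simp: P_def)
  have "coeff (monom 1 n + smult (-1) p) n = 1" using p(2) by (simp add: coeff_monom)
  then have "monom 1 n + smult (-1) p \<noteq> 0" by (metis coeff_0 zero_neq_one)
  moreover have "poly_op T (monom 1 n + smult (-1) p) u = 0"
    using p(1) by (simp only: poly_op_add poly_op_smult mon) simp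
  ultimately show ?thesis by blast
qed

text \<open>Induction on the degree of a polynomial killing \<open>u\<close>. Split off a real
  factor, with cofactor \<open>q\<close>, and put \<open>w = poly_op T q u\<close>: either
  \<open>w\<close> is nonzero and killed by the factor, or \<open>q\<close> of smaller degree kills
  \<open>u\<close>.\<close>

lemma ex_quadratic_eigenvector:
  fixes V :: "'a set"
  assumes V: "subspace V" "V \<noteq> {0}" and T: "linear T" "\<And>v. v \<in> V \<Longrightarrow> T v \<in> V"
  obtains a b u where "u \<in> V" "u \<noteq> 0" "T (T u) - (2 * a) *\<^sub>R T u + (a\<^sup>2 + b\<^sup>2) *\<^sub>R u = 0"
proof -
  have ex: "\<exists>a b u. u \<in> V \<and> u \<noteq> 0 \<and> T (T u) - (2 * a) *\<^sub>R T u + (a\<^sup>2 + b\<^sup>2) *\<^sub>R u = 0"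
    if "p \<noteq> 0" "poly_op T p u = 0" "u \<in> V" "u \<noteq> 0" for p u
    using that
  proof (induction "degree p" arbitrary: p rule: less_induct)
    case less
    show ?case
    proof (cases "degree p = 0")
      case True
      then obtain c where "p = [:c:]" by (rule degree_eq_zeroE)
      then show ?thesis using less.prems by (simp add: poly_op_def)
    next
      case False
      then have "degree p > 0" by simp
      then show ?thesis
      proof (cases rule: real_poly_factor)
        case (1 a q)
        define w where "w = poly_op T q u"
        have q: "q \<noteq> 0" using 1 less.prems by auto
        have "p = smult (- a) q + pCons 0 q" by (simp add: 1)
        then have "poly_op T p u = - a *\<^sub>R w + T w"
          by (simp only: poly_op_add poly_op_smult poly_op_pCons[OF T(1)] w_def scaleR_zero_left add_0)
        then have eq: "T w = a *\<^sub>R w"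
          using less.prems(2) by simp
        show ?thesis
        proof (cases "w = 0")
          case True
          have "degree q < degree p" using degree_mult_eq[of "[:- a, 1:]" q] q unfolding 1 by simp
          then show ?thesis using less q True by (simp add: w_def)
        next
          case False
          have "w \<in> V" unfolding w_def by (rule poly_op_mem[OF V(1) T(2) less.prems(3)])
          \<comment> \<open>A real eigenvector is the case \<open>b = 0\<close>: the quadratic is
            then the square of the linear factor.\<close>
          moreover have "T (T w) - (2 * a) *\<^sub>R T w + (a\<^sup>2 + 0\<^sup>2) *\<^sub>R w = 0"
            by (simp add: eq linear_cmul[OF T(1)] power2_eq_square algebra_simps flip: scaleR_add_left)
          ultimately show ?thesis using False by blast
        qed
      next
        case (2 a b q)
        define w where "w = poly_op T q u"
        have q: "q \<noteq> 0" using 2 less.prems by auto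
        have "p = smult (a\<^sup>2 + b\<^sup>2) q + pCons 0 (smult (- 2 * a) q + pCons 0 q)" by (simp add: 2)
        then have "poly_op T p u = (a\<^sup>2 + b\<^sup>2) *\<^sub>R w + T ((- 2 * a) *\<^sub>R w + T w)"
          by (simp only: poly_op_add poly_op_smult poly_op_pCons[OF T(1)] w_def scaleR_zero_left add_0)
        then have eq: "T (T w) - (2 * a) *\<^sub>R T w + (a\<^sup>2 + b\<^sup>2) *\<^sub>R w = 0"
          using less.prems(2)
          by (simp add: linear_add[OF T(1)] linear_cmul[OF T(1)] linear_neg[OF T(1)] linear_diff[OF T(1)] algebra_simps)
        show ?thesis
        proof (cases "w = 0")
          case True
          have "degree q < degree p" using degree_mult_eq[of "[:a\<^sup>2 + b\<^sup>2, - 2 * a, 1:]" q] q unfolding 2 by simp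
          then show ?thesis using less q True by (simp add: w_def)
        next
          case False
          have "w \<in> V" unfolding w_def by (rule poly_op_mem[OF V(1) T(2) less.prems(3)])
          then show ?thesis using False eq by blast
        qed
      qed
    qed
  qed
  obtain u where "u \<in> V" "u \<noteq> 0" using V subspace_0 by blast
  then show thesis using ex_annihilating_poly[of T u] ex that by metis
qed

end

section \<open>Symmetric intertwiners of the odd part\<close>

locale simple_killing = nondegenerate_killing +
  assumes simple: "simple_superalgebra gr br"
begin

section \<open>Consequences of simplicity\<close>

lemma part_br:
  "part gr 0 (br V Z) = br (part gr 0 V) (part gr 0 Z) + br (part gr 1 V) (part gr 1 Z)"
  "part gr 1 (br V Z) = br (part gr 0 V) (part gr 1 Z) + br (part gr 1 V) (part gr 0 Z)"
proof -
  have "br V Z = br (part gr 0 V + part gr 1 V) (part gr 0 Z + part gr 1 Z)"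
    using part_sum by metis
  also have "\<dots> = (br (part gr 0 V) (part gr 0 Z) + br (part gr 1 V) (part gr 1 Z))
      + (br (part gr 0 V) (part gr 1 Z) + br (part gr 1 V) (part gr 0 Z))"
    by (simp add: br_linear)
  finally have eq: "br V Z = (br (part gr 0 V) (part gr 0 Z) + br (part gr 1 V) (part gr 1 Z))
      + (br (part gr 0 V) (part gr 1 Z) + br (part gr 1 V) (part gr 0 Z))" .
  have "br (part gr 0 V) (part gr 0 Z) + br (part gr 1 V) (part gr 1 Z) \<in> gr 0"
    "br (part gr 0 V) (part gr 1 Z) + br (part gr 1 V) (part gr 0 Z) \<in> gr 1"
    by (intro subspace_add subspace_gr br00 br11 br10 part_mem)+
  from part_homogeneous[OF this(1)] part_homogeneous[OF this(2)]
  show "part gr 0 (br V Z) = br (part gr 0 V) (part gr 0 Z) + br (part gr 1 V) (part gr 1 Z)"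
    "part gr 1 (br V Z) = br (part gr 0 V) (part gr 1 Z) + br (part gr 1 V) (part gr 0 Z)"
    unfolding eq linear_add[OF linear_part] by simp_all
qed

text \<open>The four absorption conditions say that the sum of \<open>S\<close> and \<open>N\<close>
  is a graded ideal, to which simplicity applies.\<close>

lemma graded_ideal_trivial:
  assumes S: "subspace S" "S \<subseteq> gr 0" and N: "subspace N" "N \<subseteq> gr 1"
    and "\<And>V X. V \<in> gr 0 \<Longrightarrow> X \<in> S \<Longrightarrow> br V X \<in> S"
    and "\<And>V X. V \<in> gr 1 \<Longrightarrow> X \<in> S \<Longrightarrow> br V X \<in> N"
    and "\<And>V X. V \<in> gr 0 \<Longrightarrow> X \<in> N \<Longrightarrow> br V X \<in> N"
    and "\<And>V X. V \<in> gr 1 \<Longrightarrow> X \<in> N \<Longrightarrow> br V X \<in> S"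
  shows "S = {0} \<and> N = {0} \<or> S = gr 0 \<and> N = gr 1"
proof -
  define I where "I = {Z. part gr 0 Z \<in> S \<and> part gr 1 Z \<in> N}"
  have I0: "X \<in> I \<longleftrightarrow> X \<in> S" if "X \<in> gr 0" for X
    using part_homogeneous[OF that] subspace_0[OF N(1)] by (simp add: I_def)
  have I1: "X \<in> I \<longleftrightarrow> X \<in> N" if "X \<in> gr 1" for X
    using part_homogeneous[OF that] subspace_0[OF S(1)] by (simp add: I_def)
  have sub: "subspace I"
    unfolding subspace_def I_def
    using S(1) N(1) 
    by (simp add: linear_0[OF linear_part] linear_add[OF linear_part] linear_cmul[OF linear_part]
        subspace_0 subspace_add subspace_scale)
  have "graded_subspace gr I"
    unfolding graded_subspace_def
  proof (intro conjI sub ballI allI)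
    fix X p assume "X \<in> I"
    then show "part gr p X \<in> I"
      using I0[OF part_mem] I1[OF part_mem] by (cases p) (auto simp: I_def)
  qed
  moreover have "lie_ideal br UNIV I"
    unfolding lie_ideal_def
  proof (intro conjI sub ballI subset_UNIV)
    fix V Z assume "Z \<in> I"
    then show "br V Z \<in> I"
      using assms(5-8) part_mem by (simp add: I_def part_br S(1) N(1) subspace_add)
  qed
  ultimately have "I = {0} \<or> I = UNIV"
    using simple by (simp add: simple_superalgebra_def)
  then show ?thesis
  proof
    assume "I = {0}"
    then have "S \<subseteq> {0}" "N \<subseteq> {0}" using I0 I1 S(2) N(2) by auto
    then show ?thesis using subspace_0[OF S(1)] subspace_0[OF N(1)] by auto
  next
    assume "I = UNIV"
    then show ?thesis using I0 I1 S(2) N(2) by auto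
  qed
qed

text \<open>The kernel of the action on \<open>gr 1\<close>, with zero odd part, is a graded ideal;
  it cannot be everything because \<open>gr 1\<close> is nonzero.\<close>

lemma odd_action_faithful:
  assumes "V \<in> gr 0" "\<And>X. X \<in> gr 1 \<Longrightarrow> br V X = 0"
  shows "V = 0"
proof -
  define S where "S = {V \<in> gr 0. \<forall>X\<in>gr 1. br V X = 0}"
  have "S = {0} \<and> {0} = {0::'a} \<or> S = gr 0 \<and> {0} = gr 1"
  proof (rule graded_ideal_trivial)
    show "subspace S"
      unfolding S_def subspace_def
      using subspace_gr[of 0] by (auto simp: br_linear subspace_def)
    show "br V X \<in> S" if "V \<in> gr 0" "X \<in> S" for V X
      using that by (auto simp: S_def br00 jacobi_even br_linear)
    show "br V X \<in> {0}" if "V \<in> gr 1" "X \<in> S" for V X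
      using that br_swap(1)[of X V 1] by (auto simp: S_def)
  qed (auto simp: S_def subspace_0 subspace_gr br_linear)
  then show ?thesis using assms odd_nonzero by (auto simp: S_def)
qed

text \<open>Together with all of \<open>gr 1\<close> such an \<open>S\<close> is a graded ideal, and
  it is not zero. Used to extend properties of odd brackets to \<open>gr 0\<close>.\<close>

lemma odd_brackets_generate:
  assumes S: "subspace S" "S \<subseteq> gr 0"
    and "\<And>V X. V \<in> gr 0 \<Longrightarrow> X \<in> S \<Longrightarrow> br V X \<in> S"
    and "\<And>X Y. X \<in> gr 1 \<Longrightarrow> Y \<in> gr 1 \<Longrightarrow> br X Y \<in> S"
  shows "S = gr 0"
proof -
  have "S = {0} \<and> gr 1 = {0} \<or> S = gr 0 \<and> gr 1 = gr 1"
    using assms by (intro graded_ideal_trivial) (auto simp: subspace_gr intro: br00 br10)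
  then show ?thesis using odd_nonzero by auto
qed

lemma odd_jacobi_cyclic:
  assumes "X \<in> gr 1" "Y \<in> gr 1" "Z \<in> gr 1"
  shows "br (br X Y) Z + br (br Y Z) X + br (br Z X) Y = 0"
  using jacobi_odd[OF assms(1,2), of Z] br_swap(1)[OF br11[OF assms(2,3)] assms(1)]
    br_swap(1)[OF br11[OF assms(3,1)] assms(2)] br_swap(2)[OF assms(1,3)] by simp

text \<open>On \<open>gr 1\<close> the form \<open>K\<close> is alternating, so the last condition
  is self-adjointness for a symplectic form. Away from \<open>gr 1\<close> only linearity is asked
  of \<open>T\<close>.\<close>

definition intertwiner :: "('a \<Rightarrow> 'a) \<Rightarrow> bool" where
  "intertwiner T \<longleftrightarrow> linear T \<and> (\<forall>X\<in>gr 1. T X \<in> gr 1) \<and>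
     (\<forall>V\<in>gr 0. \<forall>X\<in>gr 1. T (br V X) = br V (T X)) \<and>
     (\<forall>X\<in>gr 1. \<forall>Y\<in>gr 1. K (T X) Y = K X (T Y))"

section \<open>Symmetric intertwiners and odd brackets\<close>

context
  fixes T :: "'a \<Rightarrow> 'a"
  assumes T: "intertwiner T"
begin

lemma linear_intertwiner: "linear T"
  and intertwiner_mem: "X \<in> gr 1 \<Longrightarrow> T X \<in> gr 1"
  and intertwiner_equivariant: "V \<in> gr 0 \<Longrightarrow> X \<in> gr 1 \<Longrightarrow> T (br V X) = br V (T X)"
  and intertwiner_symmetric: "X \<in> gr 1 \<Longrightarrow> Y \<in> gr 1 \<Longrightarrow> K (T X) Y = K X (T Y)"
  using T by (simp_all add: intertwiner_def)

text \<open>Pairing with an even \<open>W\<close> and using invariance lets \<open>T\<close> pass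
  from \<open>X\<close> to \<open>Y\<close>; nondegeneracy on \<open>gr 0\<close> then removes
  \<open>W\<close>.\<close>

lemma intertwiner_br:
  assumes X: "X \<in> gr 1" and Y: "Y \<in> gr 1"
  shows "br (T X) Y = br X (T Y)"
proof -
  note TX = intertwiner_mem[OF X] and TY = intertwiner_mem[OF Y]
  have "K W (br (T X) Y - br X (T Y)) = 0" if W: "W \<in> gr 0" for W
  proof -
    have "K W (br (T X) Y) = K (T (br W X)) Y"
      using K_invariant[OF W TX Y] intertwiner_equivariant[OF W X] by simp
    also have "\<dots> = K (br W X) (T Y)"
      by (rule intertwiner_symmetric[OF br00[OF W X] Y])
    also have "\<dots> = K W (br X (T Y))"
      by (rule K_invariant[OF W X TY])
    finally show ?thesis by (simp add: K_linear)
  qed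
  moreover have "br (T X) Y - br X (T Y) \<in> gr 0"
    by (intro subspace_diff subspace_gr br11 X Y TX TY)
  ultimately have "br (T X) Y - br X (T Y) = 0"
    using nondeg_on_K[of 0] unfolding nondeg_on_def by blast
  then show ?thesis by simp
qed

text \<open>\<open>T\<close> is inserted into each slot of the cyclic Jacobi identity and also
  applied to the whole. Equivariance and \<open>intertwiner_br\<close> leave six unknown vectors,
  and these four linear relations suffice.\<close>

lemma intertwiner_triple:
  assumes X: "X \<in> gr 1" and Y: "Y \<in> gr 1" and Z: "Z \<in> gr 1"
  shows "T (br (br X Y) Z) = br (br (T X) Y) Z"
proof -
  note TX = intertwiner_mem[OF X] and TY = intertwiner_mem[OF Y] and TZ = intertwiner_mem[OF Z]
  define f where "f X Y Z = br (br X Y) Z" for X Y Z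
  have eqv: "f X Y (T Z) = T (f X Y Z)" if "X \<in> gr 1" "Y \<in> gr 1" "Z \<in> gr 1" for X Y Z
    using intertwiner_equivariant[OF br11[OF that(1,2)] that(3)] by (simp add: f_def)
  have mv: "f X (T Y) Z = f (T X) Y Z" if "X \<in> gr 1" "Y \<in> gr 1" for X Y Z
    using intertwiner_br[OF that] by (simp add: f_def)
  have J: "f X Y Z + f Y Z X + f Z X Y = 0" if "X \<in> gr 1" "Y \<in> gr 1" "Z \<in> gr 1" for X Y Z
    using odd_jacobi_cyclic[OF that] by (simp add: f_def)
  let ?e = "f (T X) Y Z" and ?a = "f (T Y) Z X" and ?b = "f (T Z) X Y"
  have 0: "T (f X Y Z) + T (f Y Z X) + T (f Z X Y) = 0"
    using J[OF X Y Z] by (metis linear_add[OF linear_intertwiner] linear_0[OF linear_intertwiner])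
  have 1: "?e + T (f Y Z X) + ?b = 0"
    using J[OF TX Y Z] eqv[OF Y Z X] mv[OF Z X] by simp
  have 2: "?e + ?a + T (f Z X Y) = 0"
    using J[OF X TY Z] eqv[OF Z X Y] mv[OF X Y] by simp
  have 3: "T (f X Y Z) + ?a + ?b = 0"
    using J[OF X Y TZ] eqv[OF X Y Z] mv[OF Y Z] by simp
  \<comment> \<open>Each \<open>T (f ...)\<close> occurs once and each of \<open>?e\<close>,
    \<open>?a\<close>, \<open>?b\<close> twice, so relation 0 leaves
    \<open>?e + ?a + ?b = 0\<close>, to be compared with relation 3.\<close>
  have "(?e + T (f Y Z X) + ?b) + (?e + ?a + T (f Z X Y)) + (T (f X Y Z) + ?a + ?b)
      = 2 *\<^sub>R (?e + ?a + ?b) + (T (f X Y Z) + T (f Y Z X) + T (f Z X Y))"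
    by (simp add: scaleR_2 algebra_simps)
  then have "?e + ?a + ?b = 0" unfolding 0 1 2 3 by simp
  then have "T (f X Y Z) = ?e"
    using 3 by (metis add.assoc add_right_cancel)
  then show ?thesis by (simp add: f_def)
qed

text \<open>The odd kernel \<open>N\<close> and the span of its brackets with \<open>gr 1\<close>
  form a graded ideal, the decisive inclusion being \<open>intertwiner_triple\<close>. A nonzero
  \<open>X\<close> in \<open>N\<close> makes this ideal the whole algebra.\<close>

lemma intertwiner_zero_or_injective:
  assumes X: "X \<in> gr 1" "X \<noteq> 0" "T X = 0" and Y: "Y \<in> gr 1"
  shows "T Y = 0"
proof -
  define N where "N = {X \<in> gr 1. T X = 0}"
  define G where "G = {br X Y | X Y. X \<in> N \<and> Y \<in> gr 1}"
  have G0: "G \<subseteq> gr 0" by (auto simp: G_def N_def intro: br11)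
  have ind: "P X" if "X \<in> span G" "subspace {X. P X}" "\<And>X. X \<in> G \<Longrightarrow> P X" for X P
    using that span_minimal[of G "{X. P X}"] by auto
  have lin: "subspace {X. X \<in> gr 0 \<and> L X \<in> U}" if "linear L" "subspace U" for L U
    using that subspace_gr[of 0] unfolding subspace_def
    by (simp add: linear_0 linear_add linear_cmul)
  have eqN: "br V X \<in> N" if "V \<in> gr 0" "X \<in> N" for V X
    using that by (simp add: N_def br00 intertwiner_equivariant br_linear)
  have subN: "subspace N"
    using subspace_gr[of 1] unfolding N_def subspace_def
    by (simp add: linear_0 linear_add linear_cmul linear_intertwiner)
  have "span G = {0} \<and> N = {0} \<or> span G = gr 0 \<and> N = gr 1"
  proof (rule graded_ideal_trivial)
    show "span G \<subseteq> gr 0" using G0 span_minimal subspace_gr by blast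
    show "br V X \<in> span G" if V: "V \<in> gr 0" and X: "X \<in> span G" for V X
    proof -
      have "X \<in> gr 0 \<and> br V X \<in> span G"
      proof (rule ind[OF X lin[OF linear_br subspace_span]])
        fix X assume "X \<in> G"
        then obtain A B where AB: "X = br A B" "A \<in> N" "B \<in> gr 1" by (auto simp: G_def)
        have "br V X = br (br V A) B + br A (br V B)"
          using jacobi_even[OF V, of A 1 B] AB by (simp add: N_def)
        moreover have "br (br V A) B \<in> G" "br A (br V B) \<in> G"
          unfolding G_def using eqN[OF V AB(2)] AB(2,3) br00[OF V AB(3)] by blast+
        ultimately show "X \<in> gr 0 \<and> br V X \<in> span G"
          using \<open>X \<in> G\<close> G0 by (auto intro: span_add span_base)
      qed
      then show ?thesis ..
    qed
    show "br V X \<in> N" if V: "V \<in> gr 1" and X: "X \<in> span G" for V X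
    proof -
      have "X \<in> gr 0 \<and> br V X \<in> N"
      proof (rule ind[OF X lin[OF linear_br subN]])
        fix X assume "X \<in> G"
        then obtain A B where AB: "X = br A B" "A \<in> gr 1" "T A = 0" "B \<in> gr 1" by (auto simp: G_def N_def)
        have "br V X = - br (br A B) V"
          using br_swap(1)[OF br11[OF AB(2,4)] V] AB(1) by simp
        moreover have "T (br (br A B) V) = 0"
          using intertwiner_triple[OF AB(2,4) V] AB(3) by (simp add: br_linear)
        ultimately have "T (br V X) = 0" 
          by (simp add: linear_neg[OF linear_intertwiner])
        then show "X \<in> gr 0 \<and> br V X \<in> N"
          using \<open>X \<in> G\<close> G0 br10[OF V, of X] by (auto simp: N_def)
      qed
      then show ?thesis ..
    qed
    show "br V X \<in> span G" if "V \<in> gr 1" "X \<in> N" for V X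
    proof -
      have "br V X = br X V" using that br_swap(2) by (simp add: N_def)
      then show ?thesis using that by (auto simp: G_def intro: span_base)
    qed
  qed (use eqN subN in \<open>auto simp: N_def\<close>)
  then show ?thesis using X Y by (auto simp: N_def)
qed

end

text \<open>The quadratic \<open>Q\<close> in \<open>T\<close> kills a nonzero vector and is itself
  an intertwiner, so it is zero on \<open>gr 1\<close>. Completing the square gives
  \<open>N = T - a\<close> with square \<open>- b\<^sup>2\<close>, and \<open>J\<close> is
  \<open>N / b\<close>.\<close>

lemma intertwiner_cases:
  assumes T: "intertwiner T"
  obtains (scalar) a where "\<And>X. X \<in> gr 1 \<Longrightarrow> T X = a *\<^sub>R X"
  | (complex) a b J where "intertwiner J" "b \<noteq> 0" "\<And>X. X \<in> gr 1 \<Longrightarrow> J (J X) = - X"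
      "\<And>X. X \<in> gr 1 \<Longrightarrow> T X = a *\<^sub>R X + b *\<^sub>R J X"
proof -
  note lin = linear_intertwiner[OF T] and mem = intertwiner_mem[OF T]
    and eqv = intertwiner_equivariant[OF T] and sym = intertwiner_symmetric[OF T]
  note T_linear = linear_add[OF lin] linear_diff[OF lin] linear_cmul[OF lin] linear_neg[OF lin]
  obtain a b u where u: "u \<in> gr 1" "u \<noteq> 0" "T (T u) - (2 * a) *\<^sub>R T u + (a\<^sup>2 + b\<^sup>2) *\<^sub>R u = 0"
    using ex_quadratic_eigenvector[OF subspace_gr odd_nonzero lin mem] by metis
  define Q where "Q X = T (T X) - (2 * a) *\<^sub>R T X + (a\<^sup>2 + b\<^sup>2) *\<^sub>R X" for X
  have "intertwiner Q"
    unfolding intertwiner_def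
  proof (intro conjI ballI)
    show "linear Q" 
      by (rule linearI) (simp_all add: Q_def T_linear algebra_simps)
    show "Q X \<in> gr 1" if "X \<in> gr 1" for X
      unfolding Q_def
      by (intro subspace_add subspace_diff subspace_scale subspace_gr mem that)
    show "Q (br V X) = br V (Q X)" if "V \<in> gr 0" "X \<in> gr 1" for V X
      using that mem by (simp add: Q_def eqv br_linear)
    show "K (Q X) Y = K X (Q Y)" if "X \<in> gr 1" "Y \<in> gr 1" for X Y
      using that mem by (simp add: Q_def sym K_linear)
  qed
  then have Q: "Q X = 0" if "X \<in> gr 1" for X
    using intertwiner_zero_or_injective[of Q u X] u that by (simp add: Q_def)
  define N where "N X = T X - a *\<^sub>R X" for X
  have N: "intertwiner N"
    unfolding intertwiner_def
  proof (intro conjI ballI)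
    show "linear N" 
      by (rule linearI) (simp_all add: N_def T_linear algebra_simps)
    show "N X \<in> gr 1" if "X \<in> gr 1" for X
      unfolding N_def
      by (intro subspace_diff subspace_scale subspace_gr mem that)
    show "N (br V X) = br V (N X)" if "V \<in> gr 0" "X \<in> gr 1" for V X
      using that mem by (simp add: N_def eqv br_linear)
    show "K (N X) Y = K X (N Y)" if "X \<in> gr 1" "Y \<in> gr 1" for X Y
      using that mem by (simp add: N_def sym K_linear)
  qed
  have NN: "N (N X) = - (b\<^sup>2 *\<^sub>R X)" if "X \<in> gr 1" for X
  proof -
    have "N (N X) + b\<^sup>2 *\<^sub>R X = Q X"
      by (simp add: N_def Q_def T_linear algebra_simps power2_eq_square flip: scaleR_add_left)
    then show ?thesis using Q[OF that] by (simp add: eq_neg_iff_add_eq_0)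
  qed
  show thesis
  proof (cases "b = 0")
    case True
    \<comment> \<open>If \<open>N X\<close> were nonzero it would lie in the kernel of
      \<open>N\<close>, which would force \<open>N\<close> to vanish on \<open>gr 1\<close>.\<close>
    have "N X = 0" if X: "X \<in> gr 1" for X
      using intertwiner_zero_or_injective[OF N intertwiner_mem[OF N X] _ _ X] NN[OF X] True by force
    then show thesis using scalar[of a] by (simp add: N_def)
  next
    case False
    define J where "J X = (1 / b) *\<^sub>R N X" for X
    note N_linear = linear_add[OF linear_intertwiner[OF N]] linear_cmul[OF linear_intertwiner[OF N]]
    have "intertwiner J"
      unfolding intertwiner_def
    proof (intro conjI ballI)
      show "linear J" 
        by (rule linearI) (simp_all add: J_def N_linear algebra_simps)
    qed (use N in \<open>auto simp: J_def intertwiner_def br_linear K_linear subspace_scale subspace_gr\<close>)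
    moreover have "J (J X) = - X" if "X \<in> gr 1" for X
      using NN[OF that] False by (simp add: J_def N_linear power2_eq_square)
    moreover have "T X = a *\<^sub>R X + b *\<^sub>R J X" for X
      using False by (simp add: J_def N_def)
    ultimately show thesis using complex[of J b a] False by blast
  qed
qed

text \<open>Even elements that admit a partner \<open>U\<close> acting as \<open>J\<close> after
  \<open>br V\<close> form an ideal of \<open>gr 0\<close> containing all odd brackets, hence all of
  \<open>gr 0\<close>. Faithfulness makes the partner unique, and uniqueness makes \<open>J0\<close>
  linear.\<close>

lemma intertwiner_extension:
  assumes J: "intertwiner J"
  obtains J0 where "linear J0" "\<forall>V\<in>gr 0. J0 V \<in> gr 0 \<and> (\<forall>X\<in>gr 1. br (J0 V) X = J (br V X))"
proof -
  note J_linear = linear_add[OF linear_intertwiner[OF J]] linear_diff[OF linear_intertwiner[OF J]]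
    linear_cmul[OF linear_intertwiner[OF J]] linear_0[OF linear_intertwiner[OF J]]
  define W where "W V U \<longleftrightarrow> U \<in> gr 0 \<and> (\<forall>X\<in>gr 1. br U X = J (br V X))" for V U
  define S where "S = {V \<in> gr 0. \<exists>U. W V U}"
  have W0: "W 0 0" and Wadd: "W V U \<Longrightarrow> W V' U' \<Longrightarrow> W (V + V') (U + U')" 
    and Wscale: "W V U \<Longrightarrow> W (c *\<^sub>R V) (c *\<^sub>R U)" for V U V' U' c
    by (auto simp: W_def br_linear J_linear subspace_0 subspace_add subspace_scale subspace_gr)
  have "S = gr 0"
  proof (rule odd_brackets_generate)
    show "subspace S"
      unfolding subspace_def S_def using W0 Wadd Wscale subspace_gr[of 0]
      by (auto simp: subspace_def) blast+
    show "br V X \<in> S" if V: "V \<in> gr 0" and X: "X \<in> S" for V X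
    proof -
      obtain U where U: "X \<in> gr 0" "W X U" using X by (auto simp: S_def)
      then have U': "U \<in> gr 0" "\<And>Z. Z \<in> gr 1 \<Longrightarrow> br U Z = J (br X Z)" by (auto simp: W_def)
      have "br (br V U) Z = J (br (br V X) Z)" if Z: "Z \<in> gr 1" for Z
        using Z V U U' intertwiner_equivariant[OF J V br00[OF U(1) Z]]
        by (simp add: jacobi_even[of V U 0] jacobi_even[of V X 0] br00 J_linear)
      then have "W (br V X) (br V U)" 
        using br00[OF V U'(1)] by (simp add: W_def)
      then show ?thesis using br00[OF V U(1)] by (auto simp: S_def)
    qed
    show "br X Y \<in> S" if "X \<in> gr 1" "Y \<in> gr 1" for X Y
    proof -
      \<comment> \<open>The triple identity is what supplies a partner for an odd bracket.\<close>
      have "W (br X Y) (br (J X) Y)"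
        unfolding W_def using that intertwiner_triple[OF J] br11[OF intertwiner_mem[OF J]] by simp
      then show ?thesis using br11[OF that] by (auto simp: S_def)
    qed
  qed (auto simp: S_def)
  then have ex: "\<exists>U. W V U" if "V \<in> gr 0" for V using that by (auto simp: S_def)
  have uniq: "U = U'" if "W V U" "W V U'" for V U U'
  proof -
    have "br (U - U') X = 0" if "X \<in> gr 1" for X
      using that \<open>W V U\<close> \<open>W V U'\<close> by (simp add: W_def br_linear)
    moreover have "U - U' \<in> gr 0"
      using that by (simp add: W_def subspace_diff subspace_gr)
    ultimately show ?thesis using odd_action_faithful[of "U - U'"] by simp
  qed
  \<comment> \<open>Passing through the even part defines \<open>J0\<close> on the whole type, where
    linearity is required.\<close>
  define J0 where "J0 V = (SOME U. W (part gr 0 V) U)" for V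
  have J0: "W (part gr 0 V) (J0 V)" for V
    unfolding J0_def using ex[OF part_mem] by (rule someI_ex)
  have "linear J0"
  proof (rule linearI)
    show "J0 (x + y) = J0 x + J0 y" for x y
      using uniq[OF J0 Wadd[OF J0 J0, folded linear_add[OF linear_part]]] .
    show "J0 (c *\<^sub>R x) = c *\<^sub>R J0 x" for c x
      using uniq[OF J0 Wscale[OF J0, folded linear_cmul[OF linear_part]]] .
  qed
  moreover have "W V (J0 V)" if "V \<in> gr 0" for V
    using J0[of V] part_homogeneous[OF that, of 0] by simp
  ultimately show thesis using that by (simp add: W_def)
qed

text \<open>By faithfulness it suffices to compare actions on \<open>gr 1\<close>. Both sides act as
  \<open>J\<close> after \<open>br (br V U)\<close>, since \<open>J\<close> commutes with even
  elements.\<close>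

lemma extension_br:
  assumes J: "intertwiner J" and J0: "\<And>V. V \<in> gr 0 \<Longrightarrow> J0 V \<in> gr 0"
    "\<And>V X. V \<in> gr 0 \<Longrightarrow> X \<in> gr 1 \<Longrightarrow> br (J0 V) X = J (br V X)"
    and V: "V \<in> gr 0" and U: "U \<in> gr 0"
  shows "J0 (br V U) = br (J0 V) U"
proof -
  have "br (J0 (br V U) - br (J0 V) U) X = 0" if X: "X \<in> gr 1" for X
  proof -
    have "br (br (J0 V) U) X = J (br V (br U X)) - br U (J (br V X))"
      using jacobi_even[OF J0(1)[OF V] U, of X] J0(2)[OF V X] J0(2)[OF V br00[OF U X]] by simp
    also have "br U (J (br V X)) = J (br U (br V X))"
      using intertwiner_equivariant[OF J U br00[OF V X]] by simp
    also have "J (br V (br U X)) - J (br U (br V X)) = J (br (br V U) X)"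
      using jacobi_even[OF V U, of X] linear_diff[OF linear_intertwiner[OF J]] by simp
    finally show ?thesis
      using J0(2)[OF br00[OF V U] X] by (simp add: br_linear)
  qed
  moreover have "J0 (br V U) - br (J0 V) U \<in> gr 0"
    by (intro subspace_diff subspace_gr J0(1) br00 V U)
  ultimately have "J0 (br V U) - br (J0 V) U = 0" by (rule odd_action_faithful[rotated])
  then show ?thesis by simp
qed

lemma extension_square:
  assumes J: "intertwiner J" "\<And>X. X \<in> gr 1 \<Longrightarrow> J (J X) = - X" and J0: "\<And>V. V \<in> gr 0 \<Longrightarrow> J0 V \<in> gr 0"
    "\<And>V X. V \<in> gr 0 \<Longrightarrow> X \<in> gr 1 \<Longrightarrow> br (J0 V) X = J (br V X)"
    and V: "V \<in> gr 0"
  shows "J0 (J0 V) = - V"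
proof -
  have "br (J0 (J0 V) + V) X = 0" if X: "X \<in> gr 1" for X
    using J0(2)[OF J0(1)[OF V] X] J0(2)[OF V X] J(2)[OF br00[OF V X]] by (simp add: br_linear)
  moreover have "J0 (J0 V) + V \<in> gr 0"
    by (intro subspace_add subspace_gr J0(1) V)
  ultimately have "J0 (J0 V) + V = 0" by (rule odd_action_faithful[rotated])
  then show ?thesis by (simp add: eq_neg_iff_add_eq_0)
qed

end

section \<open>The Casimir operator of an ideal acting on the odd part\<close>

text \<open>\<open>L\<close> stands for one of the ideals \<open>k i\<close>, \<open>P\<close> for
  the orthogonal projection onto it. The condition \<open>centroid\<close> ensures that the complex
  structure \<open>J0\<close> of the even part restricts to \<open>L\<close>.\<close>

locale casimir_ideal = simple_killing +
  fixes L :: "'a set" and P :: "'a \<Rightarrow> 'a" and m :: real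
  assumes L_subspace: "subspace L" and L_even: "L \<subseteq> gr 0"
    and L_ideal: "V \<in> gr 0 \<Longrightarrow> X \<in> L \<Longrightarrow> br V X \<in> L"
    and L_nondeg: "nondeg_on L K"
    and linear_P: "linear P"
    and P_mem: "V \<in> gr 0 \<Longrightarrow> P V \<in> L"
    and P_id: "V \<in> L \<Longrightarrow> P V = V"
    and P_symmetric: "V \<in> gr 0 \<Longrightarrow> W \<in> gr 0 \<Longrightarrow> K (P V) W = K V (P W)"
    and odd_trace_form: "V \<in> L \<Longrightarrow> W \<in> L \<Longrightarrow> trace_form br (gr 1) V W = m * K V W"
    and centroid: "linear J0 \<Longrightarrow> (\<And>V. V \<in> gr 0 \<Longrightarrow> J0 V \<in> gr 0) \<Longrightarrow>
       (\<And>V U. V \<in> gr 0 \<Longrightarrow> U \<in> gr 0 \<Longrightarrow> J0 (br V U) = br (J0 V) U) \<Longrightarrow> V \<in> L \<Longrightarrow> J0 V \<in> L"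
begin

text \<open>The left-hand side is \<open>K X (C Y)\<close> for the Casimir operator \<open>C\<close>
  of \<open>L\<close>. Its trace on \<open>gr 1\<close> is \<open>m * dim L\<close>, which
  determines the scalar.\<close>

lemma even_trace_scalar:
  assumes X: "X \<in> gr 1" and Y: "Y \<in> gr 1"
  shows "even_trace P X Y = m * dim L / dim (gr 1) * K X Y"
proof -
  obtain B d where B: "dual_frame L K B d"
    by (rule ex_dual_frame[OF L_subspace bilinear_K L_nondeg])
  then have fin: "finite B" and mem: "\<And>b. b \<in> B \<Longrightarrow> b \<in> L" "\<And>b. b \<in> B \<Longrightarrow> d b \<in> L"
    and exp1: "\<And>v. v \<in> L \<Longrightarrow> v = (\<Sum>b\<in>B. K v (d b) *\<^sub>R b)"
    and exp2: "\<And>v. v \<in> L \<Longrightarrow> v = (\<Sum>b\<in>B. K b v *\<^sub>R d b)"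
    by (auto simp: dual_frame_def)
  have mem0: "b \<in> gr 0" "d b \<in> gr 0" if "b \<in> B" for b
    using mem that L_even by auto
  note tr1 = trace_on_dual_frame[OF L_subspace bilinear_K B]
  note tr2 = trace_on_dual_frame'[OF L_subspace bilinear_K B]
  \<comment> \<open>The Casimir operator, written in a frame of \<open>L\<close> and its
    \<open>K\<close>-dual.\<close>
  define C where "C X = (\<Sum>b\<in>B. br (d b) (br b X))" for X
  have P0: "P V \<in> gr 0" if "V \<in> gr 0" for V
    using P_mem[OF that] L_even by blast
  have C_mem: "C X \<in> gr 1" if "X \<in> gr 1" for X
    unfolding C_def by (intro subspace_sum subspace_gr br00 mem0 that)
  have linC: "linear C"
    unfolding C_def by (intro linear_compose_sum ballI linear_br2)
  have even_trace: "even_trace P X Y = K X (C Y)" if X: "X \<in> gr 1" and Y: "Y \<in> gr 1" for X Y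
  proof -
    have mXY: "br X (br Y Z) \<in> gr 0" if "Z \<in> gr 0" for Z
      by (intro br11 br10 X Y that)
    have linT: "linear (\<lambda>Z. P (br X (br Y Z)))"
      using linear_compose[OF linear_br2 linear_P] by (simp add: o_def)
    have "even_trace P X Y = trace_on L (\<lambda>Z. P (br X (br Y Z)))"
      unfolding even_trace_def
      using trace_on_commute[OF subspace_gr L_subspace linear_ident linT, of 0] P_mem mXY L_even by blast
    also have "\<dots> = (\<Sum>b\<in>B. K (P (br X (br Y b))) (d b))"
      using L_even by (intro tr1 linT P_mem mXY) auto
    also have "\<dots> = (\<Sum>b\<in>B. K X (br (d b) (br b Y)))"
    proof (rule sum.cong[OF refl])
      fix b assume b: "b \<in> B"
      have "K (P (br X (br Y b))) (d b) = K (br X (br Y b)) (d b)"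
        using P_symmetric[OF mXY[OF mem0(1)[OF b]] mem0(2)[OF b]] P_id[OF mem(2)[OF b]] by simp
      also have "\<dots> = K X (br (br Y b) (d b))"
        by (rule K_invariant[OF X br10[OF Y mem0(1)[OF b]] mem0(2)[OF b]])
      also have "br (br Y b) (d b) = br (d b) (br b Y)"
        using br_swap(1)[OF mem0(2)[OF b] br10[OF Y mem0(1)[OF b]]] br_swap(1)[OF mem0(1)[OF b] Y]
        by (simp add: br_linear)
      finally show "K (P (br X (br Y b))) (d b) = K X (br (d b) (br b Y))" .
    qed
    finally show ?thesis by (simp add: C_def K_sum)
  qed
  \<comment> \<open>\<open>even_trace P\<close> and \<open>K\<close> both change sign when two odd
    arguments are exchanged; the signs cancel.\<close>
  have C_sym: "K (C X) Y = K X (C Y)" if X: "X \<in> gr 1" and Y: "Y \<in> gr 1" for X Y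
    using even_trace_skew[OF linear_P P0 P_symmetric X Y] even_trace[OF X Y] even_trace[OF Y X]
      K_supersymmetric[OF C_mem[OF X] Y] by (simp add: sgn2_def)
  \<comment> \<open>The usual argument: invariance of \<open>K\<close> makes the matrices of
    \<open>br V\<close> on the frame and on the dual frame negative transposes of each
    other.\<close>
  have C_eqv: "C (br V X) = br V (C X)" if V: "V \<in> gr 0" and X: "X \<in> gr 1" for V X
  proof -
    have leib: "br V (br (d b) (br b X))
      = br (d b) (br b (br V X)) + (br (br V (d b)) (br b X) + br (d b) (br (br V b) X))" if b: "b \<in> B" for b
      using jacobi_even[OF V mem0(2)[OF b], of "br b X"] jacobi_even[OF V mem0(1)[OF b], of X]
      by (simp add: br_linear)
    have "(\<Sum>b\<in>B. br (br V (d b)) (br b X)) = (\<Sum>b\<in>B. \<Sum>c\<in>B. - (K (br V c) (d b) *\<^sub>R br (d c) (br b X)))"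
    proof (rule sum.cong[OF refl])
      fix b assume b: "b \<in> B"
      have "br V (d b) = (\<Sum>c\<in>B. K c (br V (d b)) *\<^sub>R d c)"
        by (rule exp2[OF L_ideal[OF V mem(2)[OF b]]])
      also have "\<dots> = (\<Sum>c\<in>B. - (K (br V c) (d b) *\<^sub>R d c))"
        using K_skew[OF V mem0(1) mem0(2)[OF b]] by (intro sum.cong) (auto simp: sgn2_def)
      finally have "br (br V (d b)) (br b X) = br (\<Sum>c\<in>B. - (K (br V c) (d b) *\<^sub>R d c)) (br b X)"
        by (rule arg_cong[where f = "\<lambda>W. br W (br b X)"])
      then show "br (br V (d b)) (br b X) = (\<Sum>c\<in>B. - (K (br V c) (d b) *\<^sub>R br (d c) (br b X)))"
        by (simp only: br_sum br_linear)
    qed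
    moreover have "(\<Sum>b\<in>B. br (d b) (br (br V b) X)) = (\<Sum>b\<in>B. \<Sum>c\<in>B. K (br V b) (d c) *\<^sub>R br (d b) (br c X))"
    proof (rule sum.cong[OF refl])
      fix b assume b: "b \<in> B"
      have "br V b = (\<Sum>c\<in>B. K (br V b) (d c) *\<^sub>R c)"
        by (rule exp1[OF L_ideal[OF V mem(1)[OF b]]])
      then have "br (d b) (br (br V b) X) = br (d b) (br (\<Sum>c\<in>B. K (br V b) (d c) *\<^sub>R c) X)"
        by (rule arg_cong[where f = "\<lambda>W. br (d b) (br W X)"])
      then show "br (d b) (br (br V b) X) = (\<Sum>c\<in>B. K (br V b) (d c) *\<^sub>R br (d b) (br c X))"
        by (simp only: br_sum br_linear)
    qed
    \<comment> \<open>After the summation indices of one double sum are exchanged, the two are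
      opposite.\<close>
    ultimately have "(\<Sum>b\<in>B. br (br V (d b)) (br b X) + br (d b) (br (br V b) X)) = 0"
      using sum.swap[of "\<lambda>b c. K (br V c) (d b) *\<^sub>R br (d c) (br b X)" B B]
      by (simp add: sum.distrib sum_negf)
    then show ?thesis
      by (simp add: C_def br_sum leib sum.distrib)
  qed
  have C: "intertwiner C"
    using linC C_mem C_eqv C_sym by (simp add: intertwiner_def)
  have dim1: "real (dim (gr 1)) > 0" using dim_pos[OF subspace_gr odd_nonzero] by simp
  have K_sym: "K v w = K w v" if "v \<in> L" "w \<in> L" for v w
    using K_supersymmetric[of v 0 w 0] that L_even by (auto simp: sgn2_def)
  have br2_mem: "br V (br W X) \<in> gr 1" if "V \<in> gr 0" "W \<in> gr 0" "X \<in> gr 1" for V W X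
    by (intro br00 that)
  from C show ?thesis
  proof (cases rule: intertwiner_cases)
    case (scalar a)
    have "trace_on (gr 1) C = trace_on (gr 1) (\<lambda>X. a *\<^sub>R X)"
      using scalar by (intro trace_on_cong) (auto simp: subspace_gr subspace_scale)
    also have "\<dots> = a * dim (gr 1)"
      by (simp add: trace_on_scale trace_on_id subspace_gr)
    finally have "a * dim (gr 1) = trace_on (gr 1) C" ..
    also have "\<dots> = (\<Sum>b\<in>B. trace_form br (gr 1) (d b) b)"
      unfolding C_def trace_form_def o_def by (intro trace_on_sum subspace_gr br2_mem mem0)
    also have "\<dots> = m * (\<Sum>b\<in>B. K b (d b))"
      using odd_trace_form mem K_sym by (simp add: sum_distrib_left)
    \<comment> \<open>This sum is the trace of the identity of \<open>L\<close> in the dual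
      frame.\<close>
    also have "(\<Sum>b\<in>B. K b (d b)) = dim L"
      using tr1[OF linear_ident] trace_on_id[OF L_subspace] by simp
    finally have "a = m * dim L / dim (gr 1)" using dim1 by (simp add: field_simps)
    then show ?thesis
      using even_trace[OF X Y] scalar[OF Y] by (simp add: K_linear)
  next
    \<comment> \<open>here \<open>L\<close> would be a complex Lie algebra, and the trace of \<open>J C\<close> vanishes since the trace of \<open>J0\<close> does\<close>
    case (complex a b J)
    obtain J0 where J0': "linear J0" "\<forall>V\<in>gr 0. J0 V \<in> gr 0 \<and> (\<forall>X\<in>gr 1. br (J0 V) X = J (br V X))"
      by (rule intertwiner_extension[OF complex(1)])
    then have J0: "linear J0" "\<And>V. V \<in> gr 0 \<Longrightarrow> J0 V \<in> gr 0"
      "\<And>V X. V \<in> gr 0 \<Longrightarrow> X \<in> gr 1 \<Longrightarrow> br (J0 V) X = J (br V X)"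
      by blast+
    have J0L: "J0 V \<in> L" if "V \<in> L" for V
      using centroid[OF J0(1,2) extension_br[OF complex(1) J0(2,3)] that] by blast
    have "J0 (J0 V) = - V" if "V \<in> L" for V
      using extension_square[OF complex(1,3) J0(2,3), of V] that L_even by blast
    with J0L have trJ0: "trace_on L J0 = 0"
      by (intro trace_on_complex_structure L_subspace J0(1))
    note J = linear_intertwiner[OF complex(1)] intertwiner_mem[OF complex(1)]
    \<comment> \<open>Composing \<open>C = a + b J\<close> with \<open>J\<close> moves
      \<open>b\<close> into the scalar part, where the trace detects it.\<close>
    have "trace_on (gr 1) (\<lambda>X. J (C X)) = trace_on (gr 1) (\<lambda>X. a *\<^sub>R J X + (- b) *\<^sub>R X)"
      using complex(3,4) J(2)
      by (intro trace_on_cong subspace_gr subspace_add subspace_scale)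
        (simp_all add: linear_add[OF J(1)] linear_cmul[OF J(1)])
    also have "\<dots> = a * trace_on (gr 1) J - b * dim (gr 1)"
      using J(2) by (simp add: trace_on_add[OF subspace_gr] trace_on_diff[OF subspace_gr] trace_on_scale[OF subspace_gr] trace_on_id[OF subspace_gr] subspace_scale subspace_gr)
    also have "trace_on (gr 1) J = 0"
      by (rule trace_on_complex_structure[OF subspace_gr J complex(3)])
    finally have "- b * dim (gr 1) = trace_on (gr 1) (\<lambda>X. J (C X))" by simp
    also have "\<dots> = trace_on (gr 1) (\<lambda>X. \<Sum>b\<in>B. br (J0 (d b)) (br b X))"
      using J0(3)[OF mem0(2) br00[OF mem0(1)]] 
      by (intro trace_on_cong subspace_gr subspace_sum br2_mem mem0 J0(2)) (auto simp: C_def linear_sum[OF J(1)])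
    also have "\<dots> = (\<Sum>b\<in>B. trace_form br (gr 1) (J0 (d b)) b)"
      unfolding trace_form_def o_def by (intro trace_on_sum subspace_gr br2_mem mem0 J0(2))
    also have "\<dots> = m * (\<Sum>b\<in>B. K b (J0 (d b)))"
      using odd_trace_form mem K_sym J0L by (simp add: sum_distrib_left)
    \<comment> \<open>The sum is the trace of \<open>J0\<close> on \<open>L\<close>, evaluated on
      the dual vectors.\<close>
    also have "(\<Sum>b\<in>B. K b (J0 (d b))) = 0"
      using tr2[OF J0(1) J0L] trJ0 by simp
    finally show ?thesis using complex(2) dim1 by simp
  qed
qed

end

section \<open>Decomposition of the even part\<close>

locale decomposed_superalgebra = simple_killing +
  fixes k :: "nat \<Rightarrow> 'a set" and s :: nat and l :: "nat \<Rightarrow> real"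
  assumes decomp: "direct_sum {0..s} k (gr 0)"
    and k_ideal: "i \<in> {0..s} \<Longrightarrow> lie_ideal br (gr 0) (k i)"
    and k0_abelian: "abelian_lie br (k 0)"
    and k_simple: "i \<in> {1..s} \<Longrightarrow> simple_lie br (k i)"
    and index: "i \<in> {1..s} \<Longrightarrow> is_index br (k i) (gr 1) (l i)"
begin

definition proj :: "nat \<Rightarrow> 'a \<Rightarrow> 'a" where
  "proj i X = component {0..s} k i (part gr 0 X)"

lemma k_subspace: "i \<in> {0..s} \<Longrightarrow> subspace (k i)"
  using direct_sum_subspace[OF decomp] .

lemma k_even: "i \<in> {0..s} \<Longrightarrow> X \<in> k i \<Longrightarrow> X \<in> gr 0"
  using direct_sum_mem[OF decomp] .

lemma k_br: "i \<in> {0..s} \<Longrightarrow> V \<in> gr 0 \<Longrightarrow> X \<in> k i \<Longrightarrow> br V X \<in> k i"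
  using k_ideal by (auto simp: lie_ideal_def)

lemma k_br_left:
  assumes "i \<in> {0..s}" "V \<in> gr 0" "X \<in> k i"
  shows "br X V \<in> k i"
  using k_br[OF assms] br_swap(1)[OF assms(2) k_even[OF assms(1,3)]] subspace_neg[OF k_subspace[OF assms(1)]]
  by simp

lemma linear_proj: "i \<in> {0..s} \<Longrightarrow> linear (proj i)"
  by (rule linearI)
    (simp_all add: proj_def linear_add[OF linear_part] linear_cmul[OF linear_part] 
      component_add[OF decomp] component_scale[OF decomp] part_mem)

lemma proj_mem: "i \<in> {0..s} \<Longrightarrow> proj i X \<in> k i"
  unfolding proj_def by (rule component_mem[OF decomp part_mem])

lemma proj_even: "i \<in> {0..s} \<Longrightarrow> proj i X \<in> gr 0"
  using proj_mem k_even by blast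

lemma proj_sum: "X \<in> gr 0 \<Longrightarrow> (\<Sum>i\<in>{0..s}. proj i X) = X"
  using sum_component[OF decomp] part_homogeneous[of X 0 0] by (simp add: proj_def)

lemma proj_k: "i \<in> {0..s} \<Longrightarrow> j \<in> {0..s} \<Longrightarrow> X \<in> k i \<Longrightarrow> proj j X = (if j = i then X else 0)"
  using component_summand[OF decomp] part_homogeneous[OF k_even, of i X 0] by (simp add: proj_def)

lemma proj_odd: "i \<in> {0..s} \<Longrightarrow> X \<in> gr 1 \<Longrightarrow> proj i X = 0"
  using part_homogeneous[of X 1 0] linear_0[OF linear_proj] part_homogeneous[OF subspace_0[OF subspace_gr], of 0 0]
  by (simp add: proj_def)

lemma proj_unique:
  assumes "\<And>i. i \<in> {0..s} \<Longrightarrow> f i \<in> k i" "j \<in> {0..s}"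
  shows "proj j (\<Sum>i\<in>{0..s}. f i) = f j"
proof -
  have "(\<Sum>i\<in>{0..s}. f i) \<in> gr 0"
    using assms(1) by (intro subspace_sum subspace_gr) (auto intro: k_even)
  then show ?thesis
    using component_sum[OF decomp assms] part_homogeneous[of _ 0 0] by (simp add: proj_def)
qed

section \<open>Commutation, perfectness and orthogonality of the ideals\<close>

lemma k_commute:
  assumes i: "i \<in> {0..s}" and j: "j \<in> {0..s}" and "i \<noteq> j" and X: "X \<in> k i" and Y: "Y \<in> k j"
  shows "br X Y = 0"
proof -
  \<comment> \<open>The bracket lies in two different summands of a direct sum.\<close>
  have "br X Y \<in> k j" using k_br[OF j k_even[OF i X] Y] .
  moreover have "br X Y \<in> k i" using k_br_left[OF i k_even[OF j Y] X] .
  ultimately show ?thesis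
    using proj_k[OF j i, of "br X Y"] proj_k[OF i i, of "br X Y"] \<open>i \<noteq> j\<close> by simp
qed

lemma proj_br:
  assumes i: "i \<in> {0..s}" and X: "X \<in> gr 0" and Y: "Y \<in> gr 0"
  shows "proj i (br X Y) = br (proj i X) Y"
proof -
  have "br X Y = br (\<Sum>i\<in>{0..s}. proj i X) Y" using proj_sum[OF X] by simp
  also have "\<dots> = (\<Sum>i\<in>{0..s}. br (proj i X) Y)" by (simp only: br_sum)
  finally show ?thesis
    using proj_unique[of "\<lambda>i. br (proj i X) Y", OF k_br_left[OF _ Y proj_mem] i] by simp
qed

lemma k0_central:
  assumes Y: "Y \<in> k 0" and Z: "Z \<in> gr 0"
  shows "br Y Z = 0"
proof -
  have "br Y (proj j Z) = 0" if j: "j \<in> {0..s}" for j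
  proof (cases "j = 0")
    case True
    then show ?thesis
      using k0_abelian Y proj_mem[OF j] by (simp add: abelian_lie_def)
  next
    case False
    then show ?thesis using k_commute[OF _ j _ Y proj_mem[OF j]] by simp
  qed
  moreover have "br Y Z = (\<Sum>j\<in>{0..s}. br Y (proj j Z))"
    using proj_sum[OF Z] by (simp only: br_sum(1)[symmetric])
  ultimately show ?thesis by simp
qed

text \<open>The derived algebra is an ideal of \<open>k i\<close>, nonzero because a simple algebra
  is not abelian.\<close>

lemma k_perfect:
  assumes i: "i \<in> {1..s}"
  shows "span {br X Y | X Y. X \<in> k i \<and> Y \<in> k i} = k i"
proof -
  let ?G = "{br X Y | X Y. X \<in> k i \<and> Y \<in> k i}"
  have i0: "i \<in> {0..s}" using i by simp
  have sub: "?G \<subseteq> k i" using k_br[OF i0] k_even[OF i0] by blast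
  then have span: "span ?G \<subseteq> k i" using span_minimal k_subspace[OF i0] by blast
  then have "lie_ideal br (k i) (span ?G)"
    unfolding lie_ideal_def using span_base[of _ ?G] by (intro conjI subspace_span) blast+
  then have "span ?G = {0} \<or> span ?G = k i"
    using k_simple[OF i] by (simp add: simple_lie_def)
  moreover have "span ?G \<noteq> {0}"
  proof
    assume "span ?G = {0}"
    then have "X \<in> ?G \<Longrightarrow> X = 0" for X using span_base[of X ?G] by simp
    then have "abelian_lie br (k i)" unfolding abelian_lie_def by blast
    then show False using k_simple[OF i] by (simp add: simple_lie_def)
  qed
  ultimately show ?thesis by blast
qed

text \<open>\<open>Y\<close> is a combination of brackets \<open>br U V\<close> in
  \<open>k j\<close>, and \<open>K X (br U V) = K (br X U) V = 0\<close> because the ideals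
  commute.\<close>

lemma k_orthogonal_simple:
  assumes i: "i \<in> {0..s}" and j: "j \<in> {1..s}" and "i \<noteq> j" and X: "X \<in> k i" and Y: "Y \<in> k j"
  shows "K X Y = 0"
proof -
  have j0: "j \<in> {0..s}" using j by simp
  have "K X Z = 0" if "Z \<in> {br U V | U V. U \<in> k j \<and> V \<in> k j}" for Z
  proof -
    from that obtain U V where Z: "Z = br U V" "U \<in> k j" "V \<in> k j" by blast
    then show ?thesis
      using K_invariant[OF k_even[OF i X] k_even[OF j0 Z(2)] k_even[OF j0 Z(3)]]
        k_commute[OF i j0 \<open>i \<noteq> j\<close> X Z(2)] by (simp add: K_linear)
  qed
  then show ?thesis
    using linear_eq_0_on_span[OF linear_K, of "{br U V | U V. U \<in> k j \<and> V \<in> k j}" X Y] k_perfect[OF j] Y by blast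
qed

lemma K_even_sym: "X \<in> gr 0 \<Longrightarrow> Y \<in> gr 0 \<Longrightarrow> K X Y = K Y X"
  using K_supersymmetric[of X 0 Y 0] by (simp add: sgn2_def)

lemma k_orthogonal:
  assumes i: "i \<in> {0..s}" and j: "j \<in> {0..s}" and "i \<noteq> j" and X: "X \<in> k i" and Y: "Y \<in> k j"
  shows "K X Y = 0"
proof (cases "j = 0")
  case True
  then show ?thesis
    using k_orthogonal_simple[OF j _ _ Y X] K_even_sym[OF k_even[OF i X] k_even[OF j Y]] i \<open>i \<noteq> j\<close> by simp
next
  case False
  then show ?thesis using k_orthogonal_simple[OF i _ \<open>i \<noteq> j\<close> X Y] j by simp
qed

lemma K_proj_left:
  assumes i: "i \<in> {0..s}" and X: "X \<in> k i" and Y: "Y \<in> gr 0"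
  shows "K X Y = K X (proj i Y)"
proof -
  have "K X Y = K X (\<Sum>j\<in>{0..s}. proj j Y)" using proj_sum[OF Y] by simp
  also have "\<dots> = (\<Sum>j\<in>{0..s}. if j = i then K X (proj i Y) else 0)"
    unfolding K_sum using k_orthogonal[OF i _ _ X proj_mem] by (intro sum.cong) auto
  finally show ?thesis using i by simp
qed

lemma K_proj_sum:
  assumes X: "X \<in> gr 0" and Y: "Y \<in> gr 0"
  shows "K X Y = (\<Sum>i\<in>{0..s}. K (proj i X) (proj i Y))"
proof -
  have "K X Y = K (\<Sum>i\<in>{0..s}. proj i X) Y" using proj_sum[OF X] by simp
  also have "\<dots> = (\<Sum>i\<in>{0..s}. K (proj i X) (proj i Y))"
    unfolding K_sum using K_proj_left[OF _ proj_mem Y] by (intro sum.cong) auto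
  finally show ?thesis .
qed

lemma proj_symmetric:
  assumes i: "i \<in> {0..s}" and X: "X \<in> gr 0" and Y: "Y \<in> gr 0"
  shows "K (proj i X) Y = K X (proj i Y)"
  using K_proj_left[OF i proj_mem[OF i] Y, of X] K_proj_left[OF i proj_mem[OF i] X, of Y]
    K_even_sym[OF X proj_even[OF i], of Y] K_even_sym[OF proj_even[OF i] proj_even[OF i], of X Y] by simp

lemma k_nondeg: 
  assumes i: "i \<in> {0..s}"
  shows "nondeg_on (k i) K"
  unfolding nondeg_on_def
proof (intro ballI impI)
  fix Y assume Y: "Y \<in> k i" "\<forall>X\<in>k i. K X Y = 0"
  have "K X Y = 0" if "X \<in> gr 0" for X
    using K_proj_left[OF i Y(1) that] K_even_sym[OF that k_even[OF i Y(1)]] 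
      K_even_sym[OF proj_even[OF i] k_even[OF i Y(1)]] Y(2) proj_mem[OF i] by simp
  then show "Y = 0"
    using nondeg_on_K[of 0] k_even[OF i Y(1)] unfolding nondeg_on_def by blast
qed

lemma ex_K_neq_0:
  assumes "nondeg_on V K" "V \<noteq> {0}" "subspace V"
  obtains X Y where "X \<in> V" "Y \<in> V" "K X Y \<noteq> 0"
  using assms subspace_0[of V] unfolding nondeg_on_def by blast

section \<open>Trace forms on the ideals\<close>

lemma K_even_part:
  assumes X: "X \<in> gr 0" and Y: "Y \<in> gr 0"
  shows "K X Y = trace_form br (gr 0) X Y - trace_form br (gr 1) X Y"
  unfolding super_killing_def trace_form_def
  using X Y by (intro supertrace_even) (auto intro: br00)

text \<open>The operator maps \<open>gr 0\<close> into \<open>k i\<close>, so only its block on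
  \<open>k i\<close> contributes to the trace.\<close>

lemma trace_form_k:
  assumes i: "i \<in> {0..s}" and X: "X \<in> k i" and Y: "Y \<in> k i"
  shows "trace_form br (gr 0) X Y = trace_form br (k i) X Y"
  unfolding trace_form_def o_def
  using k_br_left[OF i _ Y] k_br_left[OF i _ X] k_even[OF i]
  by (intro trace_on_commute[where S = "\<lambda>x. x"] subspace_gr k_subspace[OF i] linear_ident linear_br2) blast+

lemma k_nonzero: "i \<in> {1..s} \<Longrightarrow> k i \<noteq> {0}"
  using k_simple[of i] by (auto simp: simple_lie_def abelian_lie_def br_linear)

text \<open>Index 1 would make \<open>K\<close> vanish on \<open>k i\<close>, against its
  nondegeneracy there.\<close>

lemma index_neq_1:
  assumes i: "i \<in> {1..s}"
  shows "l i \<noteq> 1"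
proof
  assume l: "l i = 1"
  have i0: "i \<in> {0..s}" using i by simp
  obtain X Y where XY: "X \<in> k i" "Y \<in> k i" "K X Y \<noteq> 0"
    by (rule ex_K_neq_0[OF k_nondeg[OF i0] k_nonzero[OF i] k_subspace[OF i0]])
  then show False
    using K_even_part[OF k_even[OF i0 XY(1)] k_even[OF i0 XY(2)]] trace_form_k[OF i0 XY(1,2)] index[OF i] l
    by (simp add: is_index_def)
qed

text \<open>The Killing form of \<open>g\<^sub>0\<close> restricted to \<open>k i\<close> is \<open>ratio i\<close> times \<open>K\<close>.\<close>

definition ratio :: "nat \<Rightarrow> real" where
  "ratio i = (if i = 0 then 0 else 1 / (1 - l i))"

lemma even_trace_form_k:
  assumes i: "i \<in> {0..s}" and X: "X \<in> k i" and Y: "Y \<in> k i"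
  shows "trace_form br (gr 0) X Y = ratio i * K X Y"
proof (cases "i = 0")
  case True
  have "br X (br Y Z) = 0" if "Z \<in> gr 0" for Z
    using k0_central[of Y Z] Y that True by (simp add: br_linear)
  then have "trace_form br (gr 0) X Y = trace_on (gr 0) (\<lambda>Z. 0)"
    unfolding trace_form_def by (intro trace_on_cong) (auto simp: subspace_gr subspace_0)
  then show ?thesis using True by (simp add: ratio_def trace_on_zero subspace_gr)
next
  case False
  then have i1: "i \<in> {1..s}" using i by simp
  have "K X Y = (1 - l i) * trace_form br (gr 0) X Y"
    using K_even_part[OF k_even[OF i X] k_even[OF i Y]] trace_form_k[OF i X Y] index[OF i1] X Y
    by (simp add: is_index_def algebra_simps)
  then show ?thesis using index_neq_1[OF i1] False by (simp add: ratio_def)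
qed

lemma odd_trace_form_k:
  assumes i: "i \<in> {0..s}" and X: "X \<in> k i" and Y: "Y \<in> k i"
  shows "trace_form br (gr 1) X Y = (ratio i - 1) * K X Y"
  using even_trace_form_k[OF assms] K_even_part[OF k_even[OF i X] k_even[OF i Y]]
  unfolding left_diff_distrib by linarith

lemma even_trace_form_sum:
  assumes X: "X \<in> gr 0" and Y: "Y \<in> gr 0"
  shows "trace_form br (gr 0) X Y = (\<Sum>i\<in>{0..s}. ratio i * K (proj i X) (proj i Y))"
proof -
  have "br X (br Y Z) = (\<Sum>i\<in>{0..s}. br (proj i X) (br (proj i Y) Z))" if Z: "Z \<in> gr 0" for Z
  proof -
    have Y': "br Y Z = (\<Sum>i\<in>{0..s}. br (proj i Y) Z)"
      using proj_sum[OF Y] by (simp only: br_sum(2)[symmetric])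
    have "br X W = (\<Sum>i\<in>{0..s}. br (proj i X) W)" for W
      using proj_sum[OF X] by (simp only: br_sum(2)[symmetric])
    then have "br X (br Y Z) = (\<Sum>j\<in>{0..s}. \<Sum>i\<in>{0..s}. br (proj i X) (br (proj j Y) Z))"
      unfolding Y' br_sum(1) by (intro sum.cong refl)
    also have "\<dots> = (\<Sum>i\<in>{0..s}. \<Sum>j\<in>{0..s}. br (proj i X) (br (proj j Y) Z))"
      by (rule sum.swap)
    \<comment> \<open>Cross terms vanish: \<open>br (proj j Y) Z\<close> lies in \<open>k j\<close>
      and commutes with \<open>k i\<close>.\<close>
    also have "\<dots> = (\<Sum>i\<in>{0..s}. \<Sum>j\<in>{0..s}. if j = i then br (proj i X) (br (proj i Y) Z) else 0)"
      using k_commute[OF _ _ _ proj_mem k_br_left[OF _ Z proj_mem]] by (intro sum.cong) auto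
    finally show ?thesis by simp
  qed
  then have "trace_form br (gr 0) X Y = trace_on (gr 0) (\<lambda>Z. \<Sum>i\<in>{0..s}. br (proj i X) (br (proj i Y) Z))"
    unfolding trace_form_def o_def
    by (intro trace_on_cong subspace_gr) (auto intro!: subspace_sum subspace_gr br00 proj_even)
  also have "\<dots> = (\<Sum>i\<in>{0..s}. trace_form br (gr 0) (proj i X) (proj i Y))"
    unfolding trace_form_def o_def by (intro trace_on_sum subspace_gr br00 proj_even)
  finally show ?thesis
    using even_trace_form_k[OF _ proj_mem proj_mem] by simp
qed

text \<open>Products of actions of different ideals on \<open>gr 1\<close> need not vanish, so the
  formula is read off from the even trace form and \<open>K\<close>.\<close>

lemma odd_trace_form_sum:
  assumes X: "X \<in> gr 0" and Y: "Y \<in> gr 0"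
  shows "trace_form br (gr 1) X Y = (\<Sum>i\<in>{0..s}. (ratio i - 1) * K (proj i X) (proj i Y))"
  using even_trace_form_sum[OF assms] K_even_part[OF assms] K_proj_sum[OF assms]
  by (simp add: left_diff_distrib sum_subtractf)

lemma k_center:
  assumes i: "i \<in> {1..s}" and Z: "Z \<in> k i" and comm: "\<And>V. V \<in> k i \<Longrightarrow> br Z V = 0"
  shows "Z = 0"
proof -
  have i0: "i \<in> {0..s}" using i by simp
  define C where "C = {Z \<in> k i. \<forall>V\<in>k i. br Z V = 0}"
  have "lie_ideal br (k i) C"
    unfolding lie_ideal_def
  proof (intro conjI ballI)
    show "subspace C"
      using k_subspace[OF i0] unfolding C_def subspace_def by (simp add: br_linear)
    show "br X Y \<in> C" if "X \<in> k i" "Y \<in> C" for X Y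
    proof -
      have "br X Y = 0"
        using that br_swap(1)[OF k_even[OF i0] k_even[OF i0], of Y X] by (simp add: C_def)
      then show ?thesis using \<open>subspace C\<close> subspace_0 by simp
    qed
  qed (auto simp: C_def)
  then have "C = {0} \<or> C = k i" using k_simple[OF i] by (simp add: simple_lie_def)
  moreover have "C \<noteq> k i" using k_simple[OF i] by (auto simp: simple_lie_def abelian_lie_def C_def)
  ultimately show ?thesis using Z comm by (auto simp: C_def)
qed

lemma center_even:
  assumes Z: "Z \<in> gr 0" and comm: "\<And>V. V \<in> gr 0 \<Longrightarrow> br Z V = 0"
  shows "Z \<in> k 0"
proof -
  have "proj i Z = 0" if i: "i \<in> {1..s}" for i
  proof (rule k_center[OF i])
    have i0: "i \<in> {0..s}" using i by simp
    show "proj i Z \<in> k i" by (rule proj_mem[OF i0])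
    show "br (proj i Z) V = 0" if "V \<in> k i" for V
      using proj_br[OF i0 Z k_even[OF i0 that]] comm[OF k_even[OF i0 that]] linear_0[OF linear_proj[OF i0]] by simp
  qed
  then have "(\<Sum>i\<in>{0..s}. proj i Z) = (\<Sum>i\<in>{0..s}. if i = 0 then proj 0 Z else 0)"
    by (intro sum.cong) auto
  then have "Z = proj 0 Z" using proj_sum[OF Z] by simp
  then show ?thesis using proj_mem[of 0 Z] by simp
qed

text \<open>For the condition \<open>centroid\<close>: \<open>k 0\<close> is the centre of
  \<open>gr 0\<close>, which such a \<open>J0\<close> preserves; for \<open>i > 0\<close>,
  \<open>k i\<close> is spanned by its brackets, and \<open>J0 (br X Y) = br (J0 X) Y\<close> stays
  in it.\<close>

lemma casimir_ideal_k:
  assumes i: "i \<in> {0..s}"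
  shows "casimir_ideal gr br (k i) (proj i) (ratio i - 1)"
proof (intro casimir_ideal.intro casimir_ideal_axioms.intro simple_killing_axioms)
  fix J0 V
  assume J0: "linear J0" "\<And>V. V \<in> gr 0 \<Longrightarrow> J0 V \<in> gr 0"
    "\<And>V U. V \<in> gr 0 \<Longrightarrow> U \<in> gr 0 \<Longrightarrow> J0 (br V U) = br (J0 V) U" and V: "V \<in> k i"
  show "J0 V \<in> k i"
  proof (cases "i = 0")
    case True
    have "br (J0 V) W = 0" if W: "W \<in> gr 0" for W
    proof -
      have "br V W = 0" using k0_central V W True by blast
      then show ?thesis using J0(3)[OF k_even[OF i V] W] linear_0[OF J0(1)] by simp
    qed
    then show ?thesis using center_even[OF J0(2)[OF k_even[OF i V]]] True by simp
  next
    case False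
    then have "i \<in> {1..s}" using i by simp
    note perfect = k_perfect[OF this]
    let ?G = "{br X Y | X Y. X \<in> k i \<and> Y \<in> k i}"
    have "J0 ` ?G \<subseteq> k i"
      using J0(2,3) k_br[OF i] k_even[OF i] by auto
    then have "span (J0 ` ?G) \<subseteq> k i"
      by (rule span_minimal[OF _ k_subspace[OF i]])
    then have "J0 ` span ?G \<subseteq> k i"
      unfolding linear_span_image[OF J0(1)] .
    then show ?thesis using perfect V by blast
  qed
next
  show "proj i V = V" if "V \<in> k i" for V using proj_k[OF i i that] by simp
qed (assumption | rule k_subspace[OF i] subsetI k_br[OF i] k_nondeg[OF i] linear_proj[OF i] proj_mem[OF i]
      proj_symmetric[OF i] odd_trace_form_k[OF i] | erule k_even[OF i])+

section \<open>The rescaled metric and its Einstein equations\<close>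

definition scaling :: "(nat \<Rightarrow> real) \<Rightarrow> 'a \<Rightarrow> 'a" where
  "scaling x X = (\<Sum>i\<in>{0..s}. x i *\<^sub>R proj i X) + part gr 1 X"

lemma scaling_even: "X \<in> gr 0 \<Longrightarrow> scaling x X = (\<Sum>i\<in>{0..s}. x i *\<^sub>R proj i X)"
  using part_homogeneous[of X 0 1] by (simp add: scaling_def)

lemma proj_scaling:
  assumes "i \<in> {0..s}" "X \<in> gr 0"
  shows "proj i (scaling x X) = x i *\<^sub>R proj i X"
  unfolding scaling_even[OF assms(2)]
  by (rule proj_unique[OF subspace_scale[OF k_subspace proj_mem] assms(1)])

lemma rescaled_killing_metric_scaling:
  assumes x: "\<And>i. i \<in> {0..s} \<Longrightarrow> x i \<noteq> 0"
  shows "rescaled_killing_metric gr br (scaling x)"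
proof (intro rescaled_killing_metric.intro rescaled_killing_metric_axioms.intro nondegenerate_killing_axioms)
  show "linear (scaling x)"
    unfolding scaling_def
    by (intro linear_compose_add linear_compose_sum linear_compose_scale_right linear_proj linear_part ballI)
  fix X assume X: "X \<in> gr 0"
  show mem: "scaling x X \<in> gr 0"
    unfolding scaling_even[OF X] by (intro subspace_sum subspace_scale subspace_gr proj_even)
  show "X = 0" if "scaling x X = 0"
  proof -
    have "proj i X = 0" if i: "i \<in> {0..s}" for i
      using proj_scaling[OF i X, of x] x[OF i] \<open>scaling x X = 0\<close> linear_0[OF linear_proj[OF i]] by simp
    then show ?thesis using proj_sum[OF X] by simp
  qed
  fix Y assume Y: "Y \<in> gr 0"
  show "scaling x (br X Y) = br (scaling x X) Y"
    unfolding scaling_even[OF br00[OF X Y]] scaling_even[OF X] br_sum br_linear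
    using proj_br[OF _ X Y] by (intro sum.cong) auto
  show "K (scaling x X) Y = K X (scaling x Y)"
    unfolding scaling_even[OF Y] scaling_even[OF X] K_sum K_linear
    using proj_symmetric[OF _ X Y] by (intro sum.cong) auto
next
  fix X assume X: "X \<in> gr 1"
  then show "scaling x X = X"
    using part_homogeneous[OF X, of 1] proj_odd[OF _ X] by (simp add: scaling_def)
qed

lemma rescaled_killing_eq: "rescaled_killing gr br k s x X Y = K (scaling x X) Y"
proof -
  have Y: "K V Y = K V (part gr 0 Y) + K V (part gr 1 Y)" for V
    using part_sum[of Y] K_linear(1) by metis
  have "K (proj i X) Y = K (proj i X) (proj i Y)" if i: "i \<in> {0..s}" for i
  proof -
    have "proj i (part gr 0 Y) = proj i Y"
      using part_homogeneous[OF part_mem, of 0 0 Y] by (simp add: proj_def)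
    then show ?thesis
      using K_proj_left[OF i proj_mem[OF i] part_mem, of X Y] K_mixed[OF proj_even[OF i] part_mem, of 1 X Y] Y[of "proj i X"]
      by simp
  qed
  moreover have "K (part gr 1 X) Y = K (part gr 1 X) (part gr 1 Y)"
    using K_mixed[OF part_mem part_mem, of 1 0 X Y] Y[of "part gr 1 X"] by simp
  ultimately show ?thesis
    unfolding rescaled_killing_def scaling_def proj_def[symmetric] K_linear K_sum by simp
qed

lemma even_trace_scaling:
  assumes X: "X \<in> gr 1" and Y: "Y \<in> gr 1"
  shows "even_trace (scaling x) X Y
    = (\<Sum>i\<in>{0..s}. x i * ((ratio i - 1) * dim (k i) / dim (gr 1))) * K X Y"
proof -
  have mXY: "br X (br Y Z) \<in> gr 0" if "Z \<in> gr 0" for Z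
    by (intro br11 br10 X Y that)
  have "even_trace (scaling x) X Y = trace_on (gr 0) (\<lambda>Z. \<Sum>i\<in>{0..s}. x i *\<^sub>R proj i (br X (br Y Z)))"
    unfolding even_trace_def using scaling_even[OF mXY]
    by (intro trace_on_cong subspace_gr subspace_sum subspace_scale proj_even)
  also have "\<dots> = (\<Sum>i\<in>{0..s}. x i * even_trace (proj i) X Y)"
    unfolding even_trace_def 
    by (subst trace_on_sum; (intro sum.cong trace_on_scale refl)?)
      (intro subspace_gr subspace_scale proj_even; assumption)+
  also have "\<dots> = (\<Sum>i\<in>{0..s}. x i * ((ratio i - 1) * dim (k i) / dim (gr 1) * K X Y))"
    using casimir_ideal.even_trace_scalar[OF casimir_ideal_k X Y] by (intro sum.cong) auto
  finally show ?thesis by (simp add: sum_distrib_right mult.assoc)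
qed

lemma einstein_rescaled_killing_iff:
  assumes x: "\<And>i. i \<in> {0..s} \<Longrightarrow> x i \<noteq> 0"
  shows "einstein gr br (rescaled_killing gr br k s x) c \<longleftrightarrow>
    (\<forall>i\<in>{0..s}. k i \<noteq> {0} \<longrightarrow> - (1/4) * ratio i + (1/4) * (ratio i - 1) * (x i)\<^sup>2 = c * x i) \<and>
    (\<Sum>i\<in>{0..s}. x i * ((ratio i - 1) * dim (k i) / dim (gr 1))) = 2 * c + 1"
    (is "_ \<longleftrightarrow> ?E \<and> ?O")
proof -
  interpret rescaled_killing_metric gr br "scaling x"
    by (rule rescaled_killing_metric_scaling[OF x])
  have g: "rescaled_killing gr br k s x = metric"
    by (intro ext) (simp add: rescaled_killing_eq metric_def)
  \<comment> \<open>The defect of the Einstein equation on \<open>k i\<close>. By orthogonality the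
    even equations become diagonal with these coefficients.\<close>
  define e where "e i = - (1/4) * ratio i + (1/4) * (ratio i - 1) * (x i)\<^sup>2 - c * x i" for i
  have even: "- (1/4) * trace_form br (gr 0) X Y
        + (1/4) * trace_form br (gr 1) (scaling x X) (scaling x Y) - c * K (scaling x X) Y
      = (\<Sum>i\<in>{0..s}. e i * K (proj i X) (proj i Y))" if X: "X \<in> gr 0" and Y: "Y \<in> gr 0" for X Y
  proof -
    have "trace_form br (gr 1) (scaling x X) (scaling x Y)
      = (\<Sum>i\<in>{0..s}. (ratio i - 1) * (x i)\<^sup>2 * K (proj i X) (proj i Y))"
      unfolding odd_trace_form_sum[OF A_even[OF X] A_even[OF Y]]
      using proj_scaling X Y by (intro sum.cong) (auto simp: K_linear power2_eq_square)
    moreover have "K (scaling x X) Y = (\<Sum>i\<in>{0..s}. x i * K (proj i X) (proj i Y))"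
      unfolding K_proj_sum[OF A_even[OF X] Y]
      using proj_scaling X by (intro sum.cong) (auto simp: K_linear)
    ultimately show ?thesis
      unfolding even_trace_form_sum[OF X Y] e_def
      by (simp only: sum_distrib_left sum.distrib[symmetric] sum_subtractf[symmetric])
        (intro sum.cong refl, simp add: algebra_simps)
  qed
  have "(\<forall>X\<in>gr 0. \<forall>Y\<in>gr 0. - (1/4) * trace_form br (gr 0) X Y
        + (1/4) * trace_form br (gr 1) (scaling x X) (scaling x Y) = c * K (scaling x X) Y)
      \<longleftrightarrow> (\<forall>X\<in>gr 0. \<forall>Y\<in>gr 0. (\<Sum>i\<in>{0..s}. e i * K (proj i X) (proj i Y)) = 0)"
    using even by (metis (no_types, lifting) eq_iff_diff_eq_0)
  also have "\<dots> \<longleftrightarrow> (\<forall>i\<in>{0..s}. k i \<noteq> {0} \<longrightarrow> e i = 0)"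
  proof (intro iffI ballI impI)
    fix i assume *: "\<forall>X\<in>gr 0. \<forall>Y\<in>gr 0. (\<Sum>i\<in>{0..s}. e i * K (proj i X) (proj i Y)) = 0"
      and i: "i \<in> {0..s}" "k i \<noteq> {0}"
    \<comment> \<open>A pair from a single ideal isolates its coefficient.\<close>
    obtain X Y where XY: "X \<in> k i" "Y \<in> k i" "K X Y \<noteq> 0"
      by (rule ex_K_neq_0[OF k_nondeg[OF i(1)] i(2) k_subspace[OF i(1)]])
    have "(\<Sum>j\<in>{0..s}. e j * K (proj j X) (proj j Y)) = (\<Sum>j\<in>{0..s}. if j = i then e i * K X Y else 0)"
      using proj_k[OF i(1)] XY by (intro sum.cong) (auto simp: K_linear)
    then show "e i = 0"
      using * k_even[OF i(1)] XY i by simp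
  next
    fix X Y assume e: "\<forall>i\<in>{0..s}. k i \<noteq> {0} \<longrightarrow> e i = 0"
    have "e i * K (proj i X) (proj i Y) = 0" if "i \<in> {0..s}" for i
      using e that proj_mem[OF that, of X] by (cases "k i = {0}") (auto simp: K_linear)
    then show "(\<Sum>i\<in>{0..s}. e i * K (proj i X) (proj i Y)) = 0" by (rule sum.neutral[rule_format])
  qed
  finally have E: "(\<forall>X\<in>gr 0. \<forall>Y\<in>gr 0. - (1/4) * trace_form br (gr 0) X Y
        + (1/4) * trace_form br (gr 1) (scaling x X) (scaling x Y) = c * K (scaling x X) Y) \<longleftrightarrow> ?E"
    by (simp add: e_def)
  obtain X Y where XY: "X \<in> gr 1" "Y \<in> gr 1" "K X Y \<noteq> 0"
    by (rule ex_K_neq_0[OF nondeg_on_K odd_nonzero subspace_gr])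
  have "(\<forall>X\<in>gr 1. \<forall>Y\<in>gr 1. even_trace (scaling x) X Y = (2 * c + 1) * K X Y) \<longleftrightarrow> ?O"
  proof
    assume "\<forall>X\<in>gr 1. \<forall>Y\<in>gr 1. even_trace (scaling x) X Y = (2 * c + 1) * K X Y"
    then show ?O using even_trace_scaling[OF XY(1,2), of x] XY by simp
  next
    assume ?O
    then show "\<forall>X\<in>gr 1. \<forall>Y\<in>gr 1. even_trace (scaling x) X Y = (2 * c + 1) * K X Y"
      using even_trace_scaling[of _ _ x] by simp
  qed
  then show ?thesis
    unfolding g einstein_iff E by simp
qed

lemma einstein_rescaled_killing_iff':
  assumes x: "\<And>i. i \<in> {0..s} \<Longrightarrow> x i \<noteq> 0"
  shows "einstein gr br (rescaled_killing gr br k s x) c \<longleftrightarrow>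
      (k 0 \<noteq> {0} \<longrightarrow> c = - x 0 / 4) \<and>
      (\<forall>i\<in>{1..s}. (1 / 4) * (l i * (x i)\<^sup>2 - 1) = c * (1 - l i) * x i) \<and>
      - (real (dim (k 0)) / real (dim (gr 1))) * x 0
        + (\<Sum>i=1..s. (l i * real (dim (k i))) / ((1 - l i) * real (dim (gr 1))) * x i)
        = 2 * c + 1"
proof -
  let ?e = "\<lambda>i. - (1/4) * ratio i + (1/4) * (ratio i - 1) * (x i)\<^sup>2 = c * x i"
  have e0: "?e 0 \<longleftrightarrow> c = - x 0 / 4"
  proof -
    have "?e 0 \<longleftrightarrow> (- x 0 / 4) * x 0 = c * x 0"
      by (simp add: ratio_def power2_eq_square)
    then show ?thesis using x[of 0] by (simp only: mult_cancel_right) auto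
  qed
  \<comment> \<open>For \<open>i = 0\<close> the value \<open>ratio 0 - 1 = -1\<close> replaces the
    second quotient, which explains the minus signs of the \<open>k 0\<close> terms.\<close>
  have ratio: "ratio i = 1 / (1 - l i)" "ratio i - 1 = l i / (1 - l i)" if i: "i \<in> {1..s}" for i
    using index_neq_1[OF i] i by (auto simp: ratio_def field_simps)
  have ei: "?e i \<longleftrightarrow> (1 / 4) * (l i * (x i)\<^sup>2 - 1) = c * (1 - l i) * x i" if i: "i \<in> {1..s}" for i
  proof -
    \<comment> \<open>Denominators are cleared by the nonzero factor \<open>1 - l i\<close>.\<close>
    have "?e i \<longleftrightarrow> (1 - l i) * (- (1/4) * ratio i + (1/4) * (ratio i - 1) * (x i)\<^sup>2) = (1 - l i) * (c * x i)"
      using index_neq_1[OF i] by simp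
    moreover have "(1 - l i) * ratio i = 1" "(1 - l i) * (ratio i - 1) = l i"
      using ratio[OF i] index_neq_1[OF i] by simp_all
    then have "(1 - l i) * (- (1/4) * ratio i + (1/4) * (ratio i - 1) * (x i)\<^sup>2) = (1 / 4) * (l i * (x i)\<^sup>2 - 1)"
      by algebra
    ultimately have "?e i \<longleftrightarrow> (1 / 4) * (l i * (x i)\<^sup>2 - 1) = (1 - l i) * (c * x i)"
      by (simp only:)
    then show ?thesis by (simp only: mult_ac)
  qed
  have set: "{0..s} = insert 0 {1..s}" by auto
  have "(\<Sum>i\<in>{0..s}. x i * ((ratio i - 1) * dim (k i) / dim (gr 1)))
    = x 0 * ((ratio 0 - 1) * dim (k 0) / dim (gr 1)) + (\<Sum>i=1..s. x i * ((ratio i - 1) * dim (k i) / dim (gr 1)))"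
    unfolding set by simp
  also have "\<dots> = - (real (dim (k 0)) / real (dim (gr 1))) * x 0
        + (\<Sum>i=1..s. (l i * real (dim (k i))) / ((1 - l i) * real (dim (gr 1))) * x i)"
    using ratio(2) by (intro arg_cong2[where f = plus] sum.cong) (auto simp: ratio_def mult_ac)
  finally have S: "(\<Sum>i\<in>{0..s}. x i * ((ratio i - 1) * dim (k i) / dim (gr 1))) = \<dots>" .
  have "(\<forall>i\<in>{0..s}. k i \<noteq> {0} \<longrightarrow> ?e i) \<longleftrightarrow> (k 0 \<noteq> {0} \<longrightarrow> c = - x 0 / 4) \<and>
      (\<forall>i\<in>{1..s}. (1 / 4) * (l i * (x i)\<^sup>2 - 1) = c * (1 - l i) * x i)"
  proof -
    have "(\<forall>i\<in>{1..s}. k i \<noteq> {0} \<longrightarrow> ?e i)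
        \<longleftrightarrow> (\<forall>i\<in>{1..s}. (1 / 4) * (l i * (x i)\<^sup>2 - 1) = c * (1 - l i) * x i)"
    proof (rule ball_cong[OF refl])
      fix i assume i: "i \<in> {1..s}"
      show "(k i \<noteq> {0} \<longrightarrow> ?e i) \<longleftrightarrow> (1 / 4) * (l i * (x i)\<^sup>2 - 1) = c * (1 - l i) * x i"
        using k_nonzero[OF i] ei[OF i] by (simp only: simp_thms)
    qed
    then show ?thesis
      unfolding set by (simp only: ball_simps e0)
  qed
  moreover have "einstein gr br (rescaled_killing gr br k s x) c \<longleftrightarrow>
    (\<forall>i\<in>{0..s}. k i \<noteq> {0} \<longrightarrow> ?e i) \<and>
    (\<Sum>i\<in>{0..s}. x i * ((ratio i - 1) * dim (k i) / dim (gr 1))) = 2 * c + 1"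
    by (rule einstein_rescaled_killing_iff[OF x])
  ultimately show ?thesis
    unfolding S by (simp only: conj_assoc)
qed

end

theorem theorem4p3:
  fixes gr :: "bit \<Rightarrow> 'a::real_vector set"
    and br :: "'a \<Rightarrow> 'a \<Rightarrow> 'a"
    and k :: "nat \<Rightarrow> 'a set"
    and s :: nat
    and x l :: "nat \<Rightarrow> real"
    and c :: real
  assumes "basic_classical gr br"
    and "nondegenerate (super_killing gr br)"
    and "direct_sum {0..s} k (gr 0)"
    and "\<And>i. i \<in> {0..s} \<Longrightarrow> lie_ideal br (gr 0) (k i)"
    and "abelian_lie br (k 0)"
    and "\<And>i. i \<in> {1..s} \<Longrightarrow> simple_lie br (k i)"
    and "\<And>i. i \<in> {0..s} \<Longrightarrow> x i \<noteq> 0"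
    and "\<And>i. i \<in> {1..s} \<Longrightarrow> is_index br (k i) (gr 1) (l i)"
  shows "einstein gr br (rescaled_killing gr br k s x) c \<longleftrightarrow>
      (k 0 \<noteq> {0} \<longrightarrow> c = - x 0 / 4) \<and>
      (\<forall>i\<in>{1..s}. (1 / 4) * (l i * (x i)\<^sup>2 - 1) = c * (1 - l i) * x i) \<and>
      - (real (dim (k 0)) / real (dim (gr 1))) * x 0
        + (\<Sum>i=1..s. (l i * real (dim (k i))) / ((1 - l i) * real (dim (gr 1))) * x i)
        = 2 * c + 1"
proof -
  have sup: "lie_superalgebra gr br" and simple: "simple_superalgebra gr br"
    using assms(1) by (simp_all add: basic_classical_def)
  interpret decomposed_superalgebra gr br k s l
    by (intro decomposed_superalgebra.intro decomposed_superalgebra_axioms.intro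
        simple_killing.intro simple_killing_axioms.intro
        nondegenerate_killing.intro nondegenerate_killing_axioms.intro sup simple)
      (use assms in blast)+
  show ?thesis by (rule einstein_rescaled_killing_iff'[OF assms(7)])
qed

end
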